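(* Let $G=N\rtimes H$, $M$, $\mathcal U$, $H^+$, $D$, $\alpha$, $C=D\rtimes_\alpha H$ and $p=\chi_M$ be as in the context, with $\mathcal U$ having finite quotients, and assume that $H$ is abelian and $N=\bigcup_{a\in H^+}a^{-1}Ma$. For $a\in H^+$ and $m\in M$ put $s_a=pap$ and $p(a,m)=\chi_{maMa^{-1}}$, elements of $pCp$. Then for every SP-family $\{S_a,P(a,m):a\in H^+,m\in M\}$ in a unital $C^*$-algebra $B$ there is a unique homomorphism ($*$-homomorphism) $\Pi:pCp\to B$ such that $$\Pi(s_a)=S_a\ \text{ for all } a\in H^+,\qquad \Pi(p(a,m))=P(a,m)\ \text{ for all } a\in H^+,\ m\in M.$$
   Context: $G=N\rtimes H$ is a discrete group which is a semidirect product with normal subgroup $N$ and quotient group $H$ (regarded as a subgroup of $G$, acting on $N$ by conjugation), and $M\neq\{e\}$ is a normal subgroup of $N$. Put $\mathcal U=\{aMa^{-1}:a\in H\}$. Standing assumptions: (filter base) for all $U,V\in\mathcal U$ there is $W\in\mathcal U$ with $W\subseteq U\cap V$; (separating) $\bigcap_{U\in\mathcal U}U=\{e\}$; (finite quotients) $|U/V|<\infty$ whenever $V\subseteq U$ in $\mathcal U$. Put $H^+=\{a\in H:aMa^{-1}\subseteq M\}$. For $g=xa\in G$ with $x\in N$, $a\in H$, let $\beta_g(y)=xaya^{-1}$ for $y\in N$, and let $\alpha_g(f)=f\circ\beta_{g^{-1}}$ for $f\in\ell^\infty(N)$. $D$ is the $C^*$-subalgebra of $\ell^\infty(N)$ generated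 by the characteristic functions $\chi_{xU}$, $x\in N$, $U\in\mathcal U$; $\alpha$ restricts to actions of $G$ and of $H$ on $D$. $C=D\rtimes_\alpha H$ is the full crossed product; elements of $D$ and $H$ are identified with their images in the multiplier algebra of $C$. $p=\chi_M$, and $pCp$ is unital with unit $p$. An SP-family in a unital $C^*$-algebra $B$ consists of a set $\{S_a:a\in H^+\}$ of isometries ($S_a^*S_a=1$) in $B$ and a set $\{P(a,m):a\in H^+,m\in M\}$ of (self-adjoint) projections in $B$ satisfying, for all $a,b\in H^+$ and $m,k\in M$: (1) $S_aS_b=S_{ab}$; (2) $P(e,e)=1$; (3) $S_aP(b,m)S_a^*=P(ab,ama^{-1})$; (4) $P(a,k)=\sum_{mbMb^{-1}\in M/bMb^{-1}}P(ab,kama^{-1})$. In (4) the sum runs over (finitely many) cosets, $m$ denoting a representative of the coset; the relation is understood to hold for any choice of representatives. *)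

theory Defs
  imports "HOL-Analysis.Analysis" "HOL-Algebra.Coset"
begin

section \<open>C*-algebras\<close>

text \<open>\<^class>\<open>real_normed_algebra\<close> and \<^class>\<open>banach\<close> provide the underlying real Banach algebra; no
  unit is assumed.  In the unital class the zero algebra is not excluded.\<close>

class cstar_algebra = real_normed_algebra + banach +
  fixes scaleC :: "complex \<Rightarrow> 'a \<Rightarrow> 'a"  (infixr \<open>*\<^sub>C\<close> 75)
    and star :: "'a \<Rightarrow> 'a"
  assumes scaleC_of_real: "complex_of_real r *\<^sub>C x = r *\<^sub>R x"
    and scaleC_add_right: "c *\<^sub>C (x + y) = c *\<^sub>C x + c *\<^sub>C y"
    and scaleC_add_left: "(c + d) *\<^sub>C x = c *\<^sub>C x + d *\<^sub>C x"
    and scaleC_scaleC: "c *\<^sub>C (d *\<^sub>C x) = (c * d) *\<^sub>C x"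
    and mult_scaleC_left: "(c *\<^sub>C x) * y = c *\<^sub>C (x * y)"
    and mult_scaleC_right: "x * (c *\<^sub>C y) = c *\<^sub>C (x * y)"
    and norm_scaleC: "norm (c *\<^sub>C x) = cmod c * norm x"
    and star_star: "star (star x) = x"
    and star_add: "star (x + y) = star x + star y"
    and star_scaleC: "star (c *\<^sub>C x) = cnj c *\<^sub>C star x"
    and star_mult: "star (x * y) = star y * star x"
    and cstar_identity: "norm (star x * x) = (norm x)\<^sup>2"

class unital_cstar_algebra = cstar_algebra + monoid_mult

definition isometry_elem :: "'b::unital_cstar_algebra \<Rightarrow> bool" where
  "isometry_elem s \<longleftrightarrow> star s * s = 1"

definition projection_elem :: "'b::cstar_algebra \<Rightarrow> bool" where
  "projection_elem q \<longleftrightarrow> star q = q \<and> q * q = q"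

text \<open>*-homomorphisms defined on a *-subalgebra \<open>A\<close>; neither unitality nor continuity is required.\<close>

definition star_hom_on :: "'c::cstar_algebra set \<Rightarrow> ('c \<Rightarrow> 'b::cstar_algebra) \<Rightarrow> bool" where
  "star_hom_on A \<phi> \<longleftrightarrow>
     (\<forall>x\<in>A. \<forall>y\<in>A. \<phi> (x + y) = \<phi> x + \<phi> y \<and> \<phi> (x * y) = \<phi> x * \<phi> y) \<and>
     (\<forall>x\<in>A. \<forall>c. \<phi> (c *\<^sub>C x) = c *\<^sub>C \<phi> x) \<and>
     (\<forall>x\<in>A. \<phi> (star x) = star (\<phi> x))"

definition corner :: "'c::cstar_algebra \<Rightarrow> 'c set" where
  "corner p = range (\<lambda>x. p * x * p)"

section \<open>Multiplier algebra\<close>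

text \<open>Elements of the multiplier algebra are represented as double centralizers \<open>(L, R)\<close>; the
  products \<open>m c\<close> and \<open>c m\<close> of a multiplier \<open>m = (L, R)\<close> with an element \<open>c\<close> of the algebra are
  \<open>L c\<close> and \<open>R c\<close>.\<close>

type_synonym 'c multiplier = "('c \<Rightarrow> 'c) \<times> ('c \<Rightarrow> 'c)"

definition is_multiplier :: "'c::cstar_algebra multiplier \<Rightarrow> bool" where
  "is_multiplier m \<longleftrightarrow>
     bounded_linear (fst m) \<and> bounded_linear (snd m) \<and>
     (\<forall>c x. fst m (c *\<^sub>C x) = c *\<^sub>C fst m x \<and> snd m (c *\<^sub>C x) = c *\<^sub>C snd m x) \<and>
     (\<forall>x y. fst m (x * y) = fst m x * y \<and> snd m (x * y) = x * snd m y \<and> snd m x * y = x * fst m y)"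

definition mult_embed :: "'c::cstar_algebra \<Rightarrow> 'c multiplier" where
  "mult_embed c = ((\<lambda>x. c * x), (\<lambda>x. x * c))"

definition mult_one :: "'c multiplier" where
  "mult_one = (id, id)"

definition mult_prod :: "'c multiplier \<Rightarrow> 'c multiplier \<Rightarrow> 'c multiplier"  (infixl \<open>\<odot>\<close> 70) where
  "m \<odot> n = (fst m \<circ> fst n, snd n \<circ> snd m)"

definition mult_star :: "'c::cstar_algebra multiplier \<Rightarrow> 'c multiplier" where
  "mult_star m = ((\<lambda>x. star (snd m (star x))), (\<lambda>x. star (fst m (star x))))"

definition unitary_multiplier :: "'c::cstar_algebra multiplier \<Rightarrow> bool" where
  "unitary_multiplier m \<longleftrightarrow>
     is_multiplier m \<and> mult_star m \<odot> m = mult_one \<and> m \<odot> mult_star m = mult_one"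

section \<open>The semidirect product and the conjugates of \<open>M\<close>\<close>

definition conj_set :: "('g, 'm) monoid_scheme \<Rightarrow> 'g \<Rightarrow> 'g set \<Rightarrow> 'g set" where
  "conj_set G a X = (\<lambda>x. a \<otimes>\<^bsub>G\<^esub> x \<otimes>\<^bsub>G\<^esub> inv\<^bsub>G\<^esub> a) ` X"

definition internal_semidirect :: "('g, 'm) monoid_scheme \<Rightarrow> 'g set \<Rightarrow> 'g set \<Rightarrow> bool" where
  "internal_semidirect G N H \<longleftrightarrow>
     group G \<and> N \<lhd> G \<and> subgroup H G \<and> N \<inter> H = {\<one>\<^bsub>G\<^esub>} \<and> N <#>\<^bsub>G\<^esub> H = carrier G"

definition conjugates :: "('g, 'm) monoid_scheme \<Rightarrow> 'g set \<Rightarrow> 'g set \<Rightarrow> 'g set set" where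
  "conjugates G H M = {conj_set G a M | a. a \<in> H}"

definition Hplus :: "('g, 'm) monoid_scheme \<Rightarrow> 'g set \<Rightarrow> 'g set \<Rightarrow> 'g set" where
  "Hplus G H M = {a \<in> H. conj_set G a M \<subseteq> M}"

definition left_cosets_in :: "('g, 'm) monoid_scheme \<Rightarrow> 'g set \<Rightarrow> 'g set \<Rightarrow> 'g set set" where
  "left_cosets_in G U V = {u <#\<^bsub>G\<^esub> V | u. u \<in> U}"

definition filter_base :: "'g set set \<Rightarrow> bool" where
  "filter_base \<U> \<longleftrightarrow> (\<forall>U\<in>\<U>. \<forall>V\<in>\<U>. \<exists>W\<in>\<U>. W \<subseteq> U \<inter> V)"

definition finite_quotients :: "('g, 'm) monoid_scheme \<Rightarrow> 'g set set \<Rightarrow> bool" where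
  "finite_quotients G \<U> \<longleftrightarrow> (\<forall>U\<in>\<U>. \<forall>V\<in>\<U>. V \<subseteq> U \<longrightarrow> finite (left_cosets_in G U V))"

section \<open>The algebra \<open>D\<close> and the action\<close>

text \<open>Functions on \<open>N\<close> are represented by functions on the whole type that vanish outside \<open>N\<close>.\<close>

definition linf :: "'g set \<Rightarrow> ('g \<Rightarrow> complex) set" where
  "linf N = {f. (\<forall>x. x \<notin> N \<longrightarrow> f x = 0) \<and> bounded (range f)}"

definition cstar_subalgebra_linf :: "'g set \<Rightarrow> ('g \<Rightarrow> complex) set \<Rightarrow> bool" where
  "cstar_subalgebra_linf N A \<longleftrightarrow>
     A \<subseteq> linf N \<and> (\<lambda>x. 0) \<in> A \<and>
     (\<forall>f\<in>A. \<forall>g\<in>A. (\<lambda>x. f x + g x) \<in> A \<and> (\<lambda>x. f x * g x) \<in> A) \<and>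
     (\<forall>f\<in>A. \<forall>c. (\<lambda>x. c * f x) \<in> A) \<and>
     (\<forall>f\<in>A. (\<lambda>x. cnj (f x)) \<in> A) \<and>
     (\<forall>F f. (\<forall>n::nat. F n \<in> A) \<longrightarrow> uniform_limit UNIV F f sequentially \<longrightarrow> f \<in> A)"

definition D_alg :: "('g, 'm) monoid_scheme \<Rightarrow> 'g set \<Rightarrow> 'g set \<Rightarrow> 'g set \<Rightarrow> ('g \<Rightarrow> complex) set" where
  "D_alg G N H M =
     \<Inter> {A. cstar_subalgebra_linf N A \<and>
          (\<forall>x\<in>N. \<forall>U\<in>conjugates G H M. indicator (x <#\<^bsub>G\<^esub> U) \<in> A)}"

text \<open>\<open>\<alpha>\<^sub>a f = f \<circ> \<beta>\<^bsub>a\<inverse>\<^esub>\<close> on \<open>N\<close>, where \<open>\<beta>\<^sub>a y = a y a\<inverse>\<close>.  Only the restriction of the action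
  from \<open>G\<close> to \<open>H\<close> enters the crossed product.\<close>

definition beta :: "('g, 'm) monoid_scheme \<Rightarrow> 'g \<Rightarrow> 'g \<Rightarrow> 'g" where
  "beta G a y = a \<otimes>\<^bsub>G\<^esub> y \<otimes>\<^bsub>G\<^esub> inv\<^bsub>G\<^esub> a"

definition alpha :: "('g, 'm) monoid_scheme \<Rightarrow> 'g set \<Rightarrow> 'g \<Rightarrow> ('g \<Rightarrow> complex) \<Rightarrow> 'g \<Rightarrow> complex" where
  "alpha G N a f = (\<lambda>y. if y \<in> N then f (beta G (inv\<^bsub>G\<^esub> a) y) else 0)"

section \<open>The full crossed product\<close>

text \<open>The *-algebra \<open>C\<^sub>c(H, D)\<close> of finitely supported functions; \<open>F\<close> stands for the formal sum
  \<open>\<Sum>h. F h \<delta>\<^sub>h\<close>, subject to \<open>(d \<delta>\<^sub>a) (e \<delta>\<^sub>b) = d \<alpha>\<^sub>a(e) \<delta>\<^bsub>a b\<^esub>\<close> and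
  \<open>(d \<delta>\<^sub>a)\<^sup>* = \<alpha>\<^bsub>a\<inverse>\<^esub>(d\<^sup>*) \<delta>\<^bsub>a\<inverse>\<^esub>\<close>.\<close>

definition fsupp :: "('g \<Rightarrow> 'g \<Rightarrow> complex) \<Rightarrow> 'g set" where
  "fsupp F = {h. F h \<noteq> (\<lambda>y. 0)}"

definition Cc :: "'g set \<Rightarrow> ('g \<Rightarrow> complex) set \<Rightarrow> ('g \<Rightarrow> 'g \<Rightarrow> complex) set" where
  "Cc H D = {F. finite (fsupp F) \<and> fsupp F \<subseteq> H \<and> (\<forall>h\<in>H. F h \<in> D)}"

definition cc_mult ::
  "('g, 'm) monoid_scheme \<Rightarrow> 'g set \<Rightarrow> 'g set \<Rightarrow> ('g \<Rightarrow> 'g \<Rightarrow> complex) \<Rightarrow> ('g \<Rightarrow> 'g \<Rightarrow> complex) \<Rightarrow>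
     'g \<Rightarrow> 'g \<Rightarrow> complex" where
  "cc_mult G N H F K =
     (\<lambda>h y. if h \<in> H
            then (\<Sum>b\<in>fsupp F. F b y * alpha G N b (K (inv\<^bsub>G\<^esub> b \<otimes>\<^bsub>G\<^esub> h)) y) else 0)"

definition cc_star ::
  "('g, 'm) monoid_scheme \<Rightarrow> 'g set \<Rightarrow> 'g set \<Rightarrow> ('g \<Rightarrow> 'g \<Rightarrow> complex) \<Rightarrow> 'g \<Rightarrow> 'g \<Rightarrow> complex" where
  "cc_star G N H F =
     (\<lambda>h. if h \<in> H then alpha G N h (\<lambda>y. cnj (F (inv\<^bsub>G\<^esub> h) y)) else (\<lambda>y. 0))"

definition cc_cstar_seminorm ::
  "('g, 'm) monoid_scheme \<Rightarrow> 'g set \<Rightarrow> 'g set \<Rightarrow> ('g \<Rightarrow> complex) set \<Rightarrow>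
     (('g \<Rightarrow> 'g \<Rightarrow> complex) \<Rightarrow> real) \<Rightarrow> bool" where
  "cc_cstar_seminorm G N H D q \<longleftrightarrow>
     (\<forall>F\<in>Cc H D. 0 \<le> q F) \<and>
     (\<forall>F\<in>Cc H D. \<forall>c. q (\<lambda>h y. c * F h y) = cmod c * q F) \<and>
     (\<forall>F\<in>Cc H D. \<forall>K\<in>Cc H D. q (\<lambda>h y. F h y + K h y) \<le> q F + q K) \<and>
     (\<forall>F\<in>Cc H D. \<forall>K\<in>Cc H D. q (cc_mult G N H F K) \<le> q F * q K) \<and>
     (\<forall>F\<in>Cc H D. q (cc_mult G N H (cc_star G N H F) F) = (q F)\<^sup>2)"

text \<open>A covariant homomorphism \<open>(i\<^sub>D, i\<^sub>H)\<close> of \<open>(D, H, \<alpha>)\<close> into the multiplier algebra; as \<open>H\<close> is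
  discrete, \<open>D\<close> is mapped into the algebra itself.\<close>

definition covariant_hom ::
  "('g, 'm) monoid_scheme \<Rightarrow> 'g set \<Rightarrow> 'g set \<Rightarrow> ('g \<Rightarrow> complex) set \<Rightarrow>
     (('g \<Rightarrow> complex) \<Rightarrow> 'c::cstar_algebra) \<Rightarrow> ('g \<Rightarrow> 'c multiplier) \<Rightarrow> bool" where
  "covariant_hom G N H D iD iH \<longleftrightarrow>
     (\<forall>f\<in>D. \<forall>g\<in>D. iD (\<lambda>x. f x + g x) = iD f + iD g \<and> iD (\<lambda>x. f x * g x) = iD f * iD g) \<and>
     (\<forall>f\<in>D. \<forall>c. iD (\<lambda>x. c * f x) = c *\<^sub>C iD f) \<and>
     (\<forall>f\<in>D. iD (\<lambda>x. cnj (f x)) = star (iD f)) \<and>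
     (\<forall>a\<in>H. unitary_multiplier (iH a)) \<and>
     (\<forall>a\<in>H. \<forall>b\<in>H. iH (a \<otimes>\<^bsub>G\<^esub> b) = iH a \<odot> iH b) \<and>
     (\<forall>a\<in>H. \<forall>f\<in>D. mult_embed (iD (alpha G N a f)) = iH a \<odot> mult_embed (iD f) \<odot> mult_star (iH a))"

definition integrated_form ::
  "(('g \<Rightarrow> complex) \<Rightarrow> 'c::cstar_algebra) \<Rightarrow> ('g \<Rightarrow> 'c multiplier) \<Rightarrow> ('g \<Rightarrow> 'g \<Rightarrow> complex) \<Rightarrow> 'c" where
  "integrated_form iD iH F = (\<Sum>h\<in>fsupp F. snd (iH h) (iD (F h)))"

text \<open>The C*-algebra with carrier type \<open>'c\<close> is, via \<open>(i\<^sub>D, i\<^sub>H)\<close>, the full crossed product of \<open>D\<close> by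
  \<open>H\<close>: the completion of \<open>C\<^sub>c(H, D)\<close> in its largest C*-seminorm.  The seminorm induced by the
  integrated form is itself a C*-seminorm, so the last clause says that it is the largest one.
  C*-seminorms are exactly the functions \<open>F \<mapsto> \<parallel>\<Phi> F\<parallel>\<close> with \<open>\<Phi>\<close> a *-homomorphism of \<open>C\<^sub>c(H, D)\<close>
  into a C*-algebra, so that clause is also universality for covariant homomorphisms, expressed
  without quantifying over all C*-algebras.\<close>

definition full_crossed_product ::
  "('g, 'm) monoid_scheme \<Rightarrow> 'g set \<Rightarrow> 'g set \<Rightarrow> ('g \<Rightarrow> complex) set \<Rightarrow>
     (('g \<Rightarrow> complex) \<Rightarrow> 'c::cstar_algebra) \<Rightarrow> ('g \<Rightarrow> 'c multiplier) \<Rightarrow> bool" where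
  "full_crossed_product G N H D iD iH \<longleftrightarrow>
     covariant_hom G N H D iD iH \<and>
     closure (integrated_form iD iH ` Cc H D) = UNIV \<and>
     (\<forall>q. cc_cstar_seminorm G N H D q \<longrightarrow>
        (\<forall>F\<in>Cc H D. q F \<le> norm (integrated_form iD iH F)))"

section \<open>SP-families\<close>

definition SP_family ::
  "('g, 'm) monoid_scheme \<Rightarrow> 'g set \<Rightarrow> 'g set \<Rightarrow> ('g \<Rightarrow> 'b::unital_cstar_algebra) \<Rightarrow>
     ('g \<Rightarrow> 'g \<Rightarrow> 'b) \<Rightarrow> bool" where
  "SP_family G H M S P \<longleftrightarrow>
     (\<forall>a\<in>Hplus G H M. isometry_elem (S a)) \<and>
     (\<forall>a\<in>Hplus G H M. \<forall>m\<in>M. projection_elem (P a m)) \<and>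
     (\<forall>a\<in>Hplus G H M. \<forall>b\<in>Hplus G H M. S a * S b = S (a \<otimes>\<^bsub>G\<^esub> b)) \<and>
     P \<one>\<^bsub>G\<^esub> \<one>\<^bsub>G\<^esub> = 1 \<and>
     (\<forall>a\<in>Hplus G H M. \<forall>b\<in>Hplus G H M. \<forall>m\<in>M.
        S a * P b m * star (S a) = P (a \<otimes>\<^bsub>G\<^esub> b) (a \<otimes>\<^bsub>G\<^esub> m \<otimes>\<^bsub>G\<^esub> inv\<^bsub>G\<^esub> a)) \<and>
     (\<forall>a\<in>Hplus G H M. \<forall>b\<in>Hplus G H M. \<forall>k\<in>M. \<forall>r.
        (\<forall>c\<in>left_cosets_in G M (conj_set G b M). r c \<in> c) \<longrightarrow>
        P a k = (\<Sum>c\<in>left_cosets_in G M (conj_set G b M).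
                   P (a \<otimes>\<^bsub>G\<^esub> b) (k \<otimes>\<^bsub>G\<^esub> a \<otimes>\<^bsub>G\<^esub> r c \<otimes>\<^bsub>G\<^esub> inv\<^bsub>G\<^esub> a)))"

section \<open>The canonical elements of the corner\<close>

definition p_elem :: "'g set \<Rightarrow> (('g \<Rightarrow> complex) \<Rightarrow> 'c::cstar_algebra) \<Rightarrow> 'c" where
  "p_elem M iD = iD (indicator M)"

text \<open>The product \<open>p a p\<close>, with \<open>a\<close> acting as a multiplier on \<open>p\<close>.\<close>

definition s_elem ::
  "'g set \<Rightarrow> (('g \<Rightarrow> complex) \<Rightarrow> 'c::cstar_algebra) \<Rightarrow> ('g \<Rightarrow> 'c multiplier) \<Rightarrow> 'g \<Rightarrow> 'c" where
  "s_elem M iD iH a = p_elem M iD * fst (iH a) (p_elem M iD)"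

definition pam_elem ::
  "('g, 'm) monoid_scheme \<Rightarrow> 'g set \<Rightarrow> (('g \<Rightarrow> complex) \<Rightarrow> 'c::cstar_algebra) \<Rightarrow> 'g \<Rightarrow> 'g \<Rightarrow> 'c" where
  "pam_elem G M iD a m = iD (indicator (m <#\<^bsub>G\<^esub> conj_set G a M))"

end

theory Submission
  imports Defs
begin

text \<open>
  Write \<open>p = \<chi>\<^sub>M\<close>. Existence of the homomorphism is a statement about norms: on the dense
  subalgebra spanned by the compressed monomials \<open>p d h p\<close> it is forced by the generators, and the point
  is that it is bounded by the norm of the crossed product.

  An SP-family yields a representation \<open>\<phi>\<close> of \<open>D\<close>. A function that is constant on the
  cosets of \<open>b M b\<inverse>\<close> in \<open>M\<close> goes to the corresponding combination of the
  projections \<open>P b m\<close>. The sum formula for \<open>P a k\<close> makes this consistent in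
  \<open>b\<close>; together with \<open>P e e = 1\<close> it shows that the projections of one level have sum one,
  which forces them to be orthogonal (\<open>projections_sum_one_orthogonal\<close>), so the map is multiplicative and
  contractive. Elements of \<open>D\<close> are uniformly continuous along the filter of sections of
  \<open>H\<^sup>+\<close>, whence \<open>\<phi>\<close> is defined on \<open>D\<close> as a limit. It factors through
  restriction to \<open>M\<close>, and \<open>S\<^sub>a \<phi>(f) = \<phi>(\<alpha>\<^sub>a f) S\<^sub>a\<close> by
  the formula for \<open>S\<^sub>a P(b, m) S\<^sub>a\<^sup>*\<close>. Every \<open>h \<in> H\<close> is a quotient
  \<open>a\<inverse> b\<close> of elements of \<open>H\<^sup>+\<close>, and \<open>V\<^sub>h = S\<^sub>a\<^sup>*
  S\<^sub>b\<close> is a partial representation of \<open>H\<close> covariant with respect to \<open>\<phi>\<close>.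

  The compression \<open>F \<mapsto> \<Sum>\<^sub>h \<phi>(F\<^sub>h) V\<^sub>h\<close> of the convolution algebra
  \<open>C\<^sub>c(H, D)\<close> preserves adjoints but not products. Conjugating first by \<open>a \<in>
  H\<^sup>+\<close> replaces \<open>p\<close> by the characteristic function of \<open>a\<inverse> M a\<close>. These
  sets exhaust \<open>N\<close> and elements of \<open>D\<close> vanish at infinity, so the conjugated compressions
  are asymptotically multiplicative, while their norms increase with \<open>a\<close>. The limit of the norms is
  therefore a C*-seminorm (\<open>compr_norm_seminorm\<close>). It is dominated by the norm of the crossed product,
  which is the largest one, and it dominates the norm of the compression at \<open>a = e\<close>. Thus compression
  extends to a contraction \<open>\<Psi>\<close> of the whole crossed product, and \<open>\<Psi>(x) \<Psi>(y) =
  \<Psi>(x p y)\<close> shows that \<open>\<Psi>\<close> is multiplicative on the corner.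

  For uniqueness, a *-homomorphism on the corner is automatically contractive
  (\<open>star_hom_on_corner_contractive\<close>), its values on functions supported in \<open>M\<close> are
  determined by those on cosets, and \<open>p d a\<inverse> b p = (d p) s\<^sub>a\<^sup>* s\<^sub>b\<close>.

  All norm estimates rest on two elementary facts that take the place of spectral theory: \<open>1 - v\<close> has a
  square root if \<open>\<parallel>v\<parallel> < 1\<close>, and \<open>\<parallel>y\<parallel>\<^sup>2 \<le>
  \<parallel>y\<^sup>2 + v\<^sup>2\<parallel>\<close> for commuting self-adjoint \<open>y\<close>, \<open>v\<close>.
\<close>

section \<open>C*-algebras without spectral theory\<close>

lemma scaleC_one [simp]: "1 *\<^sub>C x = (x::'a::cstar_algebra)"
  using scaleC_of_real[of 1 x] by simp

lemma scaleC_zero_left [simp]: "0 *\<^sub>C x = (0::'a::cstar_algebra)"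
  using scaleC_of_real[of 0 x] by simp

lemma scaleC_minus_one: "(-1) *\<^sub>C x = - (x::'a::cstar_algebra)"
  using scaleC_of_real[of "-1" x] by simp

lemma scaleC_zero_right [simp]: "c *\<^sub>C (0::'a::cstar_algebra) = 0"
  using norm_scaleC[of c "0::'a"] by simp

lemma scaleC_minus_right: "c *\<^sub>C (- x) = - (c *\<^sub>C (x::'a::cstar_algebra))"
  by (metis (no_types, lifting) mult.commute scaleC_minus_one scaleC_scaleC)

lemma scaleC_minus_left: "(- c) *\<^sub>C x = - (c *\<^sub>C (x::'a::cstar_algebra))"
  by (metis mult_minus1 scaleC_minus_one scaleC_scaleC)

lemma scaleC_diff_right: "c *\<^sub>C (x - y) = c *\<^sub>C x - c *\<^sub>C (y::'a::cstar_algebra)"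
  by (metis add_uminus_conv_diff scaleC_add_right scaleC_minus_right)

lemma scaleC_diff_left: "(c - d) *\<^sub>C x = c *\<^sub>C x - d *\<^sub>C (x::'a::cstar_algebra)"
  by (metis add_uminus_conv_diff scaleC_add_left scaleC_minus_left)

lemma scaleC_sum_right: "c *\<^sub>C sum f A = (\<Sum>i\<in>A. c *\<^sub>C (f i::'a::cstar_algebra))"
  by (induction A rule: infinite_finite_induct) (auto simp: scaleC_add_right)

lemma scaleC_scaleR: "c *\<^sub>C (r *\<^sub>R x) = r *\<^sub>R (c *\<^sub>C (x::'a::cstar_algebra))"
  by (simp add: scaleC_of_real[symmetric] scaleC_scaleC mult.commute)

lemma bounded_bilinear_scaleC: "bounded_bilinear (\<lambda>c x. c *\<^sub>C (x::'a::cstar_algebra))"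
proof (unfold_locales, goal_cases)
  case (3 r a b)
  have "r *\<^sub>R a = complex_of_real r * a" by (simp add: scaleR_conv_of_real)
  then show ?case by (metis scaleC_of_real scaleC_scaleC)
next
  case 5
  show ?case by (rule exI[of _ 1]) (simp add: norm_scaleC)
qed (auto simp: scaleC_add_right scaleC_add_left scaleC_scaleR)

lemmas tendsto_scaleC [tendsto_intros] = bounded_bilinear.tendsto[OF bounded_bilinear_scaleC]

lemma star_zero [simp]: "star 0 = (0::'a::cstar_algebra)"
  by (metis add.right_neutral add_left_cancel star_add)

lemma star_one [simp]: "star 1 = (1::'a::unital_cstar_algebra)"
  by (metis mult.left_neutral mult.right_neutral star_mult star_star)

lemma star_minus: "star (- x) = - star (x::'a::cstar_algebra)"
  by (metis complex_cnj_minus complex_cnj_one scaleC_minus_one star_scaleC)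

lemma star_diff: "star (x - y) = star x - star (y::'a::cstar_algebra)"
  by (metis add_uminus_conv_diff star_add star_minus)

lemma star_scaleR: "star (r *\<^sub>R x) = r *\<^sub>R star (x::'a::cstar_algebra)"
  by (metis complex_cnj_complex_of_real scaleC_of_real star_scaleC)

lemma star_sum: "star (sum f A) = (\<Sum>i\<in>A. star (f i::'a::cstar_algebra))"
  by (induction A rule: infinite_finite_induct) (auto simp: star_add)

lemma norm_star [simp]: "norm (star x) = norm (x::'a::cstar_algebra)"
proof -
  have le: "norm y \<le> norm (star y)" for y :: 'a
  proof (cases "norm y = 0")
    case False
    have "(norm y)\<^sup>2 \<le> norm (star y) * norm y"
      using norm_mult_ineq[of "star y" y] by (simp add: cstar_identity)
    then show ?thesis using False by (simp add: power2_eq_square)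
  qed auto
  show ?thesis using le[of x] le[of "star x"] by (simp add: star_star)
qed

lemma bounded_linear_star: "bounded_linear (star :: 'a::cstar_algebra \<Rightarrow> 'a)"
  by (rule bounded_linear_intro[where K=1]) (auto simp: star_add star_scaleR)

lemmas tendsto_star [tendsto_intros] = bounded_linear.tendsto[OF bounded_linear_star]

lemma norm_selfadjoint_square: "star y = y \<Longrightarrow> norm (y * y) = (norm (y::'a::cstar_algebra))\<^sup>2"
  by (metis cstar_identity)

lemma norm_projection_le_1:
  assumes "projection_elem (P::'a::cstar_algebra)"
  shows "norm P \<le> 1"
proof -
  have "(norm P)\<^sup>2 = norm P"
    using assms cstar_identity[of P] by (simp add: projection_elem_def)
  then have "norm P * (norm P - 1) = 0" by (simp add: power2_eq_square algebra_simps)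
  then show ?thesis by auto
qed

lemma norm_one_le_1: "norm (1::'a::unital_cstar_algebra) \<le> 1"
  by (rule norm_projection_le_1) (simp add: projection_elem_def)

text \<open>If \<open>y\<close> and \<open>v\<close> are commuting and self-adjoint, then \<open>y\<^sup>2 + v\<^sup>2 = u\<^sup>* u\<close> with
  \<open>u = y + i v\<close>, and \<open>y\<close> is the average of \<open>u\<close> and \<open>u\<^sup>*\<close>.  This replaces
  the monotonicity of the norm on positive elements.\<close>

lemma norm_le_sum_of_squares:
  fixes y v e :: "'a::cstar_algebra"
  assumes "star y = y" "star v = v" "y * v = v * y" "y * y + v * v = e"
  shows "(norm y)\<^sup>2 \<le> norm e"
proof -
  define u where "u = y + \<i> *\<^sub>C v"
  have su: "star u = y - \<i> *\<^sub>C v"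
    by (simp add: u_def star_add star_scaleC assms scaleC_minus_left)
  have "star u * u = e"
    unfolding su by (simp add: u_def algebra_simps mult_scaleC_left mult_scaleC_right scaleC_scaleC
       assms(3) assms(4)[symmetric] scaleC_minus_one scaleC_diff_right)
  then have nu: "(norm u)\<^sup>2 = norm e" by (metis cstar_identity)
  have "2 *\<^sub>R y = u + star u" unfolding su by (simp add: u_def scaleR_2)
  then have "2 * norm y \<le> norm u + norm (star u)" by (metis norm_scaleR norm_triangle_ineq abs_numeral)
  then have "norm y \<le> norm u" by simp
  then show ?thesis using nu by (metis norm_ge_zero power_mono)
qed

text \<open>The contraction \<open>w \<mapsto> (v + w\<^sup>2) / 2\<close> has a fixed point, which is a square root of \<open>1 - v\<close>
  written without a unit: formally \<open>(1 - w)\<^sup>2 = 1 - v\<close>.  The set \<open>K\<close> records whatever closed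
  condition on \<open>v\<close> the root has to inherit.\<close>

lemma square_root_of_one_minus:
  fixes v :: "'a::{real_normed_algebra,banach}"
  assumes v: "norm v < 1" and K: "closed K" "0 \<in> K"
    and step: "\<And>w. w \<in> K \<Longrightarrow> (1/2) *\<^sub>R (v + w * w) \<in> K"
  shows "\<exists>w\<in>K. v = 2 *\<^sub>R w - w * w"
proof -
  \<comment> \<open>the smaller root of \<open>\<parallel>v\<parallel> + r\<^sup>2 = 2 r\<close>, so that the ball of radius \<open>r\<close> is invariant\<close>
  define r where "r = 1 - sqrt (1 - norm v)"
  have r: "0 \<le> r" "r < 1" using v by (auto simp: r_def)
  have r2: "norm v + r * r = 2 * r"
  proof -
    have "sqrt (1 - norm v) * sqrt (1 - norm v) = 1 - norm v" using v by simp
    then show ?thesis by (simp add: r_def algebra_simps)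
  qed
  define f where "f w = (1/2) *\<^sub>R (v + w * w)" for w
  have fK: "f ` (K \<inter> cball 0 r) \<subseteq> K \<inter> cball 0 r"
  proof (rule image_subsetI)
    fix w assume w: "w \<in> K \<inter> cball 0 r"
    then have "norm w \<le> r" by simp
    then have "norm (w * w) \<le> r * r"
      by (meson mult_mono norm_ge_zero norm_mult_ineq order_trans r(1))
    then have "norm (v + w * w) \<le> 2 * r" using norm_triangle_ineq[of v "w*w"] r2 by simp
    then show "f w \<in> K \<inter> cball 0 r" using w step by (simp add: f_def)
  qed
  have lip: "dist (f x) (f y) \<le> r * dist x y" if "x \<in> K \<inter> cball 0 r" "y \<in> K \<inter> cball 0 r" for x y
  proof -
    have "x * x - y * y = x * (x - y) + (x - y) * y" by (simp add: algebra_simps)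
    then have "norm (x * x - y * y) \<le> norm x * norm (x - y) + norm (x - y) * norm y"
      by (simp only:) (intro order_trans[OF norm_triangle_ineq] add_mono norm_mult_ineq)
    also have "\<dots> \<le> r * norm (x - y) + norm (x - y) * r"
      using that r by (intro add_mono mult_mono) auto
    finally have "norm (x * x - y * y) \<le> 2 * (r * norm (x - y))" by (simp add: mult.commute)
    moreover have "f x - f y = (1/2) *\<^sub>R (x * x - y * y)" by (simp add: f_def algebra_simps)
    ultimately show ?thesis by (simp add: dist_norm)
  qed
  have "complete (K \<inter> cball 0 r)" using K by (simp add: complete_eq_closed closed_Int)
  moreover have "K \<inter> cball 0 r \<noteq> {}" using K r by auto
  ultimately obtain w where "w \<in> K" "f w = w"
    using Banach_fix[OF _ _ r fK] lip by blast
  then have "2 *\<^sub>R w = v + w * w" unfolding f_def by (metis scaleR_half_double scaleR_2 scaleR_add_right)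
  then show ?thesis using \<open>w \<in> K\<close> by (intro bexI[of _ w]) (auto simp: algebra_simps)
qed

lemma commute_square:
  fixes w :: "'a::semigroup_mult"
  assumes "w * k = k * w"
  shows "w * w * k = k * (w * w)"
proof -
  have "w * w * k = w * (w * k)" by (simp only: mult.assoc)
  also have "\<dots> = w * k * w" by (subst assms) (simp only: mult.assoc)
  also have "\<dots> = k * w * w" by (simp only: assms)
  finally show ?thesis by (simp only: mult.assoc)
qed

lemma closed_commutant: "closed {w::'a::real_normed_algebra. \<forall>k\<in>Z. w * k = k * w}"
proof -
  have "{w::'a. \<forall>k\<in>Z. w * k = k * w} = (\<Inter>k\<in>Z. {w. w * k = k * w})" by auto
  moreover have "closed {w::'a. w * k = k * w}" for k
    by (rule closed_Collect_eq) (intro continuous_intros)+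
  ultimately show ?thesis by auto
qed

lemma closed_selfadjoint: "closed {w::'a::cstar_algebra. star w = w}"
  by (rule closed_Collect_eq) (intro linear_continuous_on bounded_linear_star continuous_on_id)+

text \<open>A projection \<open>P\<close> is an extreme point of the unit ball of the corner it cuts out.  The square
  roots \<open>y\<^sub>1\<close>, \<open>y\<^sub>2\<close> of \<open>P - t (P - z)\<close> and \<open>P - t (P + z)\<close> exist for \<open>t < 1\<close>, and their squares add
  up to \<open>2 (1 - t) P\<close>.  So \<open>y\<^sub>1\<^sup>2 = (1 - t) P + t z\<close> tends to zero with \<open>t \<rightarrow> 1\<close>.\<close>

lemma projection_extreme:
  fixes P z :: "'a::cstar_algebra"
  assumes P: "projection_elem P" and z: "star z = z" "P * z = z" "z * P = z"
    and n: "norm (P - z) \<le> 1" "norm (P + z) \<le> 1"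
  shows "z = 0"
proof -
  have sP: "star P = P" and PP: "P * P = P" using P by (auto simp: projection_elem_def)
  have root: "\<exists>y. star y = y \<and> y * y = P - v \<and> (\<forall>k. v * k = k * v \<longrightarrow> P * k = k * P \<longrightarrow> y * k = k * y)"
    if v: "norm v < 1" "star v = v" "P * v = v" "v * P = v" for v
  proof -
    \<comment> \<open>the double commutant makes the roots for \<open>z\<close> and \<open>-z\<close> commute with each other\<close>
    define K where "K = {w. star w = w} \<inter> {w. P * w = w} \<inter> {w. w * P = w}
       \<inter> {w. \<forall>k\<in>{k. v * k = k * v}. w * k = k * w}"
    have "closed K" unfolding K_def
      by (intro closed_Int closed_selfadjoint closed_commutant)
         (rule closed_Collect_eq; intro continuous_intros)+
    moreover have "0 \<in> K" by (simp add: K_def)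
    moreover have "(1/2) *\<^sub>R (v + w * w) \<in> K" if w: "w \<in> K" for w
    proof -
      have wK: "star w = w" "P * w = w" "w * P = w"
        and com: "\<And>k. v * k = k * v \<Longrightarrow> w * k = k * w"
        using w unfolding K_def by blast+
      have "w * w * k = k * (w * w)" if "v * k = k * v" for k
        by (rule commute_square[OF com[OF that]])
      then have "(1/2) *\<^sub>R (v + w * w) * k = k * ((1/2) *\<^sub>R (v + w * w))" if "v * k = k * v" for k
        using that by (simp add: distrib_left distrib_right)
      moreover have "P * (w * w) = w * w" by (simp only: wK flip: mult.assoc)
      moreover have "w * w * P = w * w" by (simp only: wK mult.assoc)
      ultimately show ?thesis using v wK(1) unfolding K_def
        by (simp add: star_scaleR star_add star_mult distrib_left distrib_right)
    qed
    ultimately obtain w where w: "w \<in> K" "v = 2 *\<^sub>R w - w * w"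
      using square_root_of_one_minus[OF v(1)] by blast
    have wK: "star w = w" "P * w = w" "w * P = w"
      and com: "\<And>k. v * k = k * v \<Longrightarrow> w * k = k * w"
      using w unfolding K_def by blast+
    have "star (P - w) = P - w" using wK sP by (simp add: star_diff)
    moreover have "(P - w) * (P - w) = P - v"
      using w(2) wK PP by (simp add: algebra_simps scaleR_2)
    moreover have "(P - w) * k = k * (P - w)" if "v * k = k * v" "P * k = k * P" for k
      using com[OF that(1)] that(2) by (simp add: left_diff_distrib right_diff_distrib)
    ultimately show ?thesis by blast
  qed
  have bound: "t * norm z \<le> 3 * (1 - t)" if t: "0 < t" "t < 1" for t :: real
  proof -
    have lt: "norm (t *\<^sub>R (P - z)) < 1" "norm (t *\<^sub>R (P + z)) < 1"
      using t n by (auto intro: le_less_trans[OF mult_left_le])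
    have side: "star (t *\<^sub>R (P - z)) = t *\<^sub>R (P - z)" "P * (t *\<^sub>R (P - z)) = t *\<^sub>R (P - z)"
      "t *\<^sub>R (P - z) * P = t *\<^sub>R (P - z)"
      "star (t *\<^sub>R (P + z)) = t *\<^sub>R (P + z)" "P * (t *\<^sub>R (P + z)) = t *\<^sub>R (P + z)"
      "t *\<^sub>R (P + z) * P = t *\<^sub>R (P + z)"
      by (simp_all add: star_scaleR star_diff star_add sP z PP algebra_simps)
    obtain y1 where y1: "star y1 = y1" "y1 * y1 = P - t *\<^sub>R (P - z)"
      "\<And>k. t *\<^sub>R (P - z) * k = k * (t *\<^sub>R (P - z)) \<Longrightarrow> P * k = k * P \<Longrightarrow> y1 * k = k * y1"
      using root[OF lt(1)] side(1-3) by blast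
    obtain y2 where y2: "star y2 = y2" "y2 * y2 = P - t *\<^sub>R (P + z)"
      "\<And>k. t *\<^sub>R (P + z) * k = k * (t *\<^sub>R (P + z)) \<Longrightarrow> P * k = k * P \<Longrightarrow> y2 * k = k * y2"
      using root[OF lt(2)] side(4-6) by blast
    have c1: "y1 * P = P * y1" by (rule y1(3)) (simp_all add: z algebra_simps)
    have c2: "y1 * z = z * y1" by (rule y1(3)) (simp_all add: z algebra_simps)
    have "y2 * y1 = y1 * y2"
      by (rule y2(3)) (simp_all add: c1 c2 algebra_simps)
    moreover have "y1 * y1 + y2 * y2 = (2 * (1 - t)) *\<^sub>R P"
      by (simp add: y1 y2 algebra_simps scaleR_2 flip: scaleR_add_left)
    ultimately have "(norm y1)\<^sup>2 \<le> norm ((2 * (1 - t)) *\<^sub>R P)"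
      using norm_le_sum_of_squares[OF y1(1) y2(1)] by simp
    also have "\<dots> = 2 * (1 - t) * norm P" using t by simp
    also have "\<dots> \<le> 2 * (1 - t)" using norm_projection_le_1[OF P] t by (simp add: mult_left_le)
    finally have a: "norm (y1 * y1) \<le> 2 * (1 - t)" by (simp add: norm_selfadjoint_square[OF y1(1)])
    have "t *\<^sub>R z = y1 * y1 - (1 - t) *\<^sub>R P" by (simp add: y1 algebra_simps)
    then have "norm (t *\<^sub>R z) \<le> norm (y1 * y1) + norm ((1 - t) *\<^sub>R P)" by (metis norm_triangle_ineq4)
    moreover have "norm ((1 - t) *\<^sub>R P) \<le> 1 - t" using norm_projection_le_1[OF P] t by (simp add: mult_left_le)
    ultimately have "norm (t *\<^sub>R z) \<le> 2 * (1 - t) + (1 - t)"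
      using a by (meson add_mono order_trans)
    then show ?thesis using t by simp
  qed
  have "((\<lambda>t. t * norm z) \<longlongrightarrow> 1 * norm z) (at_left 1)"
    "((\<lambda>t. 3 * (1 - t)) \<longlongrightarrow> 3 * (1 - 1)) (at_left (1::real))"
    by (intro tendsto_intros)+
  moreover have "\<forall>\<^sub>F t in at_left 1. t * norm z \<le> 3 * (1 - t)"
    using eventually_at_left_field[of "\<lambda>t. t * norm z \<le> 3 * (1 - t)" 1] bound
    by (metis zero_less_one)
  ultimately have "1 * norm z \<le> 3 * (1 - 1)"
    using tendsto_le[of "at_left (1::real)"] by fastforce
  then show ?thesis by simp
qed

text \<open>The elements \<open>x\<^sub>k = Q\<^sub>i Q\<^sub>k Q\<^sub>i\<close> with \<open>k \<noteq> i\<close> add up to zero, and each \<open>Q\<^sub>i - x\<^sub>k\<close> lies in the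
  unit ball.  Averaging shows that \<open>Q\<^sub>i + c x\<^sub>j\<close> lies there as well as \<open>Q\<^sub>i - c x\<^sub>j\<close>, and
  \<open>Q\<^sub>i\<close> is extreme.\<close>

lemma projections_sum_one_orthogonal:
  fixes Q :: "'i \<Rightarrow> 'a::unital_cstar_algebra"
  assumes fin: "finite I" and Q: "\<And>i. i \<in> I \<Longrightarrow> projection_elem (Q i)" and one: "sum Q I = 1"
    and ij: "i \<in> I" "j \<in> I" "i \<noteq> j"
  shows "Q i * Q j = 0"
proof -
  define J where "J = I - {i}"
  define x where "x k = Q i * Q k * Q i" for k
  define c where "c = inverse (real (card J))"
  have J: "finite J" "j \<in> J" using fin ij by (auto simp: J_def)
  then have cJ: "0 < card J" by (auto simp: card_gt_0_iff)
  then have c: "0 < c" "c \<le> 1" by (auto simp: c_def field_simps)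
  have Qi: "star (Q i) = Q i" "Q i * Q i = Q i" "norm (Q i) \<le> 1"
    using Q[OF ij(1)] norm_projection_le_1 by (auto simp: projection_elem_def)
  have bnd: "norm (Q i - x k) \<le> 1" if "k \<in> I" for k
  proof -
    have "projection_elem (1 - Q k)" using Q[OF that]
      by (simp add: projection_elem_def star_diff algebra_simps)
    then have nk: "norm (1 - Q k) \<le> 1" by (rule norm_projection_le_1)
    have "Q i - x k = Q i * (1 - Q k) * Q i" by (simp add: x_def Qi algebra_simps)
    also have "norm \<dots> \<le> norm (Q i) * norm (1 - Q k) * norm (Q i)"
      by (meson mult_right_mono norm_ge_zero norm_mult_ineq order_trans)
    also have "\<dots> \<le> 1 * 1 * 1" using Qi(3) nk by (intro mult_mono) auto
    finally show ?thesis by simp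
  qed
  have "(\<Sum>k\<in>J. x k) = 0"
  proof -
    have "Q i * sum Q I * Q i = Q i" by (simp add: one Qi)
    moreover have "sum Q I = Q i + sum Q J" unfolding J_def using fin ij by (simp add: sum.remove)
    ultimately have "Q i * sum Q J * Q i = 0" by (simp add: algebra_simps Qi)
    then show ?thesis by (simp add: x_def sum_distrib_left sum_distrib_right)
  qed
  then have "x j + (\<Sum>k\<in>J-{j}. x k) = 0" using J by (simp add: sum.remove)
  then have xj: "x j = - (\<Sum>k\<in>J-{j}. x k)" by (simp add: eq_neg_iff_add_eq_0)
  have "norm (Q i - c *\<^sub>R x j) \<le> 1"
  proof -
    have "Q i - c *\<^sub>R x j = (1 - c) *\<^sub>R Q i + c *\<^sub>R (Q i - x j)" by (simp add: algebra_simps)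
    also have "norm \<dots> \<le> norm ((1 - c) *\<^sub>R Q i) + norm (c *\<^sub>R (Q i - x j))" by (rule norm_triangle_ineq)
    also have "\<dots> \<le> (1 - c) * 1 + c * 1"
      using c Qi(3) bnd[OF ij(2)] by (intro add_mono) (auto simp: mult_left_le)
    finally show ?thesis by simp
  qed
  moreover have "norm (Q i + c *\<^sub>R x j) \<le> 1"
  proof -
    \<comment> \<open>\<open>Q i + c x\<^sub>j\<close> is the average of \<open>Q i\<close> and the elements \<open>Q i - x\<^sub>k\<close>, \<open>k \<noteq> i, j\<close>\<close>
    have cc: "real (card (J - {j})) * c + c = 1"
    proof -
      have "real (card (J - {j})) + 1 = real (card J)"
        using cJ J by (simp add: card_Diff_singleton of_nat_diff)
      then have "(real (card (J - {j})) + 1) * c = 1" using cJ by (simp add: c_def)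
      then show ?thesis by (simp add: algebra_simps)
    qed
    have "(\<Sum>k\<in>J-{j}. c *\<^sub>R (Q i - x k)) = (real (card (J - {j})) * c) *\<^sub>R Q i + c *\<^sub>R x j"
      unfolding xj by (simp add: scaleR_diff_right sum_subtractf scaleR_sum_right sum_constant_scaleR)
    then have "c *\<^sub>R Q i + (\<Sum>k\<in>J-{j}. c *\<^sub>R (Q i - x k))
        = (real (card (J - {j})) * c + c) *\<^sub>R Q i + c *\<^sub>R x j"
      by (simp only: scaleR_add_left add.assoc add.left_commute)
    then have "Q i + c *\<^sub>R x j = c *\<^sub>R Q i + (\<Sum>k\<in>J-{j}. c *\<^sub>R (Q i - x k))"
      by (simp only: cc scaleR_one)
    also have "norm \<dots> \<le> norm (c *\<^sub>R Q i) + norm (\<Sum>k\<in>J-{j}. c *\<^sub>R (Q i - x k))"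
      by (rule norm_triangle_ineq)
    also have "\<dots> \<le> c + (\<Sum>k\<in>J-{j}. c)"
      using c Qi(3) bnd by (intro add_mono sum_norm_le) (auto simp: J_def mult_left_le)
    also have "\<dots> = 1" using cc by (simp add: mult.commute add.commute)
    finally show ?thesis .
  qed
  moreover have "star (x j) = x j" using Q[OF ij(2)] Qi
    by (simp add: x_def star_mult mult.assoc projection_elem_def)
  moreover have "Q i * x j = x j" "x j * Q i = x j" using Qi
    by (auto simp: x_def mult.assoc) (simp add: mult.assoc[symmetric])
  ultimately have "c *\<^sub>R x j = 0"
    using projection_extreme[OF Q[OF ij(1)], of "c *\<^sub>R x j"]
    by (simp add: star_scaleR)
  then have "x j = 0" using c by simp
  moreover have "star (Q j * Q i) * (Q j * Q i) = x j" using Q[OF ij(2)] Qi(1)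
    by (simp add: x_def star_mult mult.assoc projection_elem_def) (simp add: mult.assoc[symmetric])
  ultimately have "Q j * Q i = 0" by (metis cstar_identity norm_eq_zero power_eq_0_iff)
  then have "star (Q j * Q i) = 0" by simp
  then show ?thesis using Q[OF ij(2)] Qi(1) by (simp add: star_mult projection_elem_def)
qed

lemma corner_iff:
  assumes "projection_elem p"
  shows "x \<in> corner p \<longleftrightarrow> p * x = x \<and> x * p = x"
proof
  assume "x \<in> corner p"
  then obtain y where "x = p * y * p" by (auto simp: corner_def)
  then show "p * x = x \<and> x * p = x"
    using assms by (simp add: projection_elem_def mult.assoc) (simp add: mult.assoc[symmetric])
next
  assume "p * x = x \<and> x * p = x"
  then have "x = p * x * p" by simp
  then show "x \<in> corner p" unfolding corner_def by blast
qed

lemma closed_corner: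
  assumes "projection_elem p"
  shows "closed (corner p)"
proof -
  have "corner p = {x. p * x = x} \<inter> {x. x * p = x}" using corner_iff[OF assms] by auto
  also have "closed \<dots>" by (intro closed_Int closed_Collect_eq continuous_intros)
  finally show ?thesis .
qed

text \<open>Automatic continuity: for a self-adjoint \<open>y\<close> of norm less than one the equation
  \<open>y\<^sup>2 + (1 - w)\<^sup>2 = 1\<close> is solved inside the corner, and a homomorphism carries it to the target,
  where it bounds the image of \<open>y\<close> by one.\<close>

lemma star_hom_on_corner_contractive:
  fixes \<phi> :: "'c::cstar_algebra \<Rightarrow> 'b::unital_cstar_algebra"
  assumes p: "projection_elem p" and hom: "star_hom_on (corner p) \<phi>" and x: "x \<in> corner p"
  shows "norm (\<phi> x) \<le> norm x"
proof -
  note cp = corner_iff[OF p]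
  have add: "\<phi> (x + y) = \<phi> x + \<phi> y" "\<phi> (x * y) = \<phi> x * \<phi> y" if "x \<in> corner p" "y \<in> corner p" for x y
    using hom that by (auto simp: star_hom_on_def)
  have sc: "\<phi> (c *\<^sub>C x) = c *\<^sub>C \<phi> x" and st: "\<phi> (star x) = star (\<phi> x)" if "x \<in> corner p" for x c
    using hom that by (auto simp: star_hom_on_def)
  have scR: "\<phi> (r *\<^sub>R x) = r *\<^sub>R \<phi> x" if "x \<in> corner p" for x r
    using sc[OF that, of "complex_of_real r"] by (simp add: scaleC_of_real)
  have sp: "star p = p" using p by (simp add: projection_elem_def)
  have mem: "star x \<in> corner p" "r *\<^sub>R x \<in> corner p" if "x \<in> corner p" for x r
    using that sp cp star_mult by (metis, simp add: cp)
  have mem2: "x + y \<in> corner p" "x * y \<in> corner p" if "x \<in> corner p" "y \<in> corner p" for x y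
    using that unfolding cp by (auto simp: algebra_simps) (metis mult.assoc)+
  have sa: "norm (\<phi> y) \<le> 1" if y: "y \<in> corner p" "star y = y" "norm y < 1" for y
  proof -
    define K where "K = {w. star w = w} \<inter> corner p \<inter> {w. \<forall>k\<in>{y}. w * k = k * w}"
    have "norm (y * y) < 1" using y by (simp add: norm_selfadjoint_square power_less_one_iff)
    moreover have "closed K" unfolding K_def
      by (intro closed_Int closed_selfadjoint closed_commutant closed_corner p)
    moreover have "0 \<in> K" by (simp add: K_def cp)
    moreover have "(1/2) *\<^sub>R (y * y + w * w) \<in> K" if w: "w \<in> K" for w
    proof -
      have "w * w * y = y * (w * w)" using w by (simp add: K_def mult.assoc) (metis mult.assoc)
      then show ?thesis using w y
        by (auto simp: K_def star_scaleR star_add star_mult mem mem2 algebra_simps)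
    qed
    ultimately obtain w where w: "w \<in> K" "y * y = 2 *\<^sub>R w - w * w"
      using square_root_of_one_minus[of "y * y" K] by blast
    have wc: "w \<in> corner p" "star w = w" "w * y = y * w" using w by (auto simp: K_def)
    have "y * y + w * w = 2 *\<^sub>R w" using w by simp
    then have "\<phi> y * \<phi> y + \<phi> w * \<phi> w = 2 *\<^sub>R \<phi> w"
      using add mem2 scR y wc by metis
    then have "\<phi> y * \<phi> y + (1 - \<phi> w) * (1 - \<phi> w) = 1"
      by (simp add: algebra_simps scaleR_2)
    moreover have "\<phi> y * (1 - \<phi> w) = (1 - \<phi> w) * \<phi> y"
      using add(2) wc y by (simp add: algebra_simps) metis
    moreover have "star (\<phi> y) = \<phi> y" using st y by metis
    moreover have "star (1 - \<phi> w) = 1 - \<phi> w" using st wc by (simp add: star_diff) metis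
    ultimately have "(norm (\<phi> y))\<^sup>2 \<le> norm (1::'b)"
      by (intro norm_le_sum_of_squares)
    then have "(norm (\<phi> y))\<^sup>2 \<le> 1\<^sup>2" using norm_one_le_1[where 'a='b] by simp
    then show ?thesis by (rule power2_le_imp_le) simp
  qed
  have lt: "norm (\<phi> x) \<le> 1" if "x \<in> corner p" "norm x < 1" for x
  proof -
    have "norm (\<phi> (star x * x)) \<le> 1"
      using that by (intro sa mem2 mem) (auto simp: star_mult star_star cstar_identity power_less_one_iff)
    then have "(norm (\<phi> x))\<^sup>2 \<le> 1\<^sup>2"
      using that add mem st by (simp add: cstar_identity)
    then show ?thesis by (rule power2_le_imp_le) simp
  qed
  show ?thesis
  proof (rule field_le_mult_one_interval)
    fix t :: real assume t: "0 < t" "t < 1"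
    show "t * norm (\<phi> x) \<le> norm x"
    proof (cases "norm x = 0")
      case True
      then have "x = 0 *\<^sub>R x" by simp
      then have "\<phi> x = 0" using scR[OF x, of 0] by simp
      then show ?thesis by simp
    next
      case False
      then have "norm (\<phi> ((t / norm x) *\<^sub>R x)) \<le> 1" using x t by (intro lt mem) auto
      then show ?thesis using False t by (simp add: scR[OF x] field_simps)
    qed
  qed
qed

section \<open>Conjugates of \<open>M\<close> and the directed set \<open>H\<^sup>+\<close>\<close>

locale conjugation_setting = group G for G (structure) +
  fixes N H M :: "'a set"
  assumes N_normal: "N \<lhd> G" and H_subgroup: "subgroup H G"
    and M_subgroup: "subgroup M G" and M_subset: "M \<subseteq> N"
    and base: "filter_base (conjugates G H M)"
    and fin: "finite_quotients G (conjugates G H M)"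
    and H_comm: "\<And>a b. a \<in> H \<Longrightarrow> b \<in> H \<Longrightarrow> a \<otimes> b = b \<otimes> a"
    and N_union: "N = (\<Union>a\<in>Hplus G H M. conj_set G (inv a) M)"
begin

abbreviation "Hp \<equiv> Hplus G H M"
abbreviation "D \<equiv> D_alg G N H M"
abbreviation "U a \<equiv> conj_set G a M"
abbreviation "\<alpha> \<equiv> alpha G N"
abbreviation "\<beta> \<equiv> beta G"

lemma H_carrier: "a \<in> H \<Longrightarrow> a \<in> carrier G"
  using H_subgroup subgroup.subset by blast

lemma H_closed: "a \<in> H \<Longrightarrow> b \<in> H \<Longrightarrow> a \<otimes> b \<in> H" "a \<in> H \<Longrightarrow> inv a \<in> H" "\<one> \<in> H"
  using H_subgroup by (auto intro: subgroup.m_closed subgroup.m_inv_closed subgroup.one_closed)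

lemma N_subgroup: "subgroup N G"
  using N_normal by (rule normal_imp_subgroup)

lemma N_carrier: "x \<in> N \<Longrightarrow> x \<in> carrier G"
  using N_subgroup subgroup.subset by blast

lemma N_closed: "x \<in> N \<Longrightarrow> y \<in> N \<Longrightarrow> x \<otimes> y \<in> N" "x \<in> N \<Longrightarrow> inv x \<in> N" "\<one> \<in> N"
  using N_subgroup by (auto intro: subgroup.m_closed subgroup.m_inv_closed subgroup.one_closed)

lemma M_N: "m \<in> M \<Longrightarrow> m \<in> N"
  using M_subset by blast

lemma M_carrier: "m \<in> M \<Longrightarrow> m \<in> carrier G"
  using M_N N_carrier by blast

lemma M_closed: "m \<in> M \<Longrightarrow> k \<in> M \<Longrightarrow> m \<otimes> k \<in> M" "m \<in> M \<Longrightarrow> inv m \<in> M" "\<one> \<in> M"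
  using M_subgroup by (auto intro: subgroup.m_closed subgroup.m_inv_closed subgroup.one_closed)

lemma beta_closed: "a \<in> carrier G \<Longrightarrow> x \<in> carrier G \<Longrightarrow> \<beta> a x \<in> carrier G"
  by (simp add: beta_def)

lemma beta_mult:
  assumes "a \<in> carrier G" "x \<in> carrier G" "y \<in> carrier G"
  shows "\<beta> a (x \<otimes> y) = \<beta> a x \<otimes> \<beta> a y"
proof -
  have "inv a \<otimes> (a \<otimes> (y \<otimes> inv a)) = y \<otimes> inv a" using assms by (simp flip: m_assoc)
  then show ?thesis using assms by (simp add: beta_def m_assoc)
qed

lemma beta_comp: "a \<in> carrier G \<Longrightarrow> b \<in> carrier G \<Longrightarrow> x \<in> carrier G \<Longrightarrow> \<beta> (a \<otimes> b) x = \<beta> a (\<beta> b x)"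
  by (simp add: beta_def inv_mult_group m_assoc)

lemma beta_one: "x \<in> carrier G \<Longrightarrow> \<beta> \<one> x = x"
  by (simp add: beta_def)

lemma beta_of_one: "a \<in> carrier G \<Longrightarrow> \<beta> a \<one> = \<one>"
  by (simp add: beta_def)

lemma beta_cancel:
  assumes "a \<in> carrier G" "x \<in> carrier G"
  shows "\<beta> a (\<beta> (inv a) x) = x" "\<beta> (inv a) (\<beta> a x) = x"
  using assms beta_comp[of a "inv a" x] beta_comp[of "inv a" a x] by (auto simp: beta_one)

lemma beta_inv: "a \<in> carrier G \<Longrightarrow> x \<in> carrier G \<Longrightarrow> \<beta> a (inv x) = inv (\<beta> a x)"
  by (simp add: beta_def inv_mult_group m_assoc)

lemma beta_N: "a \<in> carrier G \<Longrightarrow> x \<in> N \<Longrightarrow> \<beta> a x \<in> N"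
  unfolding beta_def by (rule normal.inv_op_closed2[OF N_normal])

lemma inv_cancel:
  assumes "a \<in> carrier G" "x \<in> carrier G"
  shows "inv a \<otimes> (a \<otimes> x) = x" "a \<otimes> (inv a \<otimes> x) = x"
  using assms by (simp_all flip: m_assoc)

lemma conj_set_eq: "conj_set G a X = \<beta> a ` X"
  by (simp add: conj_set_def beta_def)

lemma mem_U:
  assumes "a \<in> carrier G" "x \<in> carrier G"
  shows "x \<in> U a \<longleftrightarrow> \<beta> (inv a) x \<in> M"
proof
  show "x \<in> U a \<Longrightarrow> \<beta> (inv a) x \<in> M"
    using assms beta_cancel M_carrier by (auto simp: conj_set_eq)
  show "\<beta> (inv a) x \<in> M \<Longrightarrow> x \<in> U a"
    using assms beta_cancel(1) unfolding conj_set_eq by (metis image_eqI)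
qed

lemma U_one: "U \<one> = M"
  by (simp add: conj_set_eq beta_one M_carrier cong: image_cong)

lemma U_N: "a \<in> carrier G \<Longrightarrow> x \<in> U a \<Longrightarrow> x \<in> N"
  by (auto simp: conj_set_eq beta_N M_N)

lemma U_subgroup:
  assumes "a \<in> carrier G"
  shows "subgroup (U a) G"
proof (rule subgroupI)
  show "U a \<subseteq> carrier G" using assms U_N N_carrier by blast
  show "U a \<noteq> {}" using M_closed(3) by (auto simp: conj_set_eq)
  fix x assume x: "x \<in> U a"
  then have xc: "x \<in> carrier G" using assms U_N N_carrier by blast
  show "inv x \<in> U a" using x xc assms by (simp add: mem_U beta_inv M_closed)
  fix y assume y: "y \<in> U a"
  then have yc: "y \<in> carrier G" using assms U_N N_carrier by blast
  show "x \<otimes> y \<in> U a" using x y xc yc assms by (simp add: mem_U beta_mult M_closed)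
qed

lemma beta_U: "a \<in> carrier G \<Longrightarrow> b \<in> carrier G \<Longrightarrow> \<beta> a ` U b = U (a \<otimes> b)"
  by (simp add: conj_set_eq image_image beta_comp M_carrier cong: image_cong)

lemma Hp_iff: "a \<in> Hp \<longleftrightarrow> a \<in> H \<and> (\<forall>m\<in>M. \<beta> a m \<in> M)"
  by (auto simp: Hplus_def conj_set_eq)

lemma Hp_H: "a \<in> Hp \<Longrightarrow> a \<in> H"
  by (simp add: Hp_iff)

lemma Hp_carrier: "a \<in> Hp \<Longrightarrow> a \<in> carrier G"
  by (simp add: Hp_iff H_carrier)

lemma Hp_M: "a \<in> Hp \<Longrightarrow> m \<in> M \<Longrightarrow> \<beta> a m \<in> M"
  by (simp add: Hp_iff)

lemma one_Hp: "\<one> \<in> Hp"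
  by (simp add: Hp_iff H_closed beta_one M_carrier)

lemma mult_Hp: "a \<in> Hp \<Longrightarrow> b \<in> Hp \<Longrightarrow> a \<otimes> b \<in> Hp"
  by (simp add: Hp_iff H_closed H_carrier beta_comp M_carrier)

lemma Hp_comm: "a \<in> Hp \<Longrightarrow> b \<in> Hp \<Longrightarrow> a \<otimes> b = b \<otimes> a"
  using H_comm Hp_H by blast

lemma H_lcomm: "a \<in> H \<Longrightarrow> b \<in> H \<Longrightarrow> c \<in> H \<Longrightarrow> a \<otimes> (b \<otimes> c) = b \<otimes> (a \<otimes> c)"
  by (metis H_carrier H_comm m_assoc)

lemma U_M: "a \<in> Hp \<Longrightarrow> U a \<subseteq> M"
  by (auto simp: conj_set_eq Hp_M)

lemma U_mult_subset: "a \<in> carrier G \<Longrightarrow> b \<in> Hp \<Longrightarrow> U (a \<otimes> b) \<subseteq> U a"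
  using beta_U[of a b] U_M[of b] by (simp add: Hp_carrier) (auto simp: conj_set_eq)

text \<open>The filter base condition says that two conjugates of \<open>M\<close> always contain a third, which for
  \<open>M\<close> and \<open>h M h\<inverse>\<close> amounts to a common denominator for \<open>h\<close> in the monoid \<open>H\<^sup>+\<close>.\<close>

lemma H_quotient:
  assumes h: "h \<in> H"
  obtains a b where "a \<in> Hp" "b \<in> Hp" "h = inv a \<otimes> b"
proof -
  have "M \<in> conjugates G H M" "U h \<in> conjugates G H M"
    using H_closed(3) U_one h by (auto simp: conjugates_def)
  then obtain c where c: "c \<in> H" "U c \<subseteq> M" "U c \<subseteq> U h"
    using base unfolding filter_base_def conjugates_def by blast
  have cp: "c \<in> Hp" using c by (simp add: Hplus_def)
  have "\<beta> (inv h \<otimes> c) m \<in> M" if m: "m \<in> M" for m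
  proof -
    have "\<beta> c m \<in> U h" using c(3) m by (auto simp: conj_set_eq)
    then show ?thesis using m c(1) h
      by (simp add: mem_U beta_comp H_carrier M_carrier beta_closed)
  qed
  then have hp: "inv h \<otimes> c \<in> Hp" using c h by (simp add: Hp_iff H_closed)
  have "h = inv (inv h \<otimes> c) \<otimes> c"
    using h c by (simp add: H_carrier inv_mult_group m_assoc H_comm[of h c] inv_cancel)
  then show ?thesis using that cp hp by blast
qed

text \<open>A property holds eventually if it holds at all multiples of some element: this is the filter
  of sections of \<open>H\<^sup>+\<close> ordered by divisibility.\<close>

definition Hp_filter :: "'a filter" where
  "Hp_filter = (INF b\<in>Hp. principal ((\<lambda>c. b \<otimes> c) ` Hp))"

lemma eventually_multiples: "eventually P Hp_filter \<longleftrightarrow> (\<exists>b\<in>Hp. \<forall>c\<in>Hp. P (b \<otimes> c))"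
proof -
  have "eventually P Hp_filter \<longleftrightarrow> (\<exists>b\<in>Hp. eventually P (principal ((\<lambda>c. b \<otimes> c) ` Hp)))"
    unfolding Hp_filter_def
  proof (rule eventually_INF_base)
    show "Hp \<noteq> {}" using one_Hp by blast
    fix a b assume ab: "a \<in> Hp" "b \<in> Hp"
    have "(a \<otimes> b) \<otimes> c = a \<otimes> (b \<otimes> c)" "(a \<otimes> b) \<otimes> c = b \<otimes> (a \<otimes> c)" if "c \<in> Hp" for c
      using that ab H_lcomm[of a b c] by (auto simp: m_assoc Hp_carrier Hp_H)
    then have "(\<lambda>c. a \<otimes> b \<otimes> c) ` Hp \<subseteq> (\<lambda>c. a \<otimes> c) ` Hp \<inter> (\<lambda>c. b \<otimes> c) ` Hp"
      using ab mult_Hp by (auto simp: image_iff) metis+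
    then show "\<exists>x\<in>Hp. principal ((\<lambda>c. x \<otimes> c) ` Hp)
        \<le> inf (principal ((\<lambda>c. a \<otimes> c) ` Hp)) (principal ((\<lambda>c. b \<otimes> c) ` Hp))"
      using mult_Hp[OF ab] by (intro bexI[of _ "a \<otimes> b"]) auto
  qed
  then show ?thesis by (simp add: eventually_principal)
qed

lemma Hp_filter_nonbot [simp]: "Hp_filter \<noteq> bot"
  using one_Hp by (auto simp: eventually_False[symmetric] eventually_multiples)

lemma eventually_multiplesI: "b \<in> Hp \<Longrightarrow> (\<And>c. c \<in> Hp \<Longrightarrow> P (b \<otimes> c)) \<Longrightarrow> eventually P Hp_filter"
  unfolding eventually_multiples by blast

lemma eventually_in_Hp: "eventually (\<lambda>b. b \<in> Hp) Hp_filter"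
  by (rule eventually_multiplesI[OF one_Hp]) (simp add: Hp_carrier)

lemma filterlim_mult_Hp_filter:
  assumes h: "h \<in> H"
  shows "filterlim (\<lambda>b. h \<otimes> b) Hp_filter Hp_filter"
  unfolding filterlim_iff
proof (intro allI impI)
  fix P assume "eventually P Hp_filter"
  then obtain b where b: "b \<in> Hp" "\<And>c. c \<in> Hp \<Longrightarrow> P (b \<otimes> c)" by (auto simp: eventually_multiples)
  obtain a a' where a: "a \<in> Hp" "a' \<in> Hp" "h = inv a \<otimes> a'" using H_quotient[OF h] .
  show "\<forall>\<^sub>F x in Hp_filter. P (h \<otimes> x)"
  proof (rule eventually_multiplesI)
    show "a \<otimes> b \<in> Hp" using a b by (simp add: mult_Hp)
    fix c assume c: "c \<in> Hp"
    have "h \<otimes> (a \<otimes> b \<otimes> c) = inv a \<otimes> (a' \<otimes> (a \<otimes> (b \<otimes> c)))"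
      using a b c by (simp add: m_assoc Hp_carrier)
    also have "\<dots> = inv a \<otimes> (a \<otimes> (a' \<otimes> (b \<otimes> c)))"
      using a b c by (simp add: H_lcomm[of a' a] Hp_H mult_Hp)
    also have "\<dots> = a' \<otimes> (b \<otimes> c)" using a b c by (simp add: Hp_carrier flip: m_assoc)
    also have "\<dots> = b \<otimes> (a' \<otimes> c)" using a b c by (simp add: H_lcomm Hp_H)
    finally show "P (h \<otimes> (a \<otimes> b \<otimes> c))" using a b c by (simp add: mult_Hp)
  qed
qed

text \<open>The sets \<open>a\<inverse> M a\<close> exhaust \<open>N\<close> and increase with \<open>a\<close>.\<close>

lemma eventually_in_conjugate:
  assumes "x \<in> N"
  shows "\<forall>\<^sub>F a in Hp_filter. \<beta> a x \<in> M"
proof -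
  obtain a where a: "a \<in> Hp" "x \<in> U (inv a)" using assms N_union by blast
  have xc: "x \<in> carrier G" using assms N_carrier by blast
  have "\<beta> a x \<in> M" using a xc mem_U[of "inv a" x] by (simp add: Hp_carrier)
  then show ?thesis using a xc
    by (intro eventually_multiplesI[OF a(1)])
       (metis Hp_M Hp_carrier Hp_comm beta_comp)
qed

lemma eventually_U_subset:
  assumes h: "h \<in> H"
  shows "\<forall>\<^sub>F b in Hp_filter. U b \<subseteq> U h"
proof -
  obtain a a' where a: "a \<in> Hp" "a' \<in> Hp" "h = inv a \<otimes> a'" using H_quotient[OF h] .
  have "a' = h \<otimes> a"
    using a by (simp add: m_assoc Hp_carrier Hp_comm[of a' a] inv_cancel)
  then have "U (a' \<otimes> c) \<subseteq> U h" if "c \<in> Hp" for c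
    using U_mult_subset[of h a] U_mult_subset[of "h \<otimes> a" c] a that h by (auto simp: H_carrier Hp_carrier)
  then show ?thesis by (intro eventually_multiplesI[OF a(2)])
qed

lemma eventually_conjugate_in_M:
  assumes h: "h \<in> H"
  shows "\<forall>\<^sub>F a in Hp_filter. \<forall>x\<in>U h. \<beta> a x \<in> M"
proof -
  have "filterlim (\<lambda>b. h \<otimes> b) Hp_filter Hp_filter" by (rule filterlim_mult_Hp_filter[OF h])
  then have "\<forall>\<^sub>F b in Hp_filter. h \<otimes> b \<in> Hp" using eventually_in_Hp unfolding filterlim_iff by blast
  then show ?thesis using eventually_in_Hp
  proof eventually_elim
    case (elim b)
    show ?case
    proof
      fix x assume "x \<in> U h"
      then obtain m where m: "m \<in> M" "x = \<beta> h m" by (auto simp: conj_set_eq)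
      then have "\<beta> b x = \<beta> (h \<otimes> b) m"
        using elim h by (simp add: beta_comp[symmetric] H_carrier Hp_carrier M_carrier H_comm Hp_H)
      then show "\<beta> b x \<in> M" using elim m by (simp add: Hp_M)
    qed
  qed
qed

subsection \<open>Cosets in \<open>M\<close>\<close>

definition cosets :: "'a \<Rightarrow> 'a set set" where
  "cosets b = left_cosets_in G M (U b)"

definition rep :: "'a set \<Rightarrow> 'a" where
  "rep c = (SOME x. x \<in> c)"

lemma mem_l_coset:
  assumes "a \<in> carrier G" "u \<in> carrier G"
  shows "x \<in> u <#\<^bsub>G\<^esub> U a \<longleftrightarrow> x \<in> carrier G \<and> inv u \<otimes> x \<in> U a"
proof -
  have "x = u \<otimes> (inv u \<otimes> x)" if "x \<in> carrier G" using that assms by (simp flip: m_assoc)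
  moreover have "inv u \<otimes> (u \<otimes> y) = y" "y \<in> carrier G" if "y \<in> U a" for y
    using that assms U_N N_carrier by (auto simp flip: m_assoc)
  ultimately show ?thesis using assms unfolding l_coset_def by auto
qed

lemma self_l_coset: "a \<in> carrier G \<Longrightarrow> u \<in> carrier G \<Longrightarrow> u \<in> u <#\<^bsub>G\<^esub> U a"
  using U_subgroup[of a] by (simp add: mem_l_coset subgroup.one_closed)

lemma l_coset_eqI:
  assumes "a \<in> carrier G" "u \<in> carrier G" "v \<in> u <#\<^bsub>G\<^esub> U a"
  shows "v <#\<^bsub>G\<^esub> U a = u <#\<^bsub>G\<^esub> U a"
  using l_repr_independence[OF assms(3,2) U_subgroup[OF assms(1)]] by simp

lemma cosets_eq:
  assumes "b \<in> Hp" "c \<in> cosets b" "x \<in> c"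
  shows "c = x <#\<^bsub>G\<^esub> U b"
proof -
  obtain u where u: "u \<in> M" "c = u <#\<^bsub>G\<^esub> U b"
    using assms(2) unfolding cosets_def left_cosets_in_def by blast
  show ?thesis
    using l_coset_eqI[of b u x] assms(3) u Hp_carrier[OF assms(1)] M_carrier[OF u(1)] by simp
qed

lemma coset_in_cosets: "x \<in> M \<Longrightarrow> x <#\<^bsub>G\<^esub> U b \<in> cosets b"
  unfolding cosets_def left_cosets_in_def by blast

lemma coset_subset_M:
  assumes "b \<in> Hp" "c \<in> cosets b"
  shows "c \<subseteq> M"
  using assms U_M[of b] M_closed(1) unfolding cosets_def left_cosets_in_def l_coset_def by auto

lemma rep_in:
  assumes "b \<in> Hp" "c \<in> cosets b"
  shows "rep c \<in> c"
proof -
  obtain u where "u \<in> M" "c = u <#\<^bsub>G\<^esub> U b" using assms unfolding cosets_def left_cosets_in_def by blast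
  then have "u \<in> c" using assms by (simp add: self_l_coset Hp_carrier M_carrier)
  then show ?thesis unfolding rep_def by (rule someI)
qed

lemma rep_M: "b \<in> Hp \<Longrightarrow> c \<in> cosets b \<Longrightarrow> rep c \<in> M"
  using rep_in coset_subset_M by blast

lemma finite_cosets:
  assumes "b \<in> Hp"
  shows "finite (cosets b)"
proof -
  have "M \<in> conjugates G H M" "U b \<in> conjugates G H M"
    using H_closed(3) U_one Hp_H[OF assms] by (auto simp: conjugates_def)
  then show ?thesis using fin U_M[OF assms] unfolding finite_quotients_def cosets_def by blast
qed

lemma rep_coset:
  assumes "b \<in> Hp" "x \<in> M"
  shows "rep (x <#\<^bsub>G\<^esub> U b) \<in> M" "inv (rep (x <#\<^bsub>G\<^esub> U b)) \<otimes> x \<in> U b"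
proof -
  let ?c = "x <#\<^bsub>G\<^esub> U b"
  have c: "?c \<in> cosets b" using assms by (simp add: coset_in_cosets)
  show "rep ?c \<in> M" using rep_M assms c by blast
  have "?c = rep ?c <#\<^bsub>G\<^esub> U b" using cosets_eq[OF assms(1) c rep_in[OF assms(1) c]] .
  then have "x \<in> rep ?c <#\<^bsub>G\<^esub> U b" using self_l_coset[of b x] assms by (simp add: Hp_carrier M_carrier)
  then show "inv (rep ?c) \<otimes> x \<in> U b"
    using mem_l_coset[of b "rep ?c" x] assms \<open>rep ?c \<in> M\<close> by (simp add: Hp_carrier M_carrier)
qed

end

section \<open>The function algebra \<open>D\<close>\<close>

lemma linf_iff: "f \<in> linf N \<longleftrightarrow> (\<forall>x. x \<notin> N \<longrightarrow> f x = 0) \<and> (\<exists>B. \<forall>x. cmod (f x) \<le> B)"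
  by (auto simp: linf_def bounded_iff)

lemma linf_bound:
  assumes "f \<in> linf N"
  obtains B where "B \<ge> 1" "\<And>x. cmod (f x) \<le> B"
proof -
  obtain B where B: "\<And>x. cmod (f x) \<le> B" using assms by (auto simp: linf_iff)
  show ?thesis by (rule that[of "max 1 B"]) (auto intro: order_trans[OF B])
qed

lemma linf_subalgebra: "cstar_subalgebra_linf N (linf N)"
  unfolding cstar_subalgebra_linf_def
proof (intro conjI ballI allI impI)
  show "(\<lambda>x. 0) \<in> linf N" by (auto simp: linf_iff)
  fix f g c assume f: "f \<in> linf N" and g: "g \<in> linf N"
  obtain B where B: "B \<ge> 1" "\<And>x. cmod (f x) \<le> B" using linf_bound[OF f] by blast
  obtain C where C: "C \<ge> 1" "\<And>x. cmod (g x) \<le> C" using linf_bound[OF g] by blast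
  have "cmod (f x + g x) \<le> B + C" for x using B C norm_triangle_mono by blast
  then show "(\<lambda>x. f x + g x) \<in> linf N" using f g unfolding linf_iff by (auto intro!: exI[of _ "B + C"])
  have "cmod (f x * g x) \<le> B * C" for x using B C by (auto simp: norm_mult intro!: mult_mono)
  then show "(\<lambda>x. f x * g x) \<in> linf N" using f g unfolding linf_iff by (auto intro!: exI[of _ "B * C"])
next
  fix f c assume f: "f \<in> linf N"
  obtain B where B: "B \<ge> 1" "\<And>x. cmod (f x) \<le> B" using linf_bound[OF f] by blast
  have "cmod (c * f x) \<le> cmod c * B" for x using B by (auto simp: norm_mult intro!: mult_mono)
  then show "(\<lambda>x. c * f x) \<in> linf N" using f unfolding linf_iff by (auto intro!: exI[of _ "cmod c * B"])
next
  fix f assume "f \<in> linf N"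
  then show "(\<lambda>x. cnj (f x)) \<in> linf N" by (auto simp: linf_iff)
next
  fix F :: "nat \<Rightarrow> 'a \<Rightarrow> complex" and f
  assume F: "\<forall>n. F n \<in> linf N" and lim: "uniform_limit UNIV F f sequentially"
  have "\<forall>\<^sub>F n in sequentially. \<forall>x\<in>UNIV. dist (F n x) (f x) < 1"
    using lim by (rule uniform_limitD) simp
  then obtain n where n: "\<And>x. dist (F n x) (f x) < 1"
    by (auto simp: eventually_sequentially)
  obtain B where B: "\<And>x. cmod (F n x) \<le> B" using linf_bound F by metis
  have "cmod (f x) \<le> B + 1" for x
  proof -
    have "cmod (f x) \<le> cmod (F n x) + dist (F n x) (f x)"
      by (simp add: dist_norm norm_minus_commute norm_triangle_sub)
    then show ?thesis using B[of x] n[of x] by linarith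
  qed
  moreover have "f x = 0" if "x \<notin> N" for x
  proof -
    have "(\<lambda>n. F n x) \<longlonglongrightarrow> f x" using lim tendsto_uniform_limitI by fastforce
    moreover have "(\<lambda>n. F n x) = (\<lambda>n. 0)" using F that by (auto simp: linf_iff)
    ultimately show ?thesis using LIMSEQ_unique[of "\<lambda>n. 0" "f x" 0] by simp
  qed
  ultimately show "f \<in> linf N" unfolding linf_iff by blast
qed auto

context
  fixes N :: "'g set" and A
  assumes A: "cstar_subalgebra_linf N A"
begin

lemma sub_linf: "f \<in> A \<Longrightarrow> f \<in> linf N"
  and sub_zero: "(\<lambda>x. 0) \<in> A"
  and sub_add: "f \<in> A \<Longrightarrow> g \<in> A \<Longrightarrow> (\<lambda>x. f x + g x) \<in> A"
  and sub_mult: "f \<in> A \<Longrightarrow> g \<in> A \<Longrightarrow> (\<lambda>x. f x * g x) \<in> A"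
  and sub_scale: "f \<in> A \<Longrightarrow> (\<lambda>x. c * f x) \<in> A"
  and sub_cnj: "f \<in> A \<Longrightarrow> (\<lambda>x. cnj (f x)) \<in> A"
  and sub_lim: "(\<And>n::nat. F n \<in> A) \<Longrightarrow> uniform_limit UNIV F h sequentially \<Longrightarrow> h \<in> A"
  using A unfolding cstar_subalgebra_linf_def by blast+

lemma sub_diff: "f \<in> A \<Longrightarrow> g \<in> A \<Longrightarrow> (\<lambda>x. f x - g x) \<in> A"
  using sub_add[OF _ sub_scale[of g "-1"]] by simp

lemma sub_sum: "(\<And>i. i \<in> I \<Longrightarrow> F i \<in> A) \<Longrightarrow> (\<lambda>x. \<Sum>i\<in>I. F i x) \<in> A"
proof (induction I rule: infinite_finite_induct)
  case (insert i I)
  then show ?case using sub_add[of "F i" "\<lambda>x. \<Sum>i\<in>I. F i x"] by simp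
qed (auto simp: sub_zero)

end

text \<open>Evaluation at a point, where \<open>None\<close> plays the role of a point at infinity at which all
  functions vanish.  It makes vanishing at infinity an instance of small oscillation.\<close>

fun at_point :: "('g \<Rightarrow> complex) \<Rightarrow> 'g option \<Rightarrow> complex" where
  "at_point f None = 0"
| "at_point f (Some x) = f x"

definition small_oscillation :: "'i filter \<Rightarrow> ('i \<Rightarrow> ('g option \<times> 'g option) set) \<Rightarrow> ('g \<Rightarrow> complex) \<Rightarrow> bool" where
  "small_oscillation F E f \<longleftrightarrow>
     (\<forall>e>0. \<forall>\<^sub>F b in F. \<forall>(x, y)\<in>E b. cmod (at_point f x - at_point f y) \<le> e)"

lemma small_oscillationD:
  "small_oscillation F E f \<Longrightarrow> e > 0 \<Longrightarrow> \<forall>\<^sub>F b in F. \<forall>(x, y)\<in>E b. cmod (at_point f x - at_point f y) \<le> e"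
  unfolding small_oscillation_def by blast

text \<open>Evaluation at a pair of points is multiplicative, so small oscillation along any filter is
  inherited by sums, products and uniform limits.\<close>

lemma small_oscillation_subalgebra:
  "cstar_subalgebra_linf N {f \<in> linf N. small_oscillation F E f}" (is "cstar_subalgebra_linf N ?A")
  unfolding cstar_subalgebra_linf_def
proof (intro conjI ballI allI impI)
  note L = linf_subalgebra[of N]
  have at0: "at_point (\<lambda>x. 0) o' = 0" for o' by (cases o') auto
  show "?A \<subseteq> linf N" by blast
  show "(\<lambda>x. 0) \<in> ?A" using sub_zero[OF L] by (auto simp: small_oscillation_def at0)
  fix f assume f: "f \<in> ?A"
  have fl: "f \<in> linf N" and fo: "small_oscillation F E f" using f by auto
  {
    fix g assume g: "g \<in> ?A"
    have gl: "g \<in> linf N" and go: "small_oscillation F E g" using g by auto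
    have ap: "at_point (\<lambda>x. f x + g x) o' = at_point f o' + at_point g o'"
      "at_point (\<lambda>x. f x * g x) o' = at_point f o' * at_point g o'" for o' by (cases o'; simp)+
    obtain B1 where B1: "B1 \<ge> 1" "\<And>x. cmod (f x) \<le> B1" using linf_bound[OF fl] by blast
    obtain B2 where B2: "B2 \<ge> 1" "\<And>x. cmod (g x) \<le> B2" using linf_bound[OF gl] by blast
    have bf: "cmod (at_point f o') \<le> B1" and bg: "cmod (at_point g o') \<le> B2" for o'
      using B1 B2 by (cases o'; simp)+
    have "small_oscillation F E (\<lambda>x. f x + g x)"
      unfolding small_oscillation_def
    proof (intro allI impI)
      fix e :: real assume "e > 0"
      then have "e/2 > 0" by simp
      note small_oscillationD[OF fo this] small_oscillationD[OF go this]
      then show "\<forall>\<^sub>F b in F. \<forall>(x, y)\<in>E b. cmod (at_point (\<lambda>x. f x + g x) x - at_point (\<lambda>x. f x + g x) y) \<le> e"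
      proof eventually_elim
        case (elim b)
        show ?case
        proof clarify
          fix x y assume "(x, y) \<in> E b"
          then have "cmod (at_point f x - at_point f y) \<le> e/2" "cmod (at_point g x - at_point g y) \<le> e/2"
            using elim by blast+
          then have "cmod ((at_point f x - at_point f y) + (at_point g x - at_point g y)) \<le> e/2 + e/2"
            by (rule norm_triangle_mono)
          then show "cmod (at_point (\<lambda>x. f x + g x) x - at_point (\<lambda>x. f x + g x) y) \<le> e"
            by (simp add: ap algebra_simps)
        qed
      qed
    qed
    then show "(\<lambda>x. f x + g x) \<in> ?A" using sub_add[OF L fl gl] by simp
    have "small_oscillation F E (\<lambda>x. f x * g x)"
      unfolding small_oscillation_def
    proof (intro allI impI)
      fix e :: real assume e: "e > 0"
      then have "e/(2*B2) > 0" "e/(2*B1) > 0" using B1 B2 by auto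
      then have "\<forall>\<^sub>F b in F. \<forall>(x, y)\<in>E b. cmod (at_point f x - at_point f y) \<le> e/(2*B2)"
        "\<forall>\<^sub>F b in F. \<forall>(x, y)\<in>E b. cmod (at_point g x - at_point g y) \<le> e/(2*B1)"
        using small_oscillationD[OF fo] small_oscillationD[OF go] by blast+
      then show "\<forall>\<^sub>F b in F. \<forall>(x, y)\<in>E b. cmod (at_point (\<lambda>x. f x * g x) x - at_point (\<lambda>x. f x * g x) y) \<le> e"
      proof eventually_elim
        case (elim b)
        show ?case
        proof clarify
          fix x y assume "(x, y) \<in> E b"
          then have d: "cmod (at_point f x - at_point f y) \<le> e/(2*B2)" "cmod (at_point g x - at_point g y) \<le> e/(2*B1)"
            using elim by blast+
          have "at_point f x * at_point g x - at_point f y * at_point g y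
            = at_point f x * (at_point g x - at_point g y) + (at_point f x - at_point f y) * at_point g y"
            by (simp add: algebra_simps)
          also have "cmod \<dots> \<le> B1 * (e/(2*B1)) + e/(2*B2) * B2"
            using bf bg d B1 B2 e by (intro norm_triangle_mono) (auto simp only: norm_mult intro!: mult_mono norm_ge_zero; simp)+
          also have "\<dots> = e" using B1 B2 by (simp add: field_simps)
          finally show "cmod (at_point (\<lambda>x. f x * g x) x - at_point (\<lambda>x. f x * g x) y) \<le> e"
            by (simp add: ap)
        qed
      qed
    qed
    then show "(\<lambda>x. f x * g x) \<in> ?A" using sub_mult[OF L fl gl] by simp
  }
  show "(\<lambda>x. c * f x) \<in> ?A" for c
  proof -
    have ap: "at_point (\<lambda>x. c * f x) o' = c * at_point f o'" for o' by (cases o') auto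
    have "small_oscillation F E (\<lambda>x. c * f x)"
      unfolding small_oscillation_def
    proof (intro allI impI)
      fix e :: real assume e: "e > 0"
      have "e / (cmod c + 1) > 0" using e by (simp add: add_nonneg_pos)
      then have "\<forall>\<^sub>F b in F. \<forall>(x, y)\<in>E b. cmod (at_point f x - at_point f y) \<le> e / (cmod c + 1)"
        using fo unfolding small_oscillation_def by blast
      then show "\<forall>\<^sub>F b in F. \<forall>(x, y)\<in>E b. cmod (at_point (\<lambda>x. c * f x) x - at_point (\<lambda>x. c * f x) y) \<le> e"
      proof eventually_elim
        case (elim b)
        show ?case
        proof clarify
          fix x y assume "(x, y) \<in> E b"
          then have "cmod c * cmod (at_point f x - at_point f y) \<le> (cmod c + 1) * (e / (cmod c + 1))"
            using elim by (intro mult_mono) auto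
          also have "\<dots> = e" using norm_ge_zero[of c] by (intro nonzero_mult_div_cancel_left[THEN trans[OF times_divide_eq_right]]) linarith
          finally show "cmod (at_point (\<lambda>x. c * f x) x - at_point (\<lambda>x. c * f x) y) \<le> e"
            by (simp add: ap norm_mult flip: right_diff_distrib)
        qed
      qed
    qed
    then show ?thesis using sub_scale[OF L fl] by simp
  qed
  have "at_point (\<lambda>x. cnj (f x)) o' = cnj (at_point f o')" for o' by (cases o') auto
  then have "cmod (at_point (\<lambda>x. cnj (f x)) x - at_point (\<lambda>x. cnj (f x)) y) = cmod (at_point f x - at_point f y)" for x y
    by (metis complex_cnj_diff complex_mod_cnj)
  then show "(\<lambda>x. cnj (f x)) \<in> ?A" using fo sub_cnj[OF L fl] by (simp add: small_oscillation_def)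
next
  note L = linf_subalgebra[of N]
  fix S :: "nat \<Rightarrow> 'a \<Rightarrow> complex" and f
  assume S: "\<forall>n. S n \<in> ?A" and lim: "uniform_limit UNIV S f sequentially"
  have "small_oscillation F E f"
    unfolding small_oscillation_def
  proof (intro allI impI)
    fix e :: real assume e: "e > 0"
    have "\<forall>\<^sub>F n in sequentially. \<forall>x\<in>UNIV. dist (S n x) (f x) < e/3"
      using lim by (rule uniform_limitD) (use e in simp)
    then obtain n where n: "\<And>x. dist (S n x) (f x) < e/3" by (auto simp: eventually_sequentially)
    have n': "cmod (at_point f o' - at_point (S n) o') \<le> e/3" for o'
      using n less_imp_le e by (cases o') (auto simp: dist_norm norm_minus_commute)
    have "\<forall>\<^sub>F b in F. \<forall>(x, y)\<in>E b. cmod (at_point (S n) x - at_point (S n) y) \<le> e/3"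
      using S small_oscillationD[of F E "S n" "e/3"] e by auto
    then show "\<forall>\<^sub>F b in F. \<forall>(x, y)\<in>E b. cmod (at_point f x - at_point f y) \<le> e"
    proof eventually_elim
      case (elim b)
      show ?case
      proof clarify
        fix x y assume "(x, y) \<in> E b"
        then have d: "cmod (at_point (S n) x - at_point (S n) y) \<le> e/3" using elim by blast
        have "cmod (at_point f x - at_point (S n) x + (at_point (S n) x - at_point (S n) y)
            + - (at_point f y - at_point (S n) y)) \<le> e/3 + e/3 + e/3"
          using d n'[of x] n'[of y] by (intro norm_triangle_mono) (simp_all only: norm_minus_cancel)
        then show "cmod (at_point f x - at_point f y) \<le> e" by simp
      qed
    qed
  qed
  then show "f \<in> ?A" using sub_lim[OF L _ lim] S by simp
qed

context conjugation_setting
begin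

lemma l_coset_N: "x \<in> N \<Longrightarrow> a \<in> H \<Longrightarrow> x <#\<^bsub>G\<^esub> U a \<subseteq> N"
  unfolding l_coset_def by (blast intro: N_closed(1) U_N H_carrier)

lemma D_least:
  assumes "cstar_subalgebra_linf N A" "\<And>x a. x \<in> N \<Longrightarrow> a \<in> H \<Longrightarrow> indicator (x <#\<^bsub>G\<^esub> U a) \<in> A"
  shows "D \<subseteq> A"
  unfolding D_alg_def by (rule Inter_lower) (use assms in \<open>auto simp: conjugates_def\<close>)

lemma indicator_linf: "X \<subseteq> N \<Longrightarrow> indicator X \<in> linf N"
  by (auto simp: linf_iff indicator_def intro!: exI[of _ 1])

lemma D_subalgebra: "cstar_subalgebra_linf N D"
proof -
  have "D \<subseteq> linf N"
    by (rule D_least[OF linf_subalgebra]) (auto intro!: indicator_linf dest: l_coset_N)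
  then show ?thesis
    unfolding cstar_subalgebra_linf_def D_alg_def by blast
qed

lemmas D_linf = sub_linf[OF D_subalgebra]
  and D_zero = sub_zero[OF D_subalgebra]
  and D_add = sub_add[OF D_subalgebra]
  and D_mult = sub_mult[OF D_subalgebra]
  and D_scale = sub_scale[OF D_subalgebra]
  and D_cnj = sub_cnj[OF D_subalgebra]
  and D_lim = sub_lim[OF D_subalgebra]
  and D_diff = sub_diff[OF D_subalgebra]
  and D_sum = sub_sum[OF D_subalgebra]

lemma D_outside: "f \<in> D \<Longrightarrow> x \<notin> N \<Longrightarrow> f x = 0"
  using D_linf linf_iff by blast

lemma indicator_D: "x \<in> N \<Longrightarrow> a \<in> H \<Longrightarrow> indicator (x <#\<^bsub>G\<^esub> U a) \<in> D"
  unfolding D_alg_def by (auto simp: conjugates_def)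

lemma indicator_U_D: "a \<in> H \<Longrightarrow> indicator (U a) \<in> D"
proof -
  assume a: "a \<in> H"
  have "\<one> \<otimes> u = u" if "u \<in> U a" for u
    using N_carrier[OF U_N[OF H_carrier[OF a] that]] by simp
  then have "\<one> <#\<^bsub>G\<^esub> U a = U a" by (simp add: l_coset_def)
  then show ?thesis using indicator_D[of \<one> a] a N_closed by simp
qed

lemma indicator_M_D: "indicator M \<in> D"
  using indicator_U_D[of \<one>] by (simp add: H_closed U_one)

text \<open>The sets \<open>a\<inverse> M a\<close> exhaust \<open>N\<close>, and each coset lies in one of them.\<close>

lemma D_vanishes_at_infinity:
  assumes f: "f \<in> D" and e: "e > 0"
  shows "\<forall>\<^sub>F a in Hp_filter. \<forall>y\<in>N. \<beta> a y \<notin> M \<longrightarrow> cmod (f y) \<le> e"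
proof -
  define E where "E a = (\<lambda>y. (Some y, None :: 'a option)) ` {y \<in> N. \<beta> a y \<notin> M}" for a
  have "D \<subseteq> {f \<in> linf N. small_oscillation Hp_filter E f}"
  proof (rule D_least[OF small_oscillation_subalgebra])
    fix x h assume xh: "x \<in> N" "h \<in> H"
    have "\<forall>\<^sub>F a in Hp_filter. \<forall>y\<in>N. \<beta> a y \<notin> M \<longrightarrow> indicator (x <#\<^bsub>G\<^esub> U h) y = (0::complex)"
      using eventually_in_conjugate[OF xh(1)] eventually_conjugate_in_M[OF xh(2)] eventually_in_Hp
    proof eventually_elim
      case (elim a)
      have "\<beta> a (x \<otimes> u) \<in> M" if "u \<in> U h" for u
        using that elim xh U_N[of h u] by (simp add: beta_mult M_closed Hp_carrier N_carrier H_carrier)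
      then have "\<beta> a y \<in> M" if "y \<in> x <#\<^bsub>G\<^esub> U h" for y using that by (auto simp: l_coset_def)
      then show ?case by (auto simp: indicator_def)
    qed
    then have "small_oscillation Hp_filter E (indicator (x <#\<^bsub>G\<^esub> U h))"
      unfolding small_oscillation_def by (auto simp: E_def elim!: eventually_mono)
    then show "indicator (x <#\<^bsub>G\<^esub> U h) \<in> {f \<in> linf N. small_oscillation Hp_filter E f}"
      using indicator_linf[OF l_coset_N[OF xh]] by simp
  qed
  then have "\<forall>\<^sub>F a in Hp_filter. \<forall>(x, y)\<in>E a. cmod (at_point f x - at_point f y) \<le> e"
    using f e unfolding small_oscillation_def by blast
  then show ?thesis by (rule eventually_mono) (auto simp: E_def)
qed

text \<open>A coset of \<open>h M h\<inverse>\<close> is a union of cosets of \<open>b M b\<inverse>\<close> once \<open>b M b\<inverse> \<subseteq> h M h\<inverse>\<close>, so its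
  characteristic function does not oscillate at all on small scales.\<close>

lemma D_uniformly_continuous:
  assumes f: "f \<in> D" and e: "e > 0"
  shows "\<forall>\<^sub>F b in Hp_filter. \<forall>x\<in>N. \<forall>y\<in>N. inv x \<otimes> y \<in> U b \<longrightarrow> cmod (f x - f y) \<le> e"
proof -
  define E where "E b = map_prod Some Some ` {(x, y). x \<in> N \<and> y \<in> N \<and> inv x \<otimes> y \<in> U b}" for b
  have "D \<subseteq> {f \<in> linf N. small_oscillation Hp_filter E f}"
  proof (rule D_least[OF small_oscillation_subalgebra])
    fix z h assume zh: "z \<in> N" "h \<in> H"
    have "\<forall>\<^sub>F b in Hp_filter. \<forall>x\<in>N. \<forall>y\<in>N. inv x \<otimes> y \<in> U b \<longrightarrow> indicator (z <#\<^bsub>G\<^esub> U h) x = (indicator (z <#\<^bsub>G\<^esub> U h) y :: complex)"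
      using eventually_U_subset[OF zh(2)]
    proof eventually_elim
      case (elim b)
      have "x \<in> z <#\<^bsub>G\<^esub> U h \<longleftrightarrow> y \<in> z <#\<^bsub>G\<^esub> U h" if xy: "x \<in> N" "y \<in> N" "inv x \<otimes> y \<in> U b" for x y
      proof -
        have c: "x \<in> carrier G" "y \<in> carrier G" "z \<in> carrier G" "h \<in> carrier G"
          using xy zh N_carrier H_carrier by auto
        have u: "inv x \<otimes> y \<in> U h" using xy elim by blast
        have e1: "inv z \<otimes> y = (inv z \<otimes> x) \<otimes> (inv x \<otimes> y)" using c by (simp add: m_assoc inv_cancel)
        have e2: "inv z \<otimes> x = (inv z \<otimes> y) \<otimes> inv (inv x \<otimes> y)"
          using c by (simp add: m_assoc inv_cancel inv_mult_group)
        note S = U_subgroup[OF c(4)]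
        have "inv z \<otimes> x \<in> U h \<longleftrightarrow> inv z \<otimes> y \<in> U h"
          using e1 e2 u subgroup.m_closed[OF S] subgroup.m_inv_closed[OF S] by metis
        then show ?thesis using c by (simp add: mem_l_coset)
      qed
      then show ?case by (auto simp: indicator_def)
    qed
    then have "small_oscillation Hp_filter E (indicator (z <#\<^bsub>G\<^esub> U h))"
      unfolding small_oscillation_def by (auto simp: E_def elim!: eventually_mono)
    then show "indicator (z <#\<^bsub>G\<^esub> U h) \<in> {f \<in> linf N. small_oscillation Hp_filter E f}"
      using indicator_linf[OF l_coset_N[OF zh]] by simp
  qed
  then have "\<forall>\<^sub>F a in Hp_filter. \<forall>(x, y)\<in>E a. cmod (at_point f x - at_point f y) \<le> e"
    using f e unfolding small_oscillation_def by blast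
  then show ?thesis by (rule eventually_mono) (auto simp: E_def)
qed

subsection \<open>The action of \<open>H\<close>\<close>

lemma alpha_add: "\<alpha> a (\<lambda>x. f x + g x) = (\<lambda>x. \<alpha> a f x + \<alpha> a g x)"
  and alpha_mult: "\<alpha> a (\<lambda>x. f x * g x) = (\<lambda>x. \<alpha> a f x * \<alpha> a g x)"
  and alpha_scale: "\<alpha> a (\<lambda>x. c * f x) = (\<lambda>x. c * \<alpha> a f x)"
  and alpha_cnj: "\<alpha> a (\<lambda>x. cnj (f x)) = (\<lambda>x. cnj (\<alpha> a f x))"
  and alpha_diff: "\<alpha> a (\<lambda>x. f x - g x) = (\<lambda>x. \<alpha> a f x - \<alpha> a g x)"
  and alpha_zero: "\<alpha> a (\<lambda>x. 0) = (\<lambda>x. 0)"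
  and alpha_sum: "\<alpha> a (\<lambda>x. \<Sum>i\<in>I. F i x) = (\<lambda>x. \<Sum>i\<in>I. \<alpha> a (F i) x)"
  by (auto simp: alpha_def)

lemma alpha_comp: "a \<in> carrier G \<Longrightarrow> b \<in> carrier G \<Longrightarrow> \<alpha> a (\<alpha> b f) = \<alpha> (a \<otimes> b) f"
  by (auto simp: alpha_def beta_N inv_mult_group beta_comp N_carrier)

lemma alpha_one: "f \<in> D \<Longrightarrow> \<alpha> \<one> f = f"
  by (auto simp: alpha_def beta_one N_carrier D_outside)

lemma alpha_indicator:
  assumes "a \<in> carrier G" "X \<subseteq> N"
  shows "\<alpha> a (indicator X) = indicator (\<beta> a ` X)"
proof
  fix y
  show "\<alpha> a (indicator X) y = indicator (\<beta> a ` X) y"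
  proof (cases "y \<in> N")
    case True
    then have y: "y \<in> carrier G" by (rule N_carrier)
    have "\<beta> (inv a) y \<in> X \<longleftrightarrow> y \<in> \<beta> a ` X"
    proof
      assume "\<beta> (inv a) y \<in> X"
      then show "y \<in> \<beta> a ` X" using beta_cancel(1)[OF assms(1) y] by (metis image_eqI)
    next
      assume "y \<in> \<beta> a ` X"
      then show "\<beta> (inv a) y \<in> X" using beta_cancel(2)[OF assms(1)] assms(2) N_carrier by auto
    qed
    then show ?thesis using True by (simp add: alpha_def indicator_def)
  next
    case False
    then have "y \<notin> \<beta> a ` X" using assms beta_N by blast
    then show ?thesis using False by (simp add: alpha_def)
  qed
qed

lemma beta_l_coset:
  assumes "a \<in> carrier G" "b \<in> carrier G" "x \<in> carrier G"
  shows "\<beta> a ` (x <#\<^bsub>G\<^esub> U b) = \<beta> a x <#\<^bsub>G\<^esub> U (a \<otimes> b)"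
proof -
  have "\<beta> a ` (x <#\<^bsub>G\<^esub> U b) = (\<lambda>u. \<beta> a x \<otimes> \<beta> a u) ` U b"
    unfolding l_coset_def using assms U_N N_carrier by (auto simp: image_iff beta_mult)
  also have "\<dots> = \<beta> a x <#\<^bsub>G\<^esub> (\<beta> a ` U b)" by (auto simp: l_coset_def)
  finally show ?thesis using beta_U assms by simp
qed

lemma alpha_indicator_coset:
  "a \<in> H \<Longrightarrow> b \<in> H \<Longrightarrow> x \<in> N \<Longrightarrow> \<alpha> a (indicator (x <#\<^bsub>G\<^esub> U b)) = indicator (\<beta> a x <#\<^bsub>G\<^esub> U (a \<otimes> b))"
  by (simp add: alpha_indicator l_coset_N H_carrier beta_l_coset N_carrier)

lemma alpha_indicator_M: "a \<in> H \<Longrightarrow> \<alpha> a (indicator M) = indicator (U a)"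
  by (simp add: alpha_indicator M_subset H_carrier conj_set_eq)

lemma alpha_bound: "0 \<le> K \<Longrightarrow> (\<And>x. cmod (f x) \<le> K) \<Longrightarrow> cmod (\<alpha> a f y) \<le> K"
  by (simp add: alpha_def)

lemma alpha_D:
  assumes a: "a \<in> H" and f: "f \<in> D"
  shows "\<alpha> a f \<in> D"
proof -
  have "D \<subseteq> {f \<in> linf N. \<alpha> a f \<in> D}" (is "_ \<subseteq> ?A")
  proof (rule D_least)
    show "cstar_subalgebra_linf N ?A"
      unfolding cstar_subalgebra_linf_def
    proof (intro conjI ballI allI impI)
      note L = linf_subalgebra[of N]
      fix F :: "nat \<Rightarrow> 'a \<Rightarrow> complex" and f
      assume F: "\<forall>n. F n \<in> ?A" and lim: "uniform_limit UNIV F f sequentially"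
      have "uniform_limit UNIV (\<lambda>n. \<alpha> a (F n)) (\<alpha> a f) sequentially"
      proof (rule uniform_limitI)
        fix e :: real assume "e > 0"
        then have "\<forall>\<^sub>F n in sequentially. \<forall>x\<in>UNIV. dist (F n x) (f x) < e"
          using uniform_limitD[OF lim] by blast
        then show "\<forall>\<^sub>F n in sequentially. \<forall>x\<in>UNIV. dist (\<alpha> a (F n) x) (\<alpha> a f x) < e"
          by (rule eventually_mono) (use \<open>e > 0\<close> in \<open>auto simp: alpha_def\<close>)
      qed
      then show "f \<in> ?A" using F sub_lim[OF L _ lim] D_lim[of "\<lambda>n. \<alpha> a (F n)"] by auto
    next
      note L = linf_subalgebra[of N]
      show "(\<lambda>x. 0) \<in> ?A" using sub_zero[OF L] by (simp add: alpha_zero D_zero)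
      fix f assume f: "f \<in> ?A"
      show "(\<lambda>x. c * f x) \<in> ?A" for c
        using f sub_scale[OF L, of f c] by (simp add: alpha_scale D_scale)
      show "(\<lambda>x. cnj (f x)) \<in> ?A" using f sub_cnj[OF L, of f] by (simp add: alpha_cnj D_cnj)
      fix g assume g: "g \<in> ?A"
      show "(\<lambda>x. f x + g x) \<in> ?A" "(\<lambda>x. f x * g x) \<in> ?A"
        using f g sub_add[OF L, of f g] sub_mult[OF L, of f g]
        by (simp_all add: alpha_add alpha_mult D_add D_mult)
    qed blast
    fix x b assume "x \<in> N" "b \<in> H"
    then show "indicator (x <#\<^bsub>G\<^esub> U b) \<in> ?A" using a
      by (simp add: indicator_linf l_coset_N alpha_indicator_coset indicator_D beta_N H_carrier H_closed)
  qed
  then show ?thesis using f by blast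
qed

end

section \<open>The representation of \<open>D\<close> defined by an SP-family\<close>

locale sp_setting = conjugation_setting G N H M for G (structure) and N H M :: "'a set" +
  fixes S :: "'a \<Rightarrow> 'u::unital_cstar_algebra" and P :: "'a \<Rightarrow> 'a \<Rightarrow> 'u"
  assumes SP: "SP_family G H M S P"
begin

lemma S_isometry: "a \<in> Hp \<Longrightarrow> star (S a) * S a = 1"
  and P_projection: "a \<in> Hp \<Longrightarrow> m \<in> M \<Longrightarrow> projection_elem (P a m)"
  and S_mult: "a \<in> Hp \<Longrightarrow> b \<in> Hp \<Longrightarrow> S a * S b = S (a \<otimes> b)"
  and P_one: "P \<one> \<one> = 1"
  using SP unfolding SP_family_def isometry_elem_def by blast+

lemma S_P_conj: "a \<in> Hp \<Longrightarrow> b \<in> Hp \<Longrightarrow> m \<in> M \<Longrightarrow> S a * P b m * star (S a) = P (a \<otimes> b) (\<beta> a m)"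
  using SP unfolding SP_family_def beta_def by blast

lemma P_refine:
  assumes "a \<in> Hp" "b \<in> Hp" "k \<in> M" and r: "\<And>c. c \<in> cosets b \<Longrightarrow> r c \<in> c"
  shows "P a k = (\<Sum>c\<in>cosets b. P (a \<otimes> b) (k \<otimes> \<beta> a (r c)))"
proof -
  have "P a k = (\<Sum>c\<in>cosets b. P (a \<otimes> b) (k \<otimes> a \<otimes> r c \<otimes> inv a))"
    using SP assms unfolding SP_family_def cosets_def by blast
  also have "\<dots> = (\<Sum>c\<in>cosets b. P (a \<otimes> b) (k \<otimes> \<beta> a (r c)))"
  proof (rule sum.cong)
    fix c assume "c \<in> cosets b"
    then have "r c \<in> carrier G" using r coset_subset_M[OF assms(2)] M_carrier by blast
    then show "P (a \<otimes> b) (k \<otimes> a \<otimes> r c \<otimes> inv a) = P (a \<otimes> b) (k \<otimes> \<beta> a (r c))"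
      using assms by (simp add: beta_def m_assoc Hp_carrier M_carrier)
  qed simp
  finally show ?thesis .
qed

lemma norm_S: "a \<in> Hp \<Longrightarrow> norm (S a) \<le> 1"
proof -
  assume "a \<in> Hp"
  then have "(norm (S a))\<^sup>2 \<le> 1\<^sup>2" using norm_one_le_1[where 'a='u] by (simp add: S_isometry flip: cstar_identity)
  then show ?thesis by (rule power2_le_imp_le) simp
qed

lemma S_one: "S \<one> = 1"
proof -
  have "S \<one> * S \<one> = S \<one>" using S_mult[OF one_Hp one_Hp] by simp
  then have "star (S \<one>) * S \<one> * S \<one> = star (S \<one>) * S \<one>" by (simp add: mult.assoc)
  then show ?thesis by (simp add: S_isometry one_Hp)
qed

lemma S_S_star:
  assumes "a \<in> Hp"
  shows "S a * star (S a) = P a \<one>"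
  using S_P_conj[OF assms one_Hp M_closed(3)] assms by (simp add: P_one Hp_carrier beta_of_one)

lemma S_P:
  assumes "a \<in> Hp" "b \<in> Hp" "m \<in> M"
  shows "S a * P b m = P (a \<otimes> b) (\<beta> a m) * S a"
proof -
  have "P (a \<otimes> b) (\<beta> a m) * S a = S a * P b m * (star (S a) * S a)"
    unfolding S_P_conj[OF assms, symmetric] by (simp only: mult.assoc)
  then show ?thesis using assms by (simp add: S_isometry)
qed

text \<open>For \<open>b = e\<close> the sum has one term, whose representative is arbitrary: the projections depend
  on the coset only.\<close>

lemma P_depends_on_coset:
  assumes "a \<in> Hp" "x \<in> M" "y \<in> M" "inv x \<otimes> y \<in> U a"
  shows "P a y = P a x"
proof -
  have x: "x \<in> carrier G" "y \<in> carrier G" using assms M_carrier by auto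
  obtain m where m: "m \<in> M" "inv x \<otimes> y = \<beta> a m" using assms(4) by (auto simp: conj_set_eq)
  have y: "y = x \<otimes> \<beta> a m" using x by (simp add: inv_cancel flip: m(2))
  have "cosets \<one> = {\<one> <#\<^bsub>G\<^esub> U \<one>}"
  proof
    show "{\<one> <#\<^bsub>G\<^esub> U \<one>} \<subseteq> cosets \<one>" using coset_in_cosets M_closed(3) by blast
    show "cosets \<one> \<subseteq> {\<one> <#\<^bsub>G\<^esub> U \<one>}"
    proof
      fix c assume c: "c \<in> cosets \<one>"
      then obtain u where u: "u \<in> M" "c = u <#\<^bsub>G\<^esub> U \<one>" unfolding cosets_def left_cosets_in_def by blast
      then have "\<one> \<in> c" using mem_l_coset[of \<one> u \<one>] by (simp add: M_carrier U_one M_closed)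
      then show "c \<in> {\<one> <#\<^bsub>G\<^esub> U \<one>}" using cosets_eq[OF one_Hp c] by simp
    qed
  qed
  moreover have "m \<in> c" if "c \<in> cosets \<one>" for c
  proof -
    have "c = \<one> <#\<^bsub>G\<^esub> U \<one>" using that calculation by blast
    then show ?thesis using m mem_l_coset[of \<one> \<one> m] by (simp add: M_carrier U_one)
  qed
  ultimately have "P a x = P (a \<otimes> \<one>) (x \<otimes> \<beta> a m)"
    using P_refine[OF assms(1) one_Hp assms(2), of "\<lambda>c. m"] by simp
  then show ?thesis using y assms(1) by (simp add: Hp_carrier)
qed

lemma P_rep:
  assumes "b \<in> Hp" "m \<in> M"
  shows "P b (rep (m <#\<^bsub>G\<^esub> U b)) = P b m"
  using P_depends_on_coset[OF assms(1) rep_coset(1)[OF assms] assms(2) rep_coset(2)[OF assms]] by simp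

lemma sum_P: "b \<in> Hp \<Longrightarrow> (\<Sum>c\<in>cosets b. P b (rep c)) = 1"
proof -
  assume b: "b \<in> Hp"
  have "P \<one> \<one> = (\<Sum>c\<in>cosets b. P (\<one> \<otimes> b) (\<one> \<otimes> \<beta> \<one> (rep c)))"
    using P_refine[OF one_Hp b M_closed(3), of rep] rep_in[OF b] by simp
  also have "\<dots> = (\<Sum>c\<in>cosets b. P b (rep c))"
    using b rep_M by (intro sum.cong) (auto simp: beta_one M_carrier Hp_carrier)
  finally show ?thesis by (simp add: P_one)
qed

lemma P_orthogonal:
  assumes "b \<in> Hp" "c \<in> cosets b" "d \<in> cosets b" "c \<noteq> d"
  shows "P b (rep c) * P b (rep d) = 0"
  by (rule projections_sum_one_orthogonal[where Q="\<lambda>c. P b (rep c)" and I="cosets b"])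
     (use assms in \<open>auto simp: finite_cosets P_projection rep_M sum_P\<close>)

subsection \<open>Functions on finite quotients of \<open>M\<close>\<close>

text \<open>The representation at level \<open>b\<close> samples \<open>f\<close> at one point of each coset.  It is thereby a
  *-homomorphism defined on arbitrary functions, and the choice of points is immaterial in the limit
  for uniformly continuous ones.\<close>

definition sampled :: "'a \<Rightarrow> ('a \<Rightarrow> complex) \<Rightarrow> 'u" where
  "sampled b f = (\<Sum>c\<in>cosets b. f (rep c) *\<^sub>C P b (rep c))"

lemma sampled_cong: "b \<in> Hp \<Longrightarrow> (\<And>x. x \<in> M \<Longrightarrow> f x = g x) \<Longrightarrow> sampled b f = sampled b g"
  unfolding sampled_def using rep_M by (intro sum.cong) auto

lemma sampled_add: "sampled b (\<lambda>x. f x + g x) = sampled b f + sampled b g"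
  by (simp add: sampled_def scaleC_add_left sum.distrib)

lemma sampled_diff: "sampled b (\<lambda>x. f x - g x) = sampled b f - sampled b g"
  by (simp add: sampled_def scaleC_diff_left sum_subtractf)

lemma sampled_scale: "sampled b (\<lambda>x. c * f x) = c *\<^sub>C sampled b f"
  by (simp add: sampled_def scaleC_sum_right scaleC_scaleC)

lemma sampled_sum: "sampled b (\<lambda>x. \<Sum>i\<in>I. F i x) = (\<Sum>i\<in>I. sampled b (F i))"
proof (induction I rule: infinite_finite_induct)
  case (insert i I)
  then show ?case using sampled_add[of b "F i" "\<lambda>x. \<Sum>i\<in>I. F i x"] by simp
qed (auto simp: sampled_def)

lemma sampled_star: "b \<in> Hp \<Longrightarrow> sampled b (\<lambda>x. cnj (f x)) = star (sampled b f)"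
  unfolding sampled_def star_sum using P_projection rep_M
  by (intro sum.cong) (auto simp: star_scaleC projection_elem_def)

lemma sampled_mult:
  assumes b: "b \<in> Hp"
  shows "sampled b (\<lambda>x. f x * g x) = sampled b f * sampled b g"
proof -
  have "sampled b f * sampled b g = (\<Sum>c\<in>cosets b. \<Sum>d\<in>cosets b.
      (f (rep c) * g (rep d)) *\<^sub>C (P b (rep c) * P b (rep d)))"
    by (simp add: sampled_def sum_product mult_scaleC_left mult_scaleC_right scaleC_scaleC mult.commute)
  also have "\<dots> = (\<Sum>c\<in>cosets b. \<Sum>d\<in>cosets b.
      if d = c then (f (rep c) * g (rep c)) *\<^sub>C P b (rep c) else 0)"
    using P_projection[OF b rep_M[OF b]]
    by (intro sum.cong) (auto simp: P_orthogonal[OF b] projection_elem_def)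
  also have "\<dots> = sampled b (\<lambda>x. f x * g x)"
    using finite_cosets[OF b] by (simp add: sampled_def)
  finally show ?thesis by simp
qed

lemma sampled_const: "b \<in> Hp \<Longrightarrow> sampled b (\<lambda>x. c) = c *\<^sub>C 1"
  by (simp add: sampled_def sum_P flip: scaleC_sum_right)

text \<open>For real \<open>g\<close> with \<open>\<bar>g\<bar> \<le> L\<close> the function \<open>v = sqrt (L\<^sup>2 - g\<^sup>2)\<close> satisfies
  \<open>g\<^sup>2 + v\<^sup>2 = L\<^sup>2\<close>; the C*-identity reduces the general case to \<open>\<bar>f\<bar>\<^sup>2\<close>.\<close>

lemma sampled_bound:
  assumes b: "b \<in> Hp" and f: "\<And>x. x \<in> M \<Longrightarrow> cmod (f x) \<le> K"
  shows "norm (sampled b f) \<le> K"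
proof -
  have real: "norm (sampled b (\<lambda>x. complex_of_real (g x))) \<le> L"
    if g: "\<And>x. x \<in> M \<Longrightarrow> \<bar>g x\<bar> \<le> L" for g :: "'a \<Rightarrow> real" and L
  proof -
    define v where "v x = sqrt (L\<^sup>2 - (g x)\<^sup>2)" for x
    have L: "0 \<le> L" using g[OF M_closed(3)] by linarith
    have vv: "g x * g x + v x * v x = L\<^sup>2" if "x \<in> M" for x
    proof -
      have "(g x)\<^sup>2 \<le> L\<^sup>2" using g[OF that] by (rule power2_le_iff_abs_le[THEN iffD2, OF L])
      then show ?thesis by (simp add: v_def power2_eq_square)
    qed
    let ?y = "sampled b (\<lambda>x. complex_of_real (g x))" and ?v = "sampled b (\<lambda>x. complex_of_real (v x))"
    have "star ?y = ?y" "star ?v = ?v" using sampled_star[OF b, symmetric] by simp_all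
    moreover have "?y * ?v = ?v * ?y" by (simp add: mult.commute flip: sampled_mult[OF b])
    moreover have "?y * ?y + ?v * ?v = sampled b (\<lambda>x. complex_of_real (L\<^sup>2))"
      unfolding sampled_mult[OF b, symmetric] sampled_add[symmetric]
      by (rule sampled_cong[OF b]) (simp only: vv flip: of_real_mult of_real_add)
    ultimately have "(norm ?y)\<^sup>2 \<le> norm (sampled b (\<lambda>x. complex_of_real (L\<^sup>2)))"
      by (rule norm_le_sum_of_squares)
    also have "\<dots> \<le> L\<^sup>2" unfolding sampled_const[OF b] norm_scaleC
      using norm_one_le_1[where 'a='u] by (simp add: norm_power mult_left_le)
    finally show ?thesis using L by (rule power2_le_imp_le)
  qed
  have K: "0 \<le> K" using f[OF M_closed(3)] norm_ge_zero order_trans by blast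
  have "(norm (sampled b f))\<^sup>2 = norm (sampled b (\<lambda>x. cnj (f x) * f x))"
    by (simp add: sampled_mult[OF b] sampled_star[OF b] cstar_identity)
  also have "(\<lambda>x. cnj (f x) * f x) = (\<lambda>x. complex_of_real ((cmod (f x))\<^sup>2))"
    by (rule ext) (subst mult.commute, rule complex_norm_square[symmetric])
  also have "norm (sampled b \<dots>) \<le> K\<^sup>2"
    by (rule real) (use f K in \<open>auto intro: power_mono\<close>)
  finally show ?thesis using K by (rule power2_le_imp_le)
qed

lemma beta_mem_U:
  assumes "a \<in> carrier G" "b \<in> carrier G" "x \<in> carrier G"
  shows "\<beta> a x \<in> U (a \<otimes> b) \<longleftrightarrow> x \<in> U b"
  using assms by (simp add: mem_U beta_closed inv_mult_group beta_comp beta_cancel)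

text \<open>The last relation of an SP-family says that passing to a finer quotient is compatible: the
  cosets of \<open>b d M d\<inverse> b\<inverse>\<close> inside \<open>m b M b\<inverse>\<close> are the translates by \<open>m\<close> of
  the images under conjugation by \<open>b\<close> of the cosets of \<open>d M d\<inverse>\<close> in \<open>M\<close>.\<close>

lemma sampled_indicator_coset:
  assumes b: "b \<in> Hp" and d: "d \<in> Hp" and m: "m \<in> M"
  shows "sampled (b \<otimes> d) (indicator (m <#\<^bsub>G\<^esub> U b)) = P b m"
proof -
  have bd: "b \<otimes> d \<in> Hp" using b d by (rule mult_Hp)
  note c = Hp_carrier[OF b] Hp_carrier[OF d] Hp_carrier[OF bd] M_carrier[OF m]
  \<comment> \<open>for a coset \<open>k\<close> at level \<open>d\<close>, the corresponding point of \<open>m b M b\<inverse>\<close> and its coset at level \<open>b d\<close>\<close>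
  define t where "t k = m \<otimes> \<beta> b (rep k)" for k
  define j where "j k = t k <#\<^bsub>G\<^esub> U (b \<otimes> d)" for k
  have repc: "rep k \<in> carrier G" "rep k \<in> M" if "k \<in> cosets d" for k
    using rep_M[OF d that] M_carrier by auto
  have t: "t k \<in> M" "t k \<in> carrier G" if "k \<in> cosets d" for k
    using repc[OF that] m b by (auto simp: t_def M_closed Hp_M M_carrier)
  have diff: "inv (m \<otimes> \<beta> b x) \<otimes> (m \<otimes> \<beta> b y) = \<beta> b (inv x \<otimes> y)"
    if "x \<in> carrier G" "y \<in> carrier G" for x y
    using that c by (simp add: inv_mult_group m_assoc inv_cancel beta_mult beta_inv beta_closed)
  have inj: "inj_on j (cosets d)"
  proof (rule inj_onI)
    fix k l assume kl: "k \<in> cosets d" "l \<in> cosets d" "j k = j l"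
    then have "t l \<in> j k" using self_l_coset[of "b \<otimes> d" "t l"] t c by (simp add: j_def)
    then have "inv (t k) \<otimes> t l \<in> U (b \<otimes> d)" using t kl c by (simp add: j_def mem_l_coset)
    then have "inv (rep k) \<otimes> rep l \<in> U d"
      unfolding t_def using kl repc c by (simp add: diff beta_mem_U)
    then have "rep l \<in> rep k <#\<^bsub>G\<^esub> U d" using kl repc c by (simp add: mem_l_coset)
    then have "rep l \<in> k" using cosets_eq[OF d kl(1) rep_in[OF d kl(1)]] by simp
    then show "k = l" using cosets_eq[OF d kl(1)] cosets_eq[OF d kl(2) rep_in[OF d kl(2)]] by simp
  qed
  have img: "j ` cosets d = {k \<in> cosets (b \<otimes> d). rep k \<in> m <#\<^bsub>G\<^esub> U b}"
  proof (intro equalityI subsetI)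
    fix k assume "k \<in> j ` cosets d"
    then obtain l where l: "l \<in> cosets d" "k = j l" by blast
    have "inv (rep k) \<otimes> t l \<in> U (b \<otimes> d)" "rep k \<in> M"
      using rep_coset[OF bd t(1)[OF l(1)]] l(2) by (auto simp: j_def)
    then have "inv (rep k) \<otimes> t l \<in> U b" using U_mult_subset[of b d] c d by blast
    then have "t l \<in> rep k <#\<^bsub>G\<^esub> U b" using \<open>rep k \<in> M\<close> t l c by (simp add: mem_l_coset M_carrier)
    then have "t l <#\<^bsub>G\<^esub> U b = rep k <#\<^bsub>G\<^esub> U b"
      using \<open>rep k \<in> M\<close> c by (intro l_coset_eqI) (auto simp: M_carrier)
    moreover have "t l \<in> m <#\<^bsub>G\<^esub> U b"
      unfolding t_def l_coset_def conj_set_eq using repc[OF l(1)] by blast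
    then have "t l <#\<^bsub>G\<^esub> U b = m <#\<^bsub>G\<^esub> U b" using c by (intro l_coset_eqI)
    ultimately have "rep k \<in> m <#\<^bsub>G\<^esub> U b" using self_l_coset[of b "rep k"] \<open>rep k \<in> M\<close> c by (simp add: M_carrier)
    then show "k \<in> {k \<in> cosets (b \<otimes> d). rep k \<in> m <#\<^bsub>G\<^esub> U b}"
      using l t by (simp add: j_def coset_in_cosets)
  next
    fix k assume k: "k \<in> {k \<in> cosets (b \<otimes> d). rep k \<in> m <#\<^bsub>G\<^esub> U b}"
    then obtain x where x: "x \<in> M" "rep k = m \<otimes> \<beta> b x" by (auto simp: l_coset_def conj_set_eq)
    let ?l = "x <#\<^bsub>G\<^esub> U d"
    have l: "?l \<in> cosets d" using x by (simp add: coset_in_cosets)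
    have "inv (rep ?l) \<otimes> x \<in> U d" by (rule rep_coset[OF d x(1)])
    then have "inv (t ?l) \<otimes> rep k \<in> U (b \<otimes> d)"
      unfolding x(2) t_def using repc[OF l] x c by (simp add: diff beta_mem_U M_carrier)
    then have "rep k \<in> j ?l" unfolding j_def using t[OF l] c rep_M[OF bd] k
      by (simp add: mem_l_coset M_carrier)
    moreover have "j ?l \<in> cosets (b \<otimes> d)" using t[OF l] by (simp add: j_def coset_in_cosets)
    ultimately have "j ?l = rep k <#\<^bsub>G\<^esub> U (b \<otimes> d)" by (intro cosets_eq[OF bd])
    also have "\<dots> = k" using cosets_eq[OF bd _ rep_in[OF bd]] k by force
    finally show "k \<in> j ` cosets d" using l by blast
  qed
  have "sampled (b \<otimes> d) (indicator (m <#\<^bsub>G\<^esub> U b)) = (\<Sum>k\<in>j ` cosets d. P (b \<otimes> d) (rep k))"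
    unfolding sampled_def img using finite_cosets[OF bd]
    by (intro sum.mono_neutral_cong_right) (auto simp: indicator_def)
  also have "\<dots> = (\<Sum>k\<in>cosets d. P (b \<otimes> d) (t k))"
    unfolding sum.reindex[OF inj] using t by (intro sum.cong) (auto simp: j_def P_rep[OF bd])
  also have "\<dots> = P b m"
    unfolding t_def by (rule P_refine[OF b d m rep_in[OF d], symmetric])
  finally show ?thesis .
qed

text \<open>The function on \<open>M\<close> that is constant on the cosets at level \<open>b\<close> and agrees with \<open>f\<close> at
  the sampling points; it vanishes outside \<open>M\<close>.\<close>

definition step :: "'a \<Rightarrow> ('a \<Rightarrow> complex) \<Rightarrow> 'a \<Rightarrow> complex" where
  "step b f x = (\<Sum>c\<in>cosets b. f (rep c) * indicator c x)"

lemma coset_rep: "b \<in> Hp \<Longrightarrow> c \<in> cosets b \<Longrightarrow> rep c <#\<^bsub>G\<^esub> U b = c"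
  using cosets_eq rep_in by metis

lemma step_on_M:
  assumes "b \<in> Hp" "x \<in> M"
  shows "step b f x = f (rep (x <#\<^bsub>G\<^esub> U b))"
proof -
  have "step b f x = (\<Sum>c\<in>cosets b. if c = x <#\<^bsub>G\<^esub> U b then f (rep c) else 0)"
    unfolding step_def
  proof (rule sum.cong)
    fix c assume c: "c \<in> cosets b"
    have "x \<in> c \<longleftrightarrow> c = x <#\<^bsub>G\<^esub> U b"
      using cosets_eq[OF assms(1) c] self_l_coset[of b x] assms by (auto simp: Hp_carrier M_carrier)
    then show "f (rep c) * indicator c x = (if c = x <#\<^bsub>G\<^esub> U b then f (rep c) else 0)"
      by (cases "x \<in> c") auto
  qed simp
  then show ?thesis using finite_cosets assms coset_in_cosets by simp
qed

lemma step_off_M: "b \<in> Hp \<Longrightarrow> x \<notin> M \<Longrightarrow> step b f x = 0"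
  unfolding step_def using coset_subset_M by (intro sum.neutral) (auto simp: indicator_def)

lemma coset_indicator_D: "b \<in> Hp \<Longrightarrow> c \<in> cosets b \<Longrightarrow> indicator c \<in> D"
  using indicator_D[of "rep c" b] by (simp add: coset_rep rep_M M_N Hp_H)

lemma step_D: "b \<in> Hp \<Longrightarrow> step b f \<in> D"
  unfolding step_def by (intro D_sum D_scale coset_indicator_D)

lemma sampled_step:
  assumes "b \<in> Hp" "d \<in> Hp"
  shows "sampled (b \<otimes> d) (step b f) = sampled b f"
proof -
  have "sampled (b \<otimes> d) (indicator c) = P b (rep c)" if "c \<in> cosets b" for c
    using sampled_indicator_coset[OF assms rep_M[OF assms(1) that]] coset_rep[OF assms(1) that] by simp
  then show ?thesis unfolding step_def sampled_sum sampled_scale by (simp add: sampled_def)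
qed

lemma eventually_step_close:
  assumes f: "f \<in> D" and e: "e > 0"
  shows "\<forall>\<^sub>F b in Hp_filter. \<forall>x\<in>M. cmod (step b f x - f x) \<le> e"
  using D_uniformly_continuous[OF f e] eventually_in_Hp
proof eventually_elim
  case (elim b)
  show ?case
  proof
    fix x assume x: "x \<in> M"
    show "cmod (step b f x - f x) \<le> e"
      using elim rep_coset[OF elim(2) x] x by (simp add: step_on_M M_N)
  qed
qed

subsection \<open>The limit representation\<close>

definition phi :: "('a \<Rightarrow> complex) \<Rightarrow> 'u" where
  "phi f = Lim Hp_filter (\<lambda>b. sampled b f)"

text \<open>All later levels agree on the step function of an earlier one, and are contractive: the
  oscillation of \<open>f\<close> at level \<open>b\<close> bounds the change beyond \<open>b\<close>.\<close>

lemma sampled_tendsto: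
  assumes f: "f \<in> D"
  shows "((\<lambda>b. sampled b f) \<longlongrightarrow> phi f) Hp_filter"
proof -
  have "cauchy_filter (filtermap (\<lambda>b. sampled b f) Hp_filter)"
    unfolding cauchy_filter_metric_filtermap
  proof (intro allI impI)
    fix e :: real assume e: "e > 0"
    then have "\<forall>\<^sub>F b in Hp_filter. b \<in> Hp \<and> (\<forall>x\<in>M. cmod (step b f x - f x) \<le> e/3)"
      using eventually_step_close[OF f, of "e/3"] eventually_in_Hp by (intro eventually_conj) auto
    then obtain b where b: "b \<in> Hp" "\<And>x. x \<in> M \<Longrightarrow> cmod (step b f x - f x) \<le> e/3"
      using eventually_happens'[OF Hp_filter_nonbot] by blast
    have "\<forall>\<^sub>F x in Hp_filter. dist (sampled b f) (sampled x f) \<le> e/3"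
    proof (rule eventually_multiplesI[OF b(1)])
      fix d assume d: "d \<in> Hp"
      have "sampled b f - sampled (b \<otimes> d) f = sampled (b \<otimes> d) (\<lambda>x. step b f x - f x)"
        using b d by (simp add: sampled_diff sampled_step)
      also have "norm \<dots> \<le> e/3" using b d by (intro sampled_bound mult_Hp)
      finally show "dist (sampled b f) (sampled (b \<otimes> d) f) \<le> e/3" by (simp add: dist_norm)
    qed
    moreover have "dist y z < e" if "dist (sampled b f) y \<le> e/3" "dist (sampled b f) z \<le> e/3" for y z
      using dist_triangle3[of y z "sampled b f"] that e by linarith
    ultimately show "\<exists>Q. eventually Q Hp_filter \<and> (\<forall>x y. Q x \<and> Q y \<longrightarrow> dist (sampled x f) (sampled y f) < e)"
      by blast
  qed
  then have "\<exists>c. filtermap (\<lambda>b. sampled b f) Hp_filter \<le> nhds c"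
    by (rule cauchy_filter_complete_converges[OF _ complete_UNIV]) (auto simp: filtermap_bot_iff)
  then obtain c where "((\<lambda>b. sampled b f) \<longlongrightarrow> c) Hp_filter" by (auto simp: filterlim_def)
  then show ?thesis unfolding phi_def by (simp add: tendsto_Lim)
qed

lemma phi_eqI: "f \<in> D \<Longrightarrow> ((\<lambda>b. sampled b f) \<longlongrightarrow> l) Hp_filter \<Longrightarrow> phi f = l"
  using sampled_tendsto tendsto_unique Hp_filter_nonbot by blast

lemma phi_eventuallyI: "f \<in> D \<Longrightarrow> \<forall>\<^sub>F b in Hp_filter. sampled b f = l \<Longrightarrow> phi f = l"
  by (rule phi_eqI) (auto simp: tendsto_eventually)

lemma phi_add: "f \<in> D \<Longrightarrow> g \<in> D \<Longrightarrow> phi (\<lambda>x. f x + g x) = phi f + phi g"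
  by (rule phi_eqI[OF D_add]) (auto simp: sampled_add intro!: tendsto_add sampled_tendsto)

lemma phi_diff: "f \<in> D \<Longrightarrow> g \<in> D \<Longrightarrow> phi (\<lambda>x. f x - g x) = phi f - phi g"
  by (rule phi_eqI[OF D_diff]) (auto simp: sampled_diff intro!: tendsto_diff sampled_tendsto)

lemma phi_scale: "f \<in> D \<Longrightarrow> phi (\<lambda>x. c * f x) = c *\<^sub>C phi f"
  by (rule phi_eqI[OF D_scale]) (auto simp: sampled_scale intro!: tendsto_scaleC sampled_tendsto)

lemma phi_zero: "phi (\<lambda>x. 0) = 0"
  using phi_diff[OF D_zero D_zero] by simp

lemma phi_sum: "(\<And>i. i \<in> I \<Longrightarrow> F i \<in> D) \<Longrightarrow> phi (\<lambda>x. \<Sum>i\<in>I. F i x) = (\<Sum>i\<in>I. phi (F i))"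
proof (induction I rule: infinite_finite_induct)
  case (insert i I)
  then show ?case using phi_add[of "F i" "\<lambda>x. \<Sum>i\<in>I. F i x"] by (simp add: D_sum)
qed (auto simp: phi_zero)

lemma phi_mult:
  assumes "f \<in> D" "g \<in> D"
  shows "phi (\<lambda>x. f x * g x) = phi f * phi g"
proof (rule phi_eqI[OF D_mult[OF assms]])
  have "((\<lambda>b. sampled b f * sampled b g) \<longlongrightarrow> phi f * phi g) Hp_filter" using assms by (intro tendsto_mult sampled_tendsto)
  then show "((\<lambda>b. sampled b (\<lambda>x. f x * g x)) \<longlongrightarrow> phi f * phi g) Hp_filter"
    by (rule Lim_transform_eventually) (use eventually_in_Hp in eventually_elim, simp add: sampled_mult)
qed

lemma phi_star:
  assumes "f \<in> D"
  shows "phi (\<lambda>x. cnj (f x)) = star (phi f)"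
proof (rule phi_eqI[OF D_cnj[OF assms]])
  have "((\<lambda>b. star (sampled b f)) \<longlongrightarrow> star (phi f)) Hp_filter" using assms by (intro tendsto_star sampled_tendsto)
  then show "((\<lambda>b. sampled b (\<lambda>x. cnj (f x))) \<longlongrightarrow> star (phi f)) Hp_filter"
    by (rule Lim_transform_eventually) (use eventually_in_Hp in eventually_elim, simp add: sampled_star)
qed

lemma phi_bound:
  assumes f: "f \<in> D" and K: "\<And>x. x \<in> M \<Longrightarrow> cmod (f x) \<le> K"
  shows "norm (phi f) \<le> K"
proof (rule tendsto_upperbound[OF tendsto_norm[OF sampled_tendsto[OF f]]])
  show "\<forall>\<^sub>F b in Hp_filter. norm (sampled b f) \<le> K"
    using eventually_in_Hp by eventually_elim (rule sampled_bound[OF _ K])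
qed simp

lemma phi_cong:
  assumes "f \<in> D" "g \<in> D" "\<And>x. x \<in> M \<Longrightarrow> f x = g x"
  shows "phi f = phi g"
  using phi_bound[OF D_diff[OF assms(1,2)], of 0] assms by (simp add: phi_diff)

lemma phi_coset:
  assumes "a \<in> Hp" "m \<in> M"
  shows "phi (indicator (m <#\<^bsub>G\<^esub> U a)) = P a m"
proof (rule phi_eventuallyI)
  show "indicator (m <#\<^bsub>G\<^esub> U a) \<in> D" using assms by (simp add: indicator_D M_N Hp_H)
  show "\<forall>\<^sub>F b in Hp_filter. sampled b (indicator (m <#\<^bsub>G\<^esub> U a)) = P a m"
    by (rule eventually_multiplesI[OF assms(1)]) (rule sampled_indicator_coset[OF assms(1) _ assms(2)])
qed

lemma phi_U: "a \<in> Hp \<Longrightarrow> phi (indicator (U a)) = P a \<one>"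
proof -
  assume a: "a \<in> Hp"
  have "\<one> \<otimes> u = u" if "u \<in> U a" for u
    using N_carrier[OF U_N[OF Hp_carrier[OF a] that]] by simp
  then have "\<one> <#\<^bsub>G\<^esub> U a = U a" by (simp add: l_coset_def)
  then show ?thesis using phi_coset[OF a M_closed(3)] by simp
qed

lemma phi_M: "phi (indicator M) = 1"
  using phi_U[OF one_Hp] by (simp add: U_one P_one)

text \<open>On functions that are constant on cosets the commutation relation is the covariance of the
  projections, and such functions approximate \<open>f\<close> on \<open>M\<close>.  Outside \<open>M\<close> the values of \<open>f\<close>
  do not contribute, as \<open>S a\<close> has range projection \<open>P a e\<close>.\<close>

lemma S_phi:
  assumes a: "a \<in> Hp" and f: "f \<in> D"
  shows "S a * phi f = phi (\<alpha> a f) * S a"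
proof -
  have aH: "a \<in> H" using a by (rule Hp_H)
  have coset: "S a * phi (step b f) = phi (\<alpha> a (step b f)) * S a" if b: "b \<in> Hp" for b
  proof -
    have ind: "phi (\<alpha> a (indicator c)) = P (a \<otimes> b) (\<beta> a (rep c))"
       "phi (indicator c) = P b (rep c)" if c: "c \<in> cosets b" for c
    proof -
      have "\<alpha> a (indicator (rep c <#\<^bsub>G\<^esub> U b)) = indicator (\<beta> a (rep c) <#\<^bsub>G\<^esub> U (a \<otimes> b))"
        using a b rep_M[OF b c] by (intro alpha_indicator_coset) (auto simp: Hp_H M_N)
      then show "phi (\<alpha> a (indicator c)) = P (a \<otimes> b) (\<beta> a (rep c))"
        using a b rep_M[OF b c] by (simp add: coset_rep[OF b c] phi_coset mult_Hp Hp_M)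
      show "phi (indicator c) = P b (rep c)"
        using phi_coset[OF b rep_M[OF b c]] by (simp add: coset_rep[OF b c])
    qed
    have "S a * phi (step b f) = (\<Sum>c\<in>cosets b. f (rep c) *\<^sub>C (S a * P b (rep c)))"
      unfolding step_def using b
      by (simp add: phi_sum phi_scale D_scale coset_indicator_D ind sum_distrib_left mult_scaleC_right)
    also have "\<dots> = (\<Sum>c\<in>cosets b. f (rep c) *\<^sub>C P (a \<otimes> b) (\<beta> a (rep c))) * S a"
      using a b by (simp add: S_P rep_M sum_distrib_right mult_scaleC_left)
    also have "(\<Sum>c\<in>cosets b. f (rep c) *\<^sub>C P (a \<otimes> b) (\<beta> a (rep c))) = phi (\<alpha> a (step b f))"
      unfolding step_def alpha_sum alpha_scale using b
      by (simp add: phi_sum phi_scale D_scale coset_indicator_D alpha_D[OF aH] ind)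
    finally show ?thesis .
  qed
  \<comment> \<open>step functions vanish outside \<open>M\<close>, so they approximate \<open>g\<close> uniformly on \<open>N\<close>\<close>
  define g where "g x = f x * indicator M x" for x
  have g: "g \<in> D" unfolding g_def by (rule D_mult[OF f indicator_M_D])
  have "norm (S a * phi g - phi (\<alpha> a g) * S a) \<le> 2 * e" if e: "e > 0" for e
  proof -
    have "\<forall>\<^sub>F b in Hp_filter. b \<in> Hp \<and> (\<forall>x\<in>M. cmod (step b f x - f x) \<le> e)"
      using eventually_step_close[OF f e] eventually_in_Hp by (intro eventually_conj)
    then obtain b where b: "b \<in> Hp" "\<And>x. x \<in> M \<Longrightarrow> cmod (step b f x - f x) \<le> e"
      using eventually_happens'[OF Hp_filter_nonbot] by blast
    define r where "r x = g x - step b f x" for x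
    have r: "r \<in> D" unfolding r_def by (rule D_diff[OF g step_D[OF b(1)]])
    have rb: "cmod (r x) \<le> e" for x
      using b step_off_M[OF b(1), of x f] e
      by (cases "x \<in> M") (auto simp: r_def g_def norm_minus_commute)
    have "S a * phi g - phi (\<alpha> a g) * S a = S a * phi r - phi (\<alpha> a r) * S a"
      using coset[OF b(1)] g step_D[OF b(1)]
      by (simp add: r_def[abs_def] phi_diff alpha_diff alpha_D[OF aH] algebra_simps)
    also have "norm \<dots> \<le> norm (S a * phi r) + norm (phi (\<alpha> a r) * S a)" by (rule norm_triangle_ineq4)
    also have "\<dots> \<le> 1 * e + e * 1"
    proof (intro add_mono)
      show "norm (S a * phi r) \<le> 1 * e"
        using e by (intro order_trans[OF norm_mult_ineq] mult_mono norm_S[OF a] phi_bound[OF r] rb) auto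
      have "norm (phi (\<alpha> a r)) \<le> e"
        by (rule phi_bound[OF alpha_D[OF aH r]]) (rule alpha_bound, use e rb in auto)
      then show "norm (phi (\<alpha> a r) * S a) \<le> e * 1"
        using e by (intro order_trans[OF norm_mult_ineq] mult_mono norm_S[OF a]) auto
    qed
    finally show ?thesis by simp
  qed
  then have "norm (S a * phi g - phi (\<alpha> a g) * S a) \<le> 0 + e" if "e > 0" for e
    using half_gt_zero[OF that] by fastforce
  then have "norm (S a * phi g - phi (\<alpha> a g) * S a) \<le> 0" by (rule field_le_epsilon)
  then have eq: "S a * phi g = phi (\<alpha> a g) * S a" by simp
  have "phi (\<alpha> a g) * S a = phi (\<alpha> a f) * (P a \<one> * S a)"
    unfolding g_def alpha_mult alpha_indicator_M[OF aH]
    by (simp add: phi_mult alpha_D[OF aH f] indicator_U_D[OF aH] phi_U[OF a] mult.assoc)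
  also have "P a \<one> * S a = S a"
    using S_S_star[OF a] S_isometry[OF a] by (metis mult.assoc mult.right_neutral)
  finally have "phi (\<alpha> a g) * S a = phi (\<alpha> a f) * S a" .
  moreover have "phi g = phi f" by (rule phi_cong[OF g f]) (simp add: g_def)
  ultimately show ?thesis using eq by simp
qed

text \<open>The adjoint of the previous relation, applied to \<open>\<alpha>\<^bsub>a\<inverse>\<^esub>\<close> of the adjoint of \<open>f\<close>.\<close>

lemma S_star_phi:
  assumes a: "a \<in> Hp" and f: "f \<in> D"
  shows "star (S a) * phi f = phi (\<alpha> (inv a) f) * star (S a)"
proof -
  have aH: "a \<in> H" "inv a \<in> H" using a Hp_H H_closed by auto
  define g where "g = (\<lambda>x. cnj (\<alpha> (inv a) f x))"
  have g: "g \<in> D" unfolding g_def by (rule D_cnj[OF alpha_D[OF aH(2) f]])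
  have ag: "\<alpha> a g = (\<lambda>x. cnj (f x))"
    unfolding g_def alpha_cnj using f aH by (simp add: alpha_comp H_carrier alpha_one)
  have "star (S a * phi g) = star (phi (\<alpha> a g) * S a)" using S_phi[OF a g] by simp
  then have "phi (\<alpha> (inv a) f) * star (S a) = star (S a) * phi f"
    unfolding ag unfolding g_def by (simp add: star_mult phi_star f alpha_D[OF aH(2) f] star_star)
  then show ?thesis by simp
qed

subsection \<open>Partial isometries for the elements of \<open>H\<close>\<close>

text \<open>\<open>S\<^sub>a\<^sup>* S\<^sub>b\<close> depends on \<open>a\<inverse> b\<close> only, since common factors cancel: \<open>S\<^sub>c\<close> is an isometry
  and \<open>H\<close> is commutative.\<close>

definition V :: "'a \<Rightarrow> 'u" where
  "V h = (SOME v. \<exists>a\<in>Hp. \<exists>b\<in>Hp. h = inv a \<otimes> b \<and> v = star (S a) * S b)"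

lemma S_star_S_common:
  assumes "a \<in> Hp" "b \<in> Hp" "c \<in> Hp"
  shows "star (S (c \<otimes> a)) * S (c \<otimes> b) = star (S a) * S b"
proof -
  have "star (S (c \<otimes> a)) * S (c \<otimes> b) = star (S a) * (star (S c) * S c) * S b"
    using assms by (simp add: star_mult mult.assoc flip: S_mult)
  then show ?thesis using assms by (simp add: S_isometry)
qed

lemma V_eq:
  assumes a: "a \<in> Hp" and b: "b \<in> Hp"
  shows "V (inv a \<otimes> b) = star (S a) * S b"
proof -
  have "\<exists>v. \<exists>a'\<in>Hp. \<exists>b'\<in>Hp. inv a \<otimes> b = inv a' \<otimes> b' \<and> v = star (S a') * S b'" using a b by blast
  then have "\<exists>a'\<in>Hp. \<exists>b'\<in>Hp. inv a \<otimes> b = inv a' \<otimes> b' \<and> V (inv a \<otimes> b) = star (S a') * S b'"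
    unfolding V_def by (rule someI_ex)
  then obtain c d where c: "c \<in> Hp" "d \<in> Hp" "inv a \<otimes> b = inv c \<otimes> d" "V (inv a \<otimes> b) = star (S c) * S d"
    by blast
  have "c \<otimes> b = c \<otimes> (a \<otimes> (inv a \<otimes> b))" using a b c(1) by (simp add: inv_cancel Hp_carrier)
  also have "\<dots> = a \<otimes> (c \<otimes> (inv c \<otimes> d))"
    unfolding c(3) using a c by (simp add: H_lcomm Hp_H H_closed)
  also have "\<dots> = a \<otimes> d" using a c by (simp add: inv_cancel Hp_carrier)
  finally have cb: "c \<otimes> b = a \<otimes> d" .
  have "star (S a) * S b = star (S (c \<otimes> a)) * S (c \<otimes> b)" using S_star_S_common[OF a b c(1)] by simp
  also have "\<dots> = star (S (a \<otimes> c)) * S (a \<otimes> d)" using cb Hp_comm[OF c(1) a] by simp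
  also have "\<dots> = star (S c) * S d" by (rule S_star_S_common[OF c(1,2) a])
  finally show ?thesis using c(4) by simp
qed

lemma V_Hp: "a \<in> Hp \<Longrightarrow> V a = S a"
  using V_eq[OF one_Hp, of a] by (simp add: Hp_carrier S_one)

lemma V_one: "V \<one> = 1"
  by (simp add: V_Hp one_Hp S_one)

lemma V_star:
  assumes "h \<in> H"
  shows "star (V h) = V (inv h)"
proof -
  obtain a b where a: "a \<in> Hp" "b \<in> Hp" "h = inv a \<otimes> b" using H_quotient[OF assms] .
  then have "inv h = inv b \<otimes> a" by (simp add: inv_mult_group Hp_carrier)
  then show ?thesis using a by (simp add: V_eq star_mult star_star)
qed

lemma norm_V: "h \<in> H \<Longrightarrow> norm (V h) \<le> 1"
proof -
  assume "h \<in> H"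
  then obtain a b where a: "a \<in> Hp" "b \<in> Hp" "h = inv a \<otimes> b" by (rule H_quotient)
  have "norm (star (S a) * S b) \<le> norm (star (S a)) * norm (S b)" by (rule norm_mult_ineq)
  also have "\<dots> \<le> 1 * 1" using a by (intro mult_mono) (auto simp: norm_S)
  finally show ?thesis using a by (simp add: V_eq)
qed

lemma V_phi:
  assumes h: "h \<in> H" and f: "f \<in> D"
  shows "V h * phi f = phi (\<alpha> h f) * V h"
proof -
  obtain a b where a: "a \<in> Hp" "b \<in> Hp" "h = inv a \<otimes> b" using H_quotient[OF h] .
  have "V h * phi f = star (S a) * (S b * phi f)" using a by (simp add: V_eq mult.assoc)
  also have "\<dots> = star (S a) * phi (\<alpha> b f) * S b" using a f by (simp add: S_phi mult.assoc)
  also have "\<dots> = phi (\<alpha> (inv a) (\<alpha> b f)) * star (S a) * S b"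
    using a f by (simp add: S_star_phi alpha_D Hp_H)
  also have "\<dots> = phi (\<alpha> h f) * V h" using a by (simp add: V_eq mult.assoc alpha_comp Hp_carrier)
  finally show ?thesis .
qed

lemma phi_V: "h \<in> H \<Longrightarrow> phi (\<alpha> h (indicator M)) * V h = V h"
  using V_phi[of h "indicator M"] by (simp add: indicator_M_D phi_M)

text \<open>With a common denominator, \<open>h = a\<inverse> b\<close> and \<open>k = b\<inverse> d\<close>, the product is
  \<open>S\<^sub>a\<^sup>* (S\<^sub>b S\<^sub>b\<^sup>*) S\<^sub>d\<close>, and the middle factor is the image of a characteristic
  function.\<close>

lemma V_V:
  assumes h: "h \<in> H" and k: "k \<in> H"
  shows "V h * V k = phi (\<alpha> h (indicator M)) * V (h \<otimes> k)"
proof -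
  obtain a b where a: "a \<in> Hp" "b \<in> Hp" "h = inv a \<otimes> b" using H_quotient[OF h] .
  obtain c d where c: "c \<in> Hp" "d \<in> Hp" "k = inv c \<otimes> d" using H_quotient[OF k] .
  define x y z where "x = c \<otimes> a" "y = c \<otimes> b" "z = b \<otimes> d"
  have xyz: "x \<in> Hp" "y \<in> Hp" "z \<in> Hp" using a c by (auto simp: x_y_z_def mult_Hp)
  have Vh: "V h = star (S x) * S y" using a c by (simp add: x_y_z_def S_star_S_common V_eq)
  have Vk: "V k = star (S y) * S z"
    using a c S_star_S_common[of c d b] Hp_comm[of c b] by (simp add: x_y_z_def V_eq)
  have hx: "h = inv x \<otimes> y"
    using a c by (simp add: x_y_z_def inv_mult_group m_assoc Hp_carrier inv_cancel)
  have "y = b \<otimes> c" using a c by (simp add: x_y_z_def Hp_comm)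
  then have "k = inv y \<otimes> z"
    using a c by (simp add: x_y_z_def inv_mult_group m_assoc Hp_carrier inv_cancel)
  then have hk: "h \<otimes> k = inv x \<otimes> z" using xyz by (simp add: hx m_assoc Hp_carrier inv_cancel)
  have "V h * V k = star (S x) * (S y * star (S y)) * S z" by (simp add: Vh Vk mult.assoc)
  also have "S y * star (S y) = phi (\<alpha> y (indicator M))"
    using xyz by (simp add: S_S_star alpha_indicator_M Hp_H phi_U)
  also have "star (S x) * \<dots> = phi (\<alpha> (inv x) (\<alpha> y (indicator M))) * star (S x)"
    using xyz by (intro S_star_phi alpha_D Hp_H indicator_M_D)
  also have "\<alpha> (inv x) (\<alpha> y (indicator M)) = \<alpha> h (indicator M)"
    using xyz by (simp add: hx alpha_comp Hp_carrier)
  finally show ?thesis using xyz by (simp add: hk V_eq mult.assoc)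
qed

text \<open>This is where commutativity of \<open>H\<close> makes the compressions at different levels comparable.\<close>

lemma S_V_S:
  assumes c: "c \<in> Hp" and h: "h \<in> H"
  shows "star (S c) * V h * S c = V h"
proof -
  obtain a b where a: "a \<in> Hp" "b \<in> Hp" "h = inv a \<otimes> b" using H_quotient[OF h] .
  have "star (S c) * V h * S c = star (S (a \<otimes> c)) * S (b \<otimes> c)"
    using a c by (simp add: V_eq mult.assoc star_mult flip: S_mult)
  then show ?thesis using a c S_star_S_common[of a b c] by (simp add: Hp_comm V_eq)
qed

end

section \<open>A C*-seminorm on the convolution algebra\<close>

context conjugation_setting
begin

abbreviation "CC \<equiv> Cc H D"

lemma fsupp_zero: "h \<notin> fsupp F \<Longrightarrow> F h = (\<lambda>y. 0)"
  by (simp add: fsupp_def)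

lemma CcD:
  assumes "F \<in> CC"
  shows "finite (fsupp F)" "fsupp F \<subseteq> H" "F h \<in> D"
proof -
  show "finite (fsupp F)" "fsupp F \<subseteq> H" using assms by (auto simp: Cc_def)
  show "F h \<in> D"
  proof (cases "h \<in> fsupp F")
    case True
    then show ?thesis using assms unfolding Cc_def by blast
  next
    case False
    then show ?thesis using D_zero by (simp add: fsupp_zero)
  qed
qed

lemma CcI: "finite T \<Longrightarrow> T \<subseteq> H \<Longrightarrow> fsupp F \<subseteq> T \<Longrightarrow> (\<And>h. h \<in> T \<Longrightarrow> F h \<in> D) \<Longrightarrow> F \<in> CC"
  unfolding Cc_def using finite_subset[of "fsupp F" T] D_zero fsupp_zero[of _ F]
  by (simp, metis subset_iff)

lemma fsupp_add: "fsupp (\<lambda>h y. F h y + K h y) \<subseteq> fsupp F \<union> fsupp K"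
  by (auto simp: fsupp_def)

lemma Cc_add: "F \<in> CC \<Longrightarrow> K \<in> CC \<Longrightarrow> (\<lambda>h y. F h y + K h y) \<in> CC"
  by (rule CcI[OF _ _ fsupp_add]) (auto simp: CcD D_add dest: CcD(2))

lemma fsupp_scale: "fsupp (\<lambda>h y. c * F h y) \<subseteq> fsupp F"
  by (auto simp: fsupp_def)

lemma Cc_scale: "F \<in> CC \<Longrightarrow> (\<lambda>h y. c * F h y) \<in> CC"
  by (rule CcI[OF _ _ fsupp_scale]) (auto simp: CcD D_scale dest: CcD(2))

lemma fsupp_mult:
  assumes "F \<in> CC" "K \<in> CC"
  shows "fsupp (cc_mult G N H F K) \<subseteq> (\<lambda>(b, k). b \<otimes> k) ` (fsupp F \<times> fsupp K)"
proof
  fix h assume h: "h \<in> fsupp (cc_mult G N H F K)"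
  then have hH: "h \<in> H" and "\<exists>y. (\<Sum>b\<in>fsupp F. F b y * \<alpha> b (K (inv b \<otimes> h)) y) \<noteq> 0"
    by (auto simp: fsupp_def cc_mult_def split: if_splits)
  then obtain y where "(\<Sum>b\<in>fsupp F. F b y * \<alpha> b (K (inv b \<otimes> h)) y) \<noteq> 0" by blast
  then obtain b where b: "b \<in> fsupp F" "F b y * \<alpha> b (K (inv b \<otimes> h)) y \<noteq> 0"
    by (rule sum.not_neutral_contains_not_neutral)
  then have "K (inv b \<otimes> h) \<noteq> (\<lambda>y. 0)" by (auto simp: alpha_zero)
  then have "inv b \<otimes> h \<in> fsupp K" by (simp add: fsupp_def)
  moreover have "h = b \<otimes> (inv b \<otimes> h)" using b CcD(2)[OF assms(1)] hH H_carrier by (simp add: inv_cancel subset_iff)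
  ultimately show "h \<in> (\<lambda>(b, k). b \<otimes> k) ` (fsupp F \<times> fsupp K)" using b(1) by (intro image_eqI[of _ _ "(b, inv b \<otimes> h)"]) auto
qed

lemma Cc_mult:
  assumes "F \<in> CC" "K \<in> CC"
  shows "cc_mult G N H F K \<in> CC"
proof (rule CcI[OF _ _ fsupp_mult[OF assms]])
  show "finite ((\<lambda>(b, k). b \<otimes> k) ` (fsupp F \<times> fsupp K))" using assms CcD(1) by blast
  show "(\<lambda>(b, k). b \<otimes> k) ` (fsupp F \<times> fsupp K) \<subseteq> H" using assms CcD(2) H_closed(1) by fastforce
  fix h
  have "(\<lambda>y. \<Sum>b\<in>fsupp F. F b y * \<alpha> b (K (inv b \<otimes> h)) y) \<in> D"
    using assms CcD by (intro D_sum D_mult alpha_D) auto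
  then show "cc_mult G N H F K h \<in> D" using D_zero by (cases "h \<in> H") (auto simp: cc_mult_def[abs_def])
qed

lemma fsupp_star:
  assumes "F \<in> CC"
  shows "fsupp (cc_star G N H F) \<subseteq> (\<lambda>h. inv h) ` fsupp F"
proof
  fix h assume "h \<in> fsupp (cc_star G N H F)"
  then have h: "h \<in> H" "\<alpha> h (\<lambda>y. cnj (F (inv h) y)) \<noteq> (\<lambda>y. 0)"
    by (auto simp: fsupp_def cc_star_def split: if_splits)
  then have "F (inv h) \<noteq> (\<lambda>y. 0)" by (auto simp: alpha_zero)
  then have "inv h \<in> fsupp F" by (simp add: fsupp_def)
  then show "h \<in> (\<lambda>h. inv h) ` fsupp F" using h(1) H_carrier by (intro image_eqI[of _ _ "inv h"]) auto
qed

lemma Cc_star: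
  assumes "F \<in> CC"
  shows "cc_star G N H F \<in> CC"
proof (rule CcI[OF _ _ fsupp_star[OF assms]])
  show "finite ((\<lambda>h. inv h) ` fsupp F)" using assms CcD(1) by blast
  show "(\<lambda>h. inv h) ` fsupp F \<subseteq> H" using assms CcD(2) H_closed(2) by fastforce
  fix h show "cc_star G N H F h \<in> D"
    using assms CcD D_zero by (auto simp: cc_star_def alpha_D D_cnj)
qed

end

context sp_setting
begin

text \<open>The formal sum \<open>F\<close>, conjugated by \<open>a\<close> and then compressed by \<open>\<chi>\<^sub>M\<close>.  It is not
  multiplicative in \<open>F\<close>, but becomes so in the limit along \<open>H\<^sup>+\<close>.\<close>

definition compr :: "'a \<Rightarrow> ('a \<Rightarrow> 'a \<Rightarrow> complex) \<Rightarrow> 'u" where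
  "compr a F = (\<Sum>h\<in>fsupp F. phi (\<alpha> a (F h)) * V h)"

lemma compr_superset:
  assumes "finite T" "fsupp F \<subseteq> T"
  shows "compr a F = (\<Sum>h\<in>T. phi (\<alpha> a (F h)) * V h)"
  unfolding compr_def using assms
  by (intro sum.mono_neutral_left) (auto simp: fsupp_zero alpha_zero phi_zero)

lemma compr_add:
  assumes a: "a \<in> H" and F: "F \<in> CC" and K: "K \<in> CC"
  shows "compr a (\<lambda>h y. F h y + K h y) = compr a F + compr a K"
proof -
  let ?T = "fsupp F \<union> fsupp K"
  have T: "finite ?T" using CcD(1)[OF F] CcD(1)[OF K] by blast
  have "compr a (\<lambda>h y. F h y + K h y) = (\<Sum>h\<in>?T. phi (\<alpha> a (F h)) * V h + phi (\<alpha> a (K h)) * V h)"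
    using CcD(3)[OF F] CcD(3)[OF K] a
    by (simp add: compr_superset[OF T fsupp_add] alpha_add phi_add alpha_D distrib_right)
  then show ?thesis using T by (simp add: sum.distrib compr_superset[of ?T])
qed

lemma compr_scale:
  assumes a: "a \<in> H" and F: "F \<in> CC"
  shows "compr a (\<lambda>h y. c * F h y) = c *\<^sub>C compr a F"
proof -
  have "compr a (\<lambda>h y. c * F h y) = (\<Sum>h\<in>fsupp F. phi (\<alpha> a (\<lambda>y. c * F h y)) * V h)"
    by (rule compr_superset[OF CcD(1)[OF F] fsupp_scale])
  also have "\<dots> = (\<Sum>h\<in>fsupp F. c *\<^sub>C (phi (\<alpha> a (F h)) * V h))"
    using CcD(3)[OF F] a by (simp add: alpha_scale phi_scale alpha_D mult_scaleC_left)
  finally show ?thesis by (simp add: compr_def scaleC_sum_right)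
qed

lemma compr_star:
  assumes a: "a \<in> H" and F: "F \<in> CC"
  shows "compr a (cc_star G N H F) = star (compr a F)"
proof -
  have H: "h \<in> H" if "h \<in> fsupp F" for h using CcD(2)[OF F] that by blast
  have inj: "inj_on (\<lambda>h. inv h) (fsupp F)" using H H_carrier inj_onI inv_inj inj_on_subset by (metis subsetI)
  have "compr a (cc_star G N H F) = (\<Sum>h\<in>(\<lambda>h. inv h) ` fsupp F. phi (\<alpha> a (cc_star G N H F h)) * V h)"
    by (rule compr_superset[OF _ fsupp_star[OF F]]) (use CcD(1)[OF F] in blast)
  also have "\<dots> = (\<Sum>h\<in>fsupp F. star (phi (\<alpha> a (F h)) * V h))"
    unfolding sum.reindex[OF inj]
  proof (rule sum.cong[OF refl], unfold o_def)
    fix h assume "h \<in> fsupp F"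
    then have h: "h \<in> H" "inv h \<in> H" using H H_closed by auto
    have "\<alpha> a (cc_star G N H F (inv h)) = \<alpha> (inv h) (\<lambda>y. cnj (\<alpha> a (F h) y))"
      using h a by (simp add: cc_star_def alpha_cnj alpha_comp H_carrier H_comm[of a])
    then have "phi (\<alpha> a (cc_star G N H F (inv h))) * V (inv h) = V (inv h) * phi (\<lambda>y. cnj (\<alpha> a (F h) y))"
      using h a by (simp add: V_phi D_cnj alpha_D CcD(3)[OF F])
    then show "phi (\<alpha> a (cc_star G N H F (inv h))) * V (inv h) = star (phi (\<alpha> a (F h)) * V h)"
      using h a by (simp add: star_mult V_star phi_star alpha_D CcD(3)[OF F])
  qed
  finally show ?thesis by (simp add: compr_def star_sum)
qed

lemma compr_mult:
  assumes a: "a \<in> H" and F: "F \<in> CC" and K: "K \<in> CC"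
  shows "compr a (cc_mult G N H F K)
    = (\<Sum>b\<in>fsupp F. \<Sum>k\<in>fsupp K. phi (\<alpha> a (\<lambda>y. F b y * \<alpha> b (K k) y)) * V (b \<otimes> k))"
proof -
  let ?T = "(\<lambda>(b, k). b \<otimes> k) ` (fsupp F \<times> fsupp K)"
  have fin: "finite (fsupp F)" "finite (fsupp K)" using CcD(1) F K by auto
  have H: "b \<in> H" "k \<in> H" if "b \<in> fsupp F" "k \<in> fsupp K" for b k
    using CcD(2) F K that by blast+
  have T: "?T \<subseteq> H" using H H_closed(1) by fastforce
  have mem: "(\<lambda>y. F b y * \<alpha> b (K k) y) \<in> D" if "b \<in> fsupp F" for b k
    using CcD F K that by (intro D_mult alpha_D) auto
  have "compr a (cc_mult G N H F K) = (\<Sum>h\<in>?T. phi (\<alpha> a (cc_mult G N H F K h)) * V h)"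
    using fin by (intro compr_superset fsupp_mult F K) auto
  also have "\<dots> = (\<Sum>h\<in>?T. \<Sum>b\<in>fsupp F. phi (\<alpha> a (\<lambda>y. F b y * \<alpha> b (K (inv b \<otimes> h)) y)) * V h)"
  proof (rule sum.cong[OF refl])
    fix h assume "h \<in> ?T"
    then have "h \<in> H" using T by blast
    then have "cc_mult G N H F K h = (\<lambda>y. \<Sum>b\<in>fsupp F. F b y * \<alpha> b (K (inv b \<otimes> h)) y)"
      by (simp add: cc_mult_def)
    then show "phi (\<alpha> a (cc_mult G N H F K h)) * V h
        = (\<Sum>b\<in>fsupp F. phi (\<alpha> a (\<lambda>y. F b y * \<alpha> b (K (inv b \<otimes> h)) y)) * V h)"
      using mem a by (simp add: alpha_sum phi_sum alpha_D sum_distrib_right)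
  qed
  also have "\<dots> = (\<Sum>b\<in>fsupp F. \<Sum>h\<in>?T. phi (\<alpha> a (\<lambda>y. F b y * \<alpha> b (K (inv b \<otimes> h)) y)) * V h)"
    by (rule sum.swap)
  also have "\<dots> = (\<Sum>b\<in>fsupp F. \<Sum>k\<in>fsupp K. phi (\<alpha> a (\<lambda>y. F b y * \<alpha> b (K k) y)) * V (b \<otimes> k))"
  proof (rule sum.cong[OF refl])
    fix b assume b: "b \<in> fsupp F"
    have bc: "b \<in> carrier G" using CcD(2)[OF F] b H_carrier by blast
    have cancel: "inv b \<otimes> (b \<otimes> k) = k" if "k \<in> fsupp K" for k
      using H[OF b that] by (simp add: inv_cancel H_carrier)
    have inj: "inj_on (\<lambda>k. b \<otimes> k) (fsupp K)" by (rule inj_onI) (metis cancel)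
    have "(\<Sum>h\<in>?T. phi (\<alpha> a (\<lambda>y. F b y * \<alpha> b (K (inv b \<otimes> h)) y)) * V h)
      = (\<Sum>h\<in>(\<lambda>k. b \<otimes> k) ` fsupp K. phi (\<alpha> a (\<lambda>y. F b y * \<alpha> b (K (inv b \<otimes> h)) y)) * V h)"
    proof (rule sum.mono_neutral_right)
      show "finite ?T" using fin by blast
      show "(\<lambda>k. b \<otimes> k) ` fsupp K \<subseteq> ?T" using b by auto
      show "\<forall>h\<in>?T - (\<lambda>k. b \<otimes> k) ` fsupp K. phi (\<alpha> a (\<lambda>y. F b y * \<alpha> b (K (inv b \<otimes> h)) y)) * V h = 0"
      proof
        fix h assume h: "h \<in> ?T - (\<lambda>k. b \<otimes> k) ` fsupp K"
        then have "h \<in> carrier G" using T H_carrier by blast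
        then have "h = b \<otimes> (inv b \<otimes> h)" using bc by (simp add: inv_cancel)
        then have "inv b \<otimes> h \<notin> fsupp K" using h by blast
        then show "phi (\<alpha> a (\<lambda>y. F b y * \<alpha> b (K (inv b \<otimes> h)) y)) * V h = 0"
          by (simp add: fsupp_zero alpha_zero phi_zero)
      qed
    qed
    also have "\<dots> = (\<Sum>k\<in>fsupp K. phi (\<alpha> a (\<lambda>y. F b y * \<alpha> b (K k) y)) * V (b \<otimes> k))"
      unfolding sum.reindex[OF inj] by (rule sum.cong) (auto simp: cancel)
    finally show "(\<Sum>h\<in>?T. phi (\<alpha> a (\<lambda>y. F b y * \<alpha> b (K (inv b \<otimes> h)) y)) * V h)
      = (\<Sum>k\<in>fsupp K. phi (\<alpha> a (\<lambda>y. F b y * \<alpha> b (K k) y)) * V (b \<otimes> k))" .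
  qed
  finally show ?thesis .
qed

text \<open>The factor \<open>\<alpha>\<^sub>b \<chi>\<^sub>M\<close> is the defect of multiplicativity of the compression.\<close>

lemma phi_V_phi_V:
  assumes "b \<in> H" "k \<in> H" "f \<in> D" "g \<in> D"
  shows "(phi f * V b) * (phi g * V k)
    = phi (\<lambda>y. f y * \<alpha> b g y * \<alpha> b (indicator M) y) * V (b \<otimes> k)"
proof -
  have "(phi f * V b) * (phi g * V k) = phi f * (V b * phi g) * V k" by (simp add: mult.assoc)
  also have "\<dots> = phi f * phi (\<alpha> b g) * (V b * V k)" using assms by (simp add: V_phi mult.assoc)
  also have "\<dots> = phi f * phi (\<alpha> b g) * phi (\<alpha> b (indicator M)) * V (b \<otimes> k)"
    using assms by (simp add: V_V mult.assoc)
  also have "phi f * phi (\<alpha> b g) * phi (\<alpha> b (indicator M)) = phi (\<lambda>y. f y * \<alpha> b g y * \<alpha> b (indicator M) y)"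
    using assms by (simp add: phi_mult D_mult alpha_D indicator_M_D)
  finally show ?thesis .
qed

text \<open>The defect of multiplicativity involves only the values of \<open>K\<close> outside \<open>a\<inverse> M a\<close>, where
  they are small for large \<open>a\<close>.\<close>

lemma compr_asymptotically_multiplicative:
  assumes F: "F \<in> CC" and K: "K \<in> CC"
  shows "((\<lambda>a. compr a (cc_mult G N H F K) - compr a F * compr a K) \<longlongrightarrow> 0) Hp_filter"
proof -
  \<comment> \<open>\<open>r a b k\<close> vanishes on \<open>b M b\<inverse>\<close> and contains the factor \<open>\<alpha>\<^bsub>b a\<^esub> (K k)\<close>\<close>
  define r where "r a b k = (\<lambda>y. \<alpha> a (F b) y * \<alpha> b (\<alpha> a (K k)) y - \<alpha> a (F b) y * \<alpha> b (\<alpha> a (K k)) y * \<alpha> b (indicator M) y)" for a b k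
  have H: "b \<in> H" "k \<in> H" if "b \<in> fsupp F" "k \<in> fsupp K" for b k
    using CcD(2) F K that by blast+
  have FD: "F h \<in> D" "K h \<in> D" for h using CcD F K by auto
  have rD: "r a b k \<in> D" if "a \<in> H" "b \<in> H" for a b k
    unfolding r_def using that FD by (intro D_diff D_mult alpha_D indicator_M_D)
  have eq: "compr a (cc_mult G N H F K) - compr a F * compr a K
     = (\<Sum>b\<in>fsupp F. \<Sum>k\<in>fsupp K. phi (r a b k) * V (b \<otimes> k))" if a: "a \<in> Hp" for a
  proof -
    have aH: "a \<in> H" using a by (rule Hp_H)
    have "compr a F * compr a K
       = (\<Sum>b\<in>fsupp F. \<Sum>k\<in>fsupp K. (phi (\<alpha> a (F b)) * V b) * (phi (\<alpha> a (K k)) * V k))"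
      by (simp add: compr_def sum_product)
    also have "\<dots> = (\<Sum>b\<in>fsupp F. \<Sum>k\<in>fsupp K. phi (\<lambda>y. \<alpha> a (F b) y * \<alpha> b (\<alpha> a (K k)) y * \<alpha> b (indicator M) y) * V (b \<otimes> k))"
      using H FD aH by (intro sum.cong refl phi_V_phi_V alpha_D) auto
    finally have 1: "compr a F * compr a K = \<dots>" .
    have "phi (\<alpha> a (\<lambda>y. F b y * \<alpha> b (K k) y)) * V (b \<otimes> k)
        - phi (\<lambda>y. \<alpha> a (F b) y * \<alpha> b (\<alpha> a (K k)) y * \<alpha> b (indicator M) y) * V (b \<otimes> k)
      = phi (r a b k) * V (b \<otimes> k)" if "b \<in> fsupp F" "k \<in> fsupp K" for b k
    proof -
      have bH: "b \<in> H" using H that by blast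
      have "\<alpha> a (\<lambda>y. F b y * \<alpha> b (K k) y) = (\<lambda>y. \<alpha> a (F b) y * \<alpha> b (\<alpha> a (K k)) y)"
        using bH aH by (simp add: alpha_mult alpha_comp H_carrier H_comm)
      then show ?thesis unfolding r_def
        using bH aH FD by (simp add: phi_diff D_mult alpha_D indicator_M_D left_diff_distrib)
    qed
    then show ?thesis unfolding 1 compr_mult[OF aH F K] by (simp flip: sum_subtractf)
  qed
  have "((\<lambda>a. phi (r a b k) * V (b \<otimes> k)) \<longlongrightarrow> 0) Hp_filter" if bk: "b \<in> fsupp F" "k \<in> fsupp K" for b k
  proof (rule tendstoI)
    fix e :: real assume e: "e > 0"
    note bH = H[OF bk]
    obtain B where B: "B \<ge> 1" "\<And>x. cmod (F b x) \<le> B" using linf_bound[OF D_linf[OF FD(1)]] by blast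
    define d where "d = e / (2 * B)"
    have d: "d > 0" using e B by (simp add: d_def)
    show "\<forall>\<^sub>F a in Hp_filter. dist (phi (r a b k) * V (b \<otimes> k)) 0 < e"
      using D_vanishes_at_infinity[OF FD(2) d, of k] eventually_in_Hp
    proof eventually_elim
      case (elim a)
      have aH: "a \<in> H" using elim by (simp add: Hp_H)
      have rb: "cmod (r a b k y) \<le> B * d" if y: "y \<in> M" for y
      proof (cases "y \<in> U b")
        case True
        then have "r a b k y = 0" using bH by (simp add: r_def alpha_indicator_M)
        then show ?thesis using B d by simp
      next
        case False
        have yN: "y \<in> N" "y \<in> carrier G" using y M_N N_carrier by auto
        \<comment> \<open>the point at which \<open>K k\<close> is evaluated; it lies outside \<open>a\<inverse> M a\<close>\<close>
        define z where "z = \<beta> (inv a) (\<beta> (inv b) y)"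
        have zN: "z \<in> N" using yN aH bH by (simp add: z_def beta_N H_carrier)
        have "\<beta> a z = \<beta> (inv b) y" using yN aH bH by (simp add: z_def beta_cancel H_carrier beta_closed)
        then have "\<beta> a z \<notin> M" using False yN bH by (simp add: mem_U H_carrier)
        then have "cmod (K k z) \<le> d" using elim zN by blast
        moreover have "r a b k y = F b (\<beta> (inv a) y) * K k z"
          using False bH yN by (simp add: r_def alpha_indicator_M) (simp add: alpha_def z_def beta_N H_carrier)
        ultimately show ?thesis using B d by (simp add: norm_mult mult_mono)
      qed
      have "norm (phi (r a b k) * V (b \<otimes> k)) \<le> norm (phi (r a b k)) * norm (V (b \<otimes> k))" by (rule norm_mult_ineq)
      also have "\<dots> \<le> (B * d) * 1"
        using B d by (intro mult_mono phi_bound[OF rD] rb norm_V H_closed(1) aH bH) auto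
      also have "\<dots> < e" using B e by (simp add: d_def)
      finally show ?case by simp
    qed
  qed
  then have "((\<lambda>a. \<Sum>b\<in>fsupp F. \<Sum>k\<in>fsupp K. phi (r a b k) * V (b \<otimes> k)) \<longlongrightarrow> 0) Hp_filter"
    by (intro tendsto_null_sum)
  then show ?thesis
    by (rule Lim_transform_eventually) (use eventually_in_Hp in eventually_elim, simp add: eq)
qed

text \<open>Conjugation by the isometry \<open>S c\<close> undoes the translation by \<open>c\<close>, so the norms increase
  along \<open>H\<^sup>+\<close>.\<close>

lemma norm_compr_mono:
  assumes a: "a \<in> H" and c: "c \<in> Hp" and F: "F \<in> CC"
  shows "norm (compr a F) \<le> norm (compr (a \<otimes> c) F)"
proof -
  have H: "h \<in> H" if "h \<in> fsupp F" for h using CcD(2)[OF F] that by blast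
  have "star (S c) * (phi (\<alpha> (a \<otimes> c) (F h)) * V h) * S c = phi (\<alpha> a (F h)) * V h" if h: "h \<in> fsupp F" for h
  proof -
    have "\<alpha> (inv c) (\<alpha> (a \<otimes> c) (F h)) = \<alpha> a (F h)"
      using a c H[OF h] by (simp add: alpha_comp H_carrier Hp_carrier H_comm[of a c] Hp_H inv_cancel)
    then have "star (S c) * phi (\<alpha> (a \<otimes> c) (F h)) = phi (\<alpha> a (F h)) * star (S c)"
      using S_star_phi[OF c alpha_D[OF _ CcD(3)[OF F]], of "a \<otimes> c"] a c by (simp add: H_closed Hp_H)
    then have "star (S c) * (phi (\<alpha> (a \<otimes> c) (F h)) * V h) * S c = phi (\<alpha> a (F h)) * (star (S c) * V h * S c)"
      by (simp add: mult.assoc[symmetric])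
    then show ?thesis using S_V_S[OF c H[OF h]] by simp
  qed
  then have "compr a F = star (S c) * compr (a \<otimes> c) F * S c"
    by (simp add: compr_def sum_distrib_left sum_distrib_right)
  then have "norm (compr a F) \<le> norm (star (S c)) * norm (compr (a \<otimes> c) F) * norm (S c)"
    by (simp only:) (intro order_trans[OF norm_mult_ineq] mult_right_mono norm_mult_ineq norm_ge_zero)
  also have "\<dots> \<le> 1 * norm (compr (a \<otimes> c) F) * 1"
    using norm_S[OF c] by (intro mult_mono) auto
  finally show ?thesis by simp
qed

lemma compr_bounded:
  assumes F: "F \<in> CC"
  shows "\<exists>B. \<forall>a\<in>Hp. norm (compr a F) \<le> B"
proof -
  have "\<exists>B. \<forall>x. cmod (F h x) \<le> B" for h using D_linf[OF CcD(3)[OF F]] by (simp add: linf_iff)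
  then obtain B where B: "\<And>h x. cmod (F h x) \<le> B h" by metis
  have B0: "0 \<le> B h" for h using B norm_ge_zero order_trans by blast
  have "norm (compr a F) \<le> (\<Sum>h\<in>fsupp F. B h * 1)" if a: "a \<in> Hp" for a
    unfolding compr_def
  proof (rule sum_norm_le)
    fix h assume "h \<in> fsupp F"
    then have h: "h \<in> H" using CcD(2)[OF F] by blast
    have "norm (phi (\<alpha> a (F h))) \<le> B h"
      using a by (intro phi_bound alpha_D Hp_H CcD(3)[OF F] alpha_bound B B0)
    then show "norm (phi (\<alpha> a (F h)) * V h) \<le> B h * 1"
      using B0 by (intro order_trans[OF norm_mult_ineq] mult_mono norm_V[OF h]) auto
  qed
  then show ?thesis by blast
qed

text \<open>As the norms increase along \<open>H\<^sup>+\<close>, this supremum is also their limit.  The first description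
  bounds the compression at \<open>e\<close>, the second makes the C*-identity and submultiplicativity pass from
  the asymptotic relations.\<close>

definition compr_norm :: "('a \<Rightarrow> 'a \<Rightarrow> complex) \<Rightarrow> real" where
  "compr_norm F = (SUP a\<in>Hp. norm (compr a F))"

lemma compr_norm_upper:
  assumes F: "F \<in> CC" and a: "a \<in> Hp"
  shows "norm (compr a F) \<le> compr_norm F"
  unfolding compr_norm_def using compr_bounded[OF F] a by (intro cSUP_upper) (auto simp: bdd_above_def)

lemma compr_norm_tendsto:
  assumes F: "F \<in> CC"
  shows "((\<lambda>a. norm (compr a F)) \<longlongrightarrow> compr_norm F) Hp_filter"
proof (rule order_tendstoI)
  fix l assume "l < compr_norm F"
  then obtain a where a: "a \<in> Hp" "l < norm (compr a F)"
    unfolding compr_norm_def using less_cSUP_iff[of Hp "\<lambda>a. norm (compr a F)" l] compr_bounded[OF F] one_Hp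
    by (auto simp: bdd_above_def)
  show "\<forall>\<^sub>F a in Hp_filter. l < norm (compr a F)"
    by (rule eventually_multiplesI[OF a(1)])
       (rule less_le_trans[OF a(2) norm_compr_mono[OF Hp_H[OF a(1)] _ F]])
next
  fix u assume "u > compr_norm F"
  then show "\<forall>\<^sub>F a in Hp_filter. norm (compr a F) < u"
    using compr_norm_upper[OF F] eventually_in_Hp by (auto elim!: eventually_mono intro: le_less_trans)
qed

lemma compr_norm_seminorm: "cc_cstar_seminorm G N H D compr_norm"
  unfolding cc_cstar_seminorm_def
proof (intro conjI ballI allI)
  fix F assume F: "F \<in> CC"
  note tF = compr_norm_tendsto[OF F]
  show "0 \<le> compr_norm F" by (rule tendsto_lowerbound[OF tF]) auto
  show "compr_norm (\<lambda>h y. c * F h y) = cmod c * compr_norm F" for c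
  proof (rule tendsto_unique[OF Hp_filter_nonbot])
    show "((\<lambda>a. norm (compr a (\<lambda>h y. c * F h y))) \<longlongrightarrow> compr_norm (\<lambda>h y. c * F h y)) Hp_filter"
      by (rule compr_norm_tendsto[OF Cc_scale[OF F]])
    have "((\<lambda>a. cmod c * norm (compr a F)) \<longlongrightarrow> cmod c * compr_norm F) Hp_filter"
      by (intro tendsto_mult tendsto_const tF)
    then show "((\<lambda>a. norm (compr a (\<lambda>h y. c * F h y))) \<longlongrightarrow> cmod c * compr_norm F) Hp_filter"
      by (rule Lim_transform_eventually)
         (use eventually_in_Hp in eventually_elim, simp add: compr_scale[OF Hp_H F] norm_scaleC)
  qed
  {
    fix K assume K: "K \<in> CC"
    note tK = compr_norm_tendsto[OF K]
    show "compr_norm (\<lambda>h y. F h y + K h y) \<le> compr_norm F + compr_norm K"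
    proof (rule tendsto_le[OF Hp_filter_nonbot tendsto_add[OF tF tK] compr_norm_tendsto[OF Cc_add[OF F K]]])
      show "\<forall>\<^sub>F a in Hp_filter. norm (compr a (\<lambda>h y. F h y + K h y)) \<le> norm (compr a F) + norm (compr a K)"
        using eventually_in_Hp by eventually_elim (simp add: compr_add[OF Hp_H F K] norm_triangle_ineq)
    qed
    let ?d = "\<lambda>a. compr a (cc_mult G N H F K) - compr a F * compr a K"
    have d: "((\<lambda>a. norm (?d a)) \<longlongrightarrow> 0) Hp_filter"
      by (rule tendsto_norm_zero[OF compr_asymptotically_multiplicative[OF F K]])
    have "((\<lambda>a. norm (compr a F) * norm (compr a K) + norm (?d a)) \<longlongrightarrow> compr_norm F * compr_norm K + 0) Hp_filter"
      by (intro tendsto_add tendsto_mult tF tK d)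
    then have "compr_norm (cc_mult G N H F K) \<le> compr_norm F * compr_norm K + 0"
    proof (rule tendsto_le[OF Hp_filter_nonbot _ compr_norm_tendsto[OF Cc_mult[OF F K]]])
      have "norm (compr a (cc_mult G N H F K)) \<le> norm (compr a F) * norm (compr a K) + norm (?d a)" for a
        using norm_triangle_ineq[of "compr a F * compr a K" "?d a"] norm_mult_ineq[of "compr a F" "compr a K"] by simp
      then show "\<forall>\<^sub>F a in Hp_filter. norm (compr a (cc_mult G N H F K)) \<le> norm (compr a F) * norm (compr a K) + norm (?d a)"
        by simp
    qed
    then show "compr_norm (cc_mult G N H F K) \<le> compr_norm F * compr_norm K" by simp
  }
  let ?Fs = "cc_star G N H F"
  note Fs = Cc_star[OF F]
  have "((\<lambda>a. norm (compr a (cc_mult G N H ?Fs F)) - norm (compr a ?Fs * compr a F)) \<longlongrightarrow> 0) Hp_filter"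
  proof (rule Lim_null_comparison)
    show "((\<lambda>a. norm (compr a (cc_mult G N H ?Fs F) - compr a ?Fs * compr a F)) \<longlongrightarrow> 0) Hp_filter"
      by (rule tendsto_norm_zero[OF compr_asymptotically_multiplicative[OF Fs F]])
    show "\<forall>\<^sub>F a in Hp_filter. norm (norm (compr a (cc_mult G N H ?Fs F)) - norm (compr a ?Fs * compr a F))
       \<le> norm (compr a (cc_mult G N H ?Fs F) - compr a ?Fs * compr a F)"
      by (simp add: norm_triangle_ineq3)
  qed
  then have 1: "((\<lambda>a. norm (compr a (cc_mult G N H ?Fs F)) - (norm (compr a F))\<^sup>2) \<longlongrightarrow> 0) Hp_filter"
    by (rule Lim_transform_eventually)
       (use eventually_in_Hp in eventually_elim, simp add: compr_star[OF Hp_H F] cstar_identity)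
  have "((\<lambda>a. norm (compr a (cc_mult G N H ?Fs F)) - (norm (compr a F))\<^sup>2)
      \<longlongrightarrow> compr_norm (cc_mult G N H ?Fs F) - (compr_norm F)\<^sup>2) Hp_filter"
    by (intro tendsto_diff tendsto_power tF compr_norm_tendsto[OF Cc_mult[OF Fs F]])
  then show "compr_norm (cc_mult G N H ?Fs F) = (compr_norm F)\<^sup>2"
    using tendsto_unique[OF Hp_filter_nonbot 1] by fastforce
qed

end

section \<open>Monomials in the crossed product\<close>

lemma cstar_cancel_right:
  fixes c d :: "'c::cstar_algebra"
  assumes "\<And>y. c * y = d * y"
  shows "c = d"
proof -
  have "(norm (star (c - d)))\<^sup>2 = norm ((c - d) * star (c - d))"
    by (metis cstar_identity star_star)
  also have "\<dots> = 0" using assms by (simp add: left_diff_distrib)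
  finally show ?thesis by simp
qed

locale crossed_setting = conjugation_setting G N H M for G (structure) and N H M :: "'a set" +
  fixes iD :: "('a \<Rightarrow> complex) \<Rightarrow> 'c::cstar_algebra" and iH :: "'a \<Rightarrow> 'c multiplier"
  assumes FCP: "full_crossed_product G N H (D_alg G N H M) iD iH"
begin

lemma iD_add: "f \<in> D \<Longrightarrow> g \<in> D \<Longrightarrow> iD (\<lambda>x. f x + g x) = iD f + iD g"
  and iD_mult: "f \<in> D \<Longrightarrow> g \<in> D \<Longrightarrow> iD (\<lambda>x. f x * g x) = iD f * iD g"
  and iD_scale: "f \<in> D \<Longrightarrow> iD (\<lambda>x. c * f x) = c *\<^sub>C iD f"
  and iD_star: "f \<in> D \<Longrightarrow> iD (\<lambda>x. cnj (f x)) = star (iD f)"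
  and iH_unitary: "a \<in> H \<Longrightarrow> unitary_multiplier (iH a)"
  and iH_mult: "a \<in> H \<Longrightarrow> b \<in> H \<Longrightarrow> iH (a \<otimes> b) = iH a \<odot> iH b"
  and iH_covariant: "a \<in> H \<Longrightarrow> f \<in> D \<Longrightarrow>
    mult_embed (iD (\<alpha> a f)) = iH a \<odot> mult_embed (iD f) \<odot> mult_star (iH a)"
  using FCP unfolding full_crossed_product_def covariant_hom_def by blast+

lemma iH_multiplier: "a \<in> H \<Longrightarrow> is_multiplier (iH a)"
  using iH_unitary by (simp add: unitary_multiplier_def)

lemma iH_fst_mult: "a \<in> H \<Longrightarrow> fst (iH a) (x * y) = fst (iH a) x * y"
  and iH_snd_mult: "a \<in> H \<Longrightarrow> snd (iH a) (x * y) = x * snd (iH a) y"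
  and iH_middle: "a \<in> H \<Longrightarrow> snd (iH a) x * y = x * fst (iH a) y"
  and iH_snd_scale: "a \<in> H \<Longrightarrow> snd (iH a) (c *\<^sub>C x) = c *\<^sub>C snd (iH a) x"
  using iH_multiplier[of a] unfolding is_multiplier_def by auto

lemma iH_snd_add: "a \<in> H \<Longrightarrow> snd (iH a) (x + y) = snd (iH a) x + snd (iH a) y"
  using iH_multiplier[of a] unfolding is_multiplier_def by (simp add: linear_add bounded_linear.linear)

lemma mult_prod_assoc: "(k \<odot> m) \<odot> n = k \<odot> (m \<odot> n)"
  by (simp add: mult_prod_def comp_assoc)

lemma mult_prod_one: "mult_one \<odot> m = m" "m \<odot> mult_one = m"
  by (simp_all add: mult_prod_def mult_one_def)

lemma iH_one: "iH \<one> = mult_one"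
proof -
  have "iH \<one> \<odot> iH \<one> = iH \<one>" using iH_mult[of \<one> \<one>] H_closed(3) by simp
  then have "(mult_star (iH \<one>) \<odot> iH \<one>) \<odot> iH \<one> = mult_star (iH \<one>) \<odot> iH \<one>"
    by (simp add: mult_prod_assoc)
  then show ?thesis using iH_unitary[OF H_closed(3)] by (simp add: unitary_multiplier_def mult_prod_one)
qed

lemma iH_star:
  assumes a: "a \<in> H"
  shows "mult_star (iH a) = iH (inv a)"
proof -
  have "iH a \<odot> iH (inv a) = mult_one"
    using iH_mult[OF a H_closed(2)[OF a]] a by (simp add: H_carrier iH_one)
  then have "mult_star (iH a) = mult_star (iH a) \<odot> (iH a \<odot> iH (inv a))" by (simp add: mult_prod_one)
  also have "\<dots> = iH (inv a)" using iH_unitary[OF a]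
    by (simp add: unitary_multiplier_def mult_prod_one flip: mult_prod_assoc)
  finally show ?thesis .
qed

text \<open>The product \<open>d h\<close>, formed with the right action of the multiplier \<open>h\<close>.\<close>

definition monomial :: "'a \<Rightarrow> ('a \<Rightarrow> complex) \<Rightarrow> 'c" where
  "monomial h d = snd (iH h) (iD d)"

lemma monomial_one: "monomial \<one> d = iD d"
  by (simp add: monomial_def iH_one mult_one_def)

text \<open>In multiplier notation \<open>h d = \<alpha>\<^sub>h(d) h\<close>.  Both sides are compared after multiplication by
  an arbitrary element from the right, where the covariance relation for \<open>h d h\<inverse>\<close> applies to
  \<open>h y\<close>.\<close>

lemma iH_fst_iD:
  assumes a: "a \<in> H" and f: "f \<in> D"
  shows "fst (iH a) (iD f) = monomial a (\<alpha> a f)"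
proof (rule cstar_cancel_right)
  fix y
  have "iH (inv a) \<odot> iH a = mult_one"
    using iH_mult[OF H_closed(2)[OF a] a] a by (simp add: H_carrier iH_one)
  then have inv: "fst (iH (inv a)) (fst (iH a) y) = y"
    by (metis comp_apply fst_conv id_apply mult_one_def mult_prod_def)
  have "iD (\<alpha> a f) * fst (iH a) y = fst (mult_embed (iD (\<alpha> a f))) (fst (iH a) y)"
    by (simp add: mult_embed_def)
  also have "\<dots> = fst (iH a) (iD f * fst (iH (inv a)) (fst (iH a) y))"
    unfolding iH_covariant[OF a f] iH_star[OF a] by (simp add: mult_prod_def mult_embed_def)
  also have "\<dots> = fst (iH a) (iD f) * y" by (simp add: inv iH_fst_mult[OF a])
  finally show "fst (iH a) (iD f) * y = monomial a (\<alpha> a f) * y"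
    by (simp add: monomial_def iH_middle[OF a])
qed

lemma monomial_mult:
  assumes "h \<in> H" "k \<in> H" "d \<in> D" "e \<in> D"
  shows "monomial h d * monomial k e = monomial (h \<otimes> k) (\<lambda>x. d x * \<alpha> h e x)"
proof -
  have "monomial h d * monomial k e = snd (iH k) (snd (iH h) (iD d) * iD e)"
    using assms by (simp add: monomial_def iH_snd_mult)
  also have "snd (iH h) (iD d) * iD e = snd (iH h) (iD (\<lambda>x. d x * \<alpha> h e x))"
    using assms by (simp add: iH_middle iH_fst_iD monomial_def iD_mult alpha_D iH_snd_mult)
  finally show ?thesis using assms by (simp add: monomial_def iH_mult mult_prod_def)
qed

lemma monomial_star:
  assumes "h \<in> H" "d \<in> D"
  shows "star (monomial h d) = monomial (inv h) (\<alpha> (inv h) (\<lambda>x. cnj (d x)))"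
proof -
  have "star (monomial h d) = fst (mult_star (iH h)) (star (iD d))"
    by (simp add: monomial_def mult_star_def star_star)
  then show ?thesis using assms by (simp add: iH_star iH_fst_iD H_closed D_cnj flip: iD_star)
qed

lemma monomial_add: "h \<in> H \<Longrightarrow> d \<in> D \<Longrightarrow> e \<in> D \<Longrightarrow> monomial h (\<lambda>x. d x + e x) = monomial h d + monomial h e"
  by (simp add: monomial_def iD_add iH_snd_add)

lemma monomial_scale: "h \<in> H \<Longrightarrow> d \<in> D \<Longrightarrow> monomial h (\<lambda>x. c * d x) = c *\<^sub>C monomial h d"
  by (simp add: monomial_def iD_scale iH_snd_scale)

lemma monomial_zero: "h \<in> H \<Longrightarrow> monomial h (\<lambda>x. 0) = 0"
  using monomial_scale[OF _ D_zero, of h 0] by simp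

abbreviation "I \<equiv> integrated_form iD iH"

lemma integrated_eq: "I F = (\<Sum>h\<in>fsupp F. monomial h (F h))"
  by (simp add: integrated_form_def monomial_def)

lemma integrated_superset:
  assumes "finite T" "fsupp F \<subseteq> T" "T \<subseteq> H"
  shows "I F = (\<Sum>h\<in>T. monomial h (F h))"
  unfolding integrated_eq using assms
  by (intro sum.mono_neutral_left) (auto simp: fsupp_zero monomial_zero subset_iff)

lemma integrated_add:
  assumes F: "F \<in> CC" and K: "K \<in> CC"
  shows "I (\<lambda>h y. F h y + K h y) = I F + I K"
proof -
  let ?T = "fsupp F \<union> fsupp K"
  have T: "finite ?T" "?T \<subseteq> H" using CcD[OF F] CcD[OF K] by blast+
  have "I (\<lambda>h y. F h y + K h y) = (\<Sum>h\<in>?T. monomial h (\<lambda>y. F h y + K h y))"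
    by (rule integrated_superset[OF T(1) fsupp_add T(2)])
  also have "\<dots> = (\<Sum>h\<in>?T. monomial h (F h) + monomial h (K h))"
    using T CcD(3)[OF F] CcD(3)[OF K] by (intro sum.cong) (auto simp: monomial_add subset_iff)
  finally show ?thesis using T by (simp add: sum.distrib integrated_superset[of ?T])
qed

lemma integrated_scale:
  assumes F: "F \<in> CC"
  shows "I (\<lambda>h y. c * F h y) = c *\<^sub>C I F"
proof -
  have "I (\<lambda>h y. c * F h y) = (\<Sum>h\<in>fsupp F. monomial h (\<lambda>y. c * F h y))"
    by (rule integrated_superset[OF CcD(1)[OF F] fsupp_scale CcD(2)[OF F]])
  also have "\<dots> = (\<Sum>h\<in>fsupp F. c *\<^sub>C monomial h (F h))"
    using CcD(2)[OF F] CcD(3)[OF F] by (intro sum.cong) (auto simp: monomial_scale subset_iff)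
  finally show ?thesis by (simp add: integrated_eq scaleC_sum_right)
qed

lemma integrated_dense: "closure (I ` CC) = UNIV"
  using FCP unfolding full_crossed_product_def by blast

text \<open>Finite sums of monomials are dense, so identities that are closed and additive need to be
  checked on monomials only.\<close>

lemma monomials_dense:
  assumes "closed A" "0 \<in> A" and add: "\<And>x y. x \<in> A \<Longrightarrow> y \<in> A \<Longrightarrow> x + y \<in> A"
    and mono: "\<And>h d. h \<in> H \<Longrightarrow> d \<in> D \<Longrightarrow> monomial h d \<in> A"
  shows "x \<in> A"
proof -
  have sum: "(\<Sum>h\<in>T. f h) \<in> A" if "finite T" "\<And>h. h \<in> T \<Longrightarrow> f h \<in> A" for T and f :: "'a \<Rightarrow> 'c"
    using that by (induction T) (auto simp: assms)
  have "I F \<in> A" if F: "F \<in> CC" for F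
    unfolding integrated_eq
  proof (rule sum[OF CcD(1)[OF F]])
    fix h assume "h \<in> fsupp F"
    then have "h \<in> H" using CcD(2)[OF F] by blast
    then show "monomial h (F h) \<in> A" by (rule mono[OF _ CcD(3)[OF F]])
  qed
  then have "closure (I ` CC) \<subseteq> A" using assms(1) by (intro closure_minimal) auto
  then show ?thesis using integrated_dense by blast
qed

lemma single_Cc:
  assumes "h \<in> H" "d \<in> D"
  shows "(\<lambda>k. if k = h then d else (\<lambda>y. 0)) \<in> CC" "fsupp (\<lambda>k. if k = h then d else (\<lambda>y. 0)) \<subseteq> {h}"
proof -
  show s: "fsupp (\<lambda>k. if k = h then d else (\<lambda>y. 0)) \<subseteq> {h}" by (auto simp: fsupp_def)
  show "(\<lambda>k. if k = h then d else (\<lambda>y. 0)) \<in> CC"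
    by (rule CcI[OF _ _ s]) (use assms in auto)
qed

abbreviation "p \<equiv> p_elem M iD"

lemma p_eq: "p = monomial \<one> (indicator M)"
  by (simp add: p_elem_def monomial_one)

lemma projection_p: "projection_elem p"
proof -
  have "(\<lambda>x. indicator M x * indicator M x) = (indicator M :: 'a \<Rightarrow> complex)"
    "(\<lambda>x. cnj (indicator M x)) = indicator M" by (auto simp: fun_eq_iff indicator_def)
  then show ?thesis
    using iD_mult[OF indicator_M_D indicator_M_D] iD_star[OF indicator_M_D]
    by (simp add: projection_elem_def p_elem_def)
qed

lemma s_elem_eq:
  assumes a: "a \<in> Hp"
  shows "s_elem M iD iH a = monomial a (indicator (U a))"
proof -
  have aH: "a \<in> H" using a by (rule Hp_H)
  have "s_elem M iD iH a = monomial \<one> (indicator M) * monomial a (\<alpha> a (indicator M))"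
    using aH by (simp add: s_elem_def iH_fst_iD p_elem_def indicator_M_D monomial_one)
  also have "\<dots> = monomial a (\<lambda>x. indicator M x * indicator (U a) x)"
    using aH by (simp add: monomial_mult H_closed indicator_M_D alpha_D alpha_indicator_M H_carrier alpha_one indicator_U_D)
  also have "(\<lambda>x. indicator M x * indicator (U a) x) = (indicator (U a) :: 'a \<Rightarrow> complex)"
    using U_M[OF a] by (auto simp: fun_eq_iff indicator_def)
  finally show ?thesis .
qed

lemma corner_monomial:
  assumes "h \<in> H" "d \<in> D"
  shows "p * monomial h d * p = monomial h (\<lambda>x. indicator M x * d x * \<alpha> h (indicator M) x)"
  using assms unfolding p_eq
  by (simp add: monomial_mult H_closed indicator_M_D D_mult alpha_one H_carrier)

text \<open>For \<open>h = a\<inverse> b\<close> the compressed monomial is a product of canonical elements: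
  \<open>p h p = s\<^sub>a\<^sup>* s\<^sub>b\<close>.\<close>

lemma corner_monomial_factor:
  assumes a: "a \<in> Hp" and b: "b \<in> Hp" and d: "d \<in> D"
  shows "p * monomial (inv a \<otimes> b) d * p
    = iD (\<lambda>x. d x * indicator M x) * (star (s_elem M iD iH a) * s_elem M iD iH b)"
proof -
  have H: "a \<in> H" "b \<in> H" "inv a \<in> H" using a b by (auto simp: Hp_H H_closed)
  have cnj: "(\<lambda>x. cnj (indicator (U a) x)) = indicator (U a)" by (auto simp: fun_eq_iff indicator_def)
  have shift: "\<alpha> (inv a) (indicator (U a)) = indicator M"
    using H by (simp add: alpha_comp H_carrier alpha_one indicator_M_D flip: alpha_indicator_M)
  have "star (s_elem M iD iH a) = monomial (inv a) (indicator M)"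
    using a H by (simp add: s_elem_eq monomial_star indicator_U_D cnj shift)
  then have "star (s_elem M iD iH a) * s_elem M iD iH b
     = monomial (inv a \<otimes> b) (\<lambda>x. indicator M x * \<alpha> (inv a \<otimes> b) (indicator M) x)"
    using b H by (simp add: s_elem_eq monomial_mult indicator_M_D indicator_U_D)
       (simp add: alpha_comp H_carrier flip: alpha_indicator_M)
  then have "iD (\<lambda>x. d x * indicator M x) * (star (s_elem M iD iH a) * s_elem M iD iH b)
    = monomial (inv a \<otimes> b) (\<lambda>x. d x * indicator M x * (indicator M x * \<alpha> (inv a \<otimes> b) (indicator M) x))"
    using d H by (simp add: monomial_one[symmetric] monomial_mult H_closed D_mult indicator_M_D alpha_D alpha_one H_carrier)
  also have "(\<lambda>x. d x * indicator M x * (indicator M x * \<alpha> (inv a \<otimes> b) (indicator M) x))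
     = (\<lambda>x. indicator M x * d x * \<alpha> (inv a \<otimes> b) (indicator M) x)"
    by (auto simp: fun_eq_iff indicator_def)
  finally show ?thesis using d H by (simp add: corner_monomial H_closed)
qed

lemma iD_in_corner:
  assumes "f \<in> D" "\<And>x. x \<notin> M \<Longrightarrow> f x = 0"
  shows "iD f \<in> corner p"
proof -
  have "(\<lambda>x. indicator M x * f x) = f" "(\<lambda>x. f x * indicator M x) = f"
    using assms(2) by (auto simp: fun_eq_iff indicator_def)
  then show ?thesis using iD_mult[OF indicator_M_D assms(1)] iD_mult[OF assms(1) indicator_M_D]
    by (simp add: corner_iff[OF projection_p]) (simp add: p_elem_def)
qed

lemma s_elem_in_corner: "a \<in> Hp \<Longrightarrow> s_elem M iD iH a \<in> corner p"
proof -
  assume a: "a \<in> Hp"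
  have aH: "a \<in> H" using a by (rule Hp_H)
  have "p * monomial a (indicator (U a)) * p = monomial a (indicator (U a))"
    using aH U_M[OF a] by (simp add: corner_monomial indicator_U_D alpha_indicator_M)
      (rule arg_cong[of _ _ "monomial a"], auto simp: fun_eq_iff indicator_def)
  then show ?thesis unfolding corner_def s_elem_eq[OF a] by (metis rangeI)
qed

lemma pam_elem_in_corner:
  assumes "a \<in> Hp" "m \<in> M"
  shows "pam_elem G M iD a m \<in> corner p"
  unfolding pam_elem_def
proof (rule iD_in_corner)
  show "indicator (m <#\<^bsub>G\<^esub> U a) \<in> D" using assms by (simp add: indicator_D M_N Hp_H)
  have "m <#\<^bsub>G\<^esub> U a \<subseteq> M" using U_M[OF assms(1)] M_closed(1) assms(2) by (auto simp: l_coset_def)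
  then show "x \<notin> M \<Longrightarrow> indicator (m <#\<^bsub>G\<^esub> U a) x = (0::complex)" for x by (auto simp: fun_eq_iff indicator_def)
qed

end

section \<open>The homomorphism\<close>

locale sp_crossed_setting = sp_setting G N H M S P + crossed_setting G N H M iD iH
  for G (structure) and N H M :: "'a set" and S :: "'a \<Rightarrow> 'u::unital_cstar_algebra" and P
    and iD :: "('a \<Rightarrow> complex) \<Rightarrow> 'c::cstar_algebra" and iH
begin

lemma norm_compr_le: "F \<in> CC \<Longrightarrow> norm (compr \<one> F) \<le> norm (I F)"
  using FCP compr_norm_seminorm compr_norm_upper[OF _ one_Hp, of F]
  unfolding full_crossed_product_def by (meson order_trans)

text \<open>The largest C*-seminorm dominates the one built from the compressions, so compression
  extends to a contraction on the whole crossed product.\<close>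

lemma compression_exists:
  "\<exists>\<Psi> :: 'c \<Rightarrow> 'u. continuous_on UNIV \<Psi> \<and> (\<forall>x y. \<Psi> (x + y) = \<Psi> x + \<Psi> y)
     \<and> (\<forall>c x. \<Psi> (c *\<^sub>C x) = c *\<^sub>C \<Psi> x) \<and> (\<forall>F\<in>CC. \<Psi> (I F) = compr \<one> F)"
proof -
  define X where "X = I ` CC"
  define f where "f x = compr \<one> (SOME F. F \<in> CC \<and> I F = x)" for x
  have oneH: "\<one> \<in> H" by (rule H_closed)
  have diff: "norm (compr \<one> F - compr \<one> K) \<le> norm (I F - I K)" if F: "F \<in> CC" and K: "K \<in> CC" for F K
  proof -
    note K' = Cc_scale[OF K, of "-1"]
    have "compr \<one> (\<lambda>h y. F h y + (-1) * K h y) = compr \<one> F - compr \<one> K"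
      unfolding compr_add[OF oneH F K'] compr_scale[OF oneH K] by (simp add: scaleC_minus_one)
    moreover have "I (\<lambda>h y. F h y + (-1) * K h y) = I F - I K"
      unfolding integrated_add[OF F K'] integrated_scale[OF K] by (simp add: scaleC_minus_one)
    ultimately show ?thesis using norm_compr_le[OF Cc_add[OF F K']] by simp
  qed
  have fI: "f (I F) = compr \<one> F" if F: "F \<in> CC" for F
  proof -
    have "(SOME K. K \<in> CC \<and> I K = I F) \<in> CC \<and> I (SOME K. K \<in> CC \<and> I K = I F) = I F"
      by (rule someI[where P="\<lambda>K. K \<in> CC \<and> I K = I F"]) (use F in simp)
    then show ?thesis using diff[OF _ F] unfolding f_def by fastforce
  qed
  have "dist (f x) (f y) \<le> dist x y" if "x \<in> X" "y \<in> X" for x y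
    using that diff by (auto simp: X_def fI dist_norm)
  then have "uniformly_continuous_on X f"
    unfolding uniformly_continuous_on_def by (metis le_less_trans)
  then obtain g where g: "uniformly_continuous_on (closure X) g" "\<And>x. x \<in> X \<Longrightarrow> f x = g x"
    using uniformly_continuous_on_extension_on_closure[of X f] by metis
  have cont: "continuous_on UNIV g"
    using uniformly_continuous_imp_continuous[OF g(1)] integrated_dense by (simp add: X_def)
  have gI: "g (I F) = compr \<one> F" if "F \<in> CC" for F using g(2)[of "I F"] that by (simp add: X_def fI)
  have approx: "\<exists>s. (\<forall>n. s n \<in> CC) \<and> (\<lambda>n. I (s n)) \<longlonglongrightarrow> x \<and> (\<lambda>n. compr \<one> (s n)) \<longlonglongrightarrow> g x" for x
  proof -
    have "x \<in> closure X" using integrated_dense by (simp add: X_def)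
    then obtain t where t: "\<And>n. t n \<in> X" "t \<longlonglongrightarrow> x" unfolding closure_sequential by blast
    then obtain s where s: "\<And>n. s n \<in> CC" "\<And>n. t n = I (s n)" unfolding X_def image_iff by metis
    have t': "(\<lambda>n. I (s n)) \<longlonglongrightarrow> x" using t(2) by (simp flip: s(2))
    then have "(\<lambda>n. g (I (s n))) \<longlonglongrightarrow> g x"
      using cont by (auto intro: continuous_on_tendsto_compose)
    then show ?thesis using s(1) t' by (auto simp: gI)
  qed
  have "g (x + y) = g x + g y" for x y
  proof -
    obtain s where s: "\<And>n. s n \<in> CC" "(\<lambda>n. I (s n)) \<longlonglongrightarrow> x" "(\<lambda>n. compr \<one> (s n)) \<longlonglongrightarrow> g x" using approx[of x] by blast
    obtain t where t: "\<And>n. t n \<in> CC" "(\<lambda>n. I (t n)) \<longlonglongrightarrow> y" "(\<lambda>n. compr \<one> (t n)) \<longlonglongrightarrow> g y" using approx[of y] by blast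
    have "(\<lambda>n. g (I (s n) + I (t n))) \<longlonglongrightarrow> g (x + y)"
      by (rule continuous_on_tendsto_compose[OF cont tendsto_add[OF s(2) t(2)]]) auto
    moreover have eq: "g (I (s n) + I (t n)) = compr \<one> (s n) + compr \<one> (t n)" for n
      using gI[OF Cc_add[OF s(1) t(1)]] by (simp add: integrated_add s t compr_add oneH)
    ultimately show ?thesis
      using LIMSEQ_unique[OF _ tendsto_add[OF s(3) t(3)]] unfolding eq by blast
  qed
  moreover have "g (c *\<^sub>C x) = c *\<^sub>C g x" for c x
  proof -
    obtain s where s: "\<And>n. s n \<in> CC" "(\<lambda>n. I (s n)) \<longlonglongrightarrow> x" "(\<lambda>n. compr \<one> (s n)) \<longlonglongrightarrow> g x" using approx[of x] by blast
    have "(\<lambda>n. g (c *\<^sub>C I (s n))) \<longlonglongrightarrow> g (c *\<^sub>C x)"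
      by (rule continuous_on_tendsto_compose[OF cont tendsto_scaleC[OF tendsto_const s(2)]]) auto
    moreover have eq: "g (c *\<^sub>C I (s n)) = c *\<^sub>C compr \<one> (s n)" for n
      using gI[OF Cc_scale[OF s(1)]] by (simp add: integrated_scale s compr_scale oneH)
    ultimately show ?thesis
      using LIMSEQ_unique[OF _ tendsto_scaleC[OF tendsto_const s(3)]] unfolding eq by blast
  qed
  ultimately show ?thesis using cont gI by blast
qed

text \<open>The extended compression; its restriction to the corner is the homomorphism sought.\<close>

definition \<Psi> :: "'c \<Rightarrow> 'u" where
  "\<Psi> = (SOME \<Psi>. continuous_on UNIV \<Psi> \<and> (\<forall>x y. \<Psi> (x + y) = \<Psi> x + \<Psi> y)
     \<and> (\<forall>c x. \<Psi> (c *\<^sub>C x) = c *\<^sub>C \<Psi> x) \<and> (\<forall>F\<in>CC. \<Psi> (I F) = compr \<one> F))"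

lemma Psi_continuous: "continuous_on UNIV \<Psi>"
  and Psi_add: "\<Psi> (x + y) = \<Psi> x + \<Psi> y"
  and Psi_scale: "\<Psi> (c *\<^sub>C x) = c *\<^sub>C \<Psi> x"
  and Psi_integrated: "F \<in> CC \<Longrightarrow> \<Psi> (I F) = compr \<one> F"
  using someI_ex[OF compression_exists, folded \<Psi>_def] by blast+

lemma Psi_zero: "\<Psi> 0 = 0"
  using Psi_scale[of 0 0] by simp

lemma Psi_compose_continuous: "continuous_on UNIV f \<Longrightarrow> continuous_on UNIV (\<lambda>x. \<Psi> (f x))"
  using continuous_on_compose2[OF Psi_continuous] by blast

lemma Psi_monomial:
  assumes "h \<in> H" "d \<in> D"
  shows "\<Psi> (monomial h d) = phi d * V h"
proof -
  define F where "F = (\<lambda>k. if k = h then d else (\<lambda>y. 0))"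
  have F: "F \<in> CC" "fsupp F \<subseteq> {h}" using single_Cc[OF assms] by (auto simp: F_def)
  have "I F = monomial h d" using F assms by (simp add: integrated_superset[of "{h}"]) (simp add: F_def)
  moreover have "compr \<one> F = phi d * V h"
    using F assms by (simp add: compr_superset[of "{h}"]) (simp add: F_def alpha_one)
  ultimately show ?thesis using Psi_integrated[OF F(1)] by simp
qed

text \<open>On monomials both sides are \<open>\<phi>(d \<alpha>\<^sub>h(\<chi>\<^sub>M e)) V\<^bsub>h k\<^esub>\<close>: the defect of multiplicativity of the
  partial representation \<open>V\<close> is exactly what inserting \<open>p\<close> produces.\<close>

lemma Psi_mult: "\<Psi> x * \<Psi> y = \<Psi> (x * p * y)"
proof -
  have mono: "\<Psi> (monomial h d) * \<Psi> (monomial k e) = \<Psi> (monomial h d * p * monomial k e)"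
    if "h \<in> H" "d \<in> D" "k \<in> H" "e \<in> D" for h d k e
  proof -
    have "monomial h d * p * monomial k e = monomial (h \<otimes> k) (\<lambda>x. d x * \<alpha> h (indicator M) x * \<alpha> h e x)"
      using that unfolding p_eq
      by (simp add: monomial_mult H_closed indicator_M_D D_mult alpha_D H_carrier)
    also have "\<Psi> \<dots> = phi (\<lambda>x. d x * \<alpha> h (indicator M) x * \<alpha> h e x) * V (h \<otimes> k)"
      using that by (intro Psi_monomial H_closed D_mult alpha_D indicator_M_D)
    also have "(\<lambda>x. d x * \<alpha> h (indicator M) x * \<alpha> h e x) = (\<lambda>x. d x * \<alpha> h e x * \<alpha> h (indicator M) x)"
      by (simp add: mult_ac)
    finally show ?thesis using that by (simp add: Psi_monomial phi_V_phi_V)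
  qed
  have left: "y \<in> {y. \<Psi> (monomial h d) * \<Psi> y = \<Psi> (monomial h d * p * y)}" if "h \<in> H" "d \<in> D" for h d y
  proof (rule monomials_dense)
    show "closed {y. \<Psi> (monomial h d) * \<Psi> y = \<Psi> (monomial h d * p * y)}"
      by (intro closed_Collect_eq continuous_intros Psi_continuous Psi_compose_continuous)
  qed (auto simp: Psi_zero Psi_add distrib_left mono that)
  have "x \<in> {x. \<Psi> x * \<Psi> y = \<Psi> (x * p * y)}"
  proof (rule monomials_dense)
    show "closed {x. \<Psi> x * \<Psi> y = \<Psi> (x * p * y)}"
      by (intro closed_Collect_eq continuous_intros Psi_continuous Psi_compose_continuous)
  qed (use left in \<open>auto simp: Psi_zero Psi_add distrib_right\<close>)
  then show ?thesis by simp
qed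

lemma Psi_star: "\<Psi> (star x) = star (\<Psi> x)"
proof -
  have "x \<in> {x. \<Psi> (star x) = star (\<Psi> x)}"
  proof (rule monomials_dense)
    show "closed {x. \<Psi> (star x) = star (\<Psi> x)}"
      by (intro closed_Collect_eq Psi_compose_continuous linear_continuous_on bounded_linear_star
          continuous_on_compose2[OF linear_continuous_on[OF bounded_linear_star, of UNIV] Psi_continuous]) simp
    fix h d assume h: "h \<in> H" and d: "d \<in> D"
    have "\<Psi> (star (monomial h d)) = phi (\<alpha> (inv h) (\<lambda>x. cnj (d x))) * V (inv h)"
      using h d by (simp add: monomial_star Psi_monomial H_closed alpha_D D_cnj)
    also have "\<dots> = V (inv h) * phi (\<lambda>x. cnj (d x))" using h d by (simp add: V_phi H_closed D_cnj)
    also have "\<dots> = star (phi d * V h)" using h d by (simp add: star_mult V_star phi_star)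
    finally show "monomial h d \<in> {x. \<Psi> (star x) = star (\<Psi> x)}" using h d by (simp add: Psi_monomial)
  qed (auto simp: Psi_zero Psi_add star_add)
  then show ?thesis by simp
qed

lemma Psi_s_elem: "a \<in> Hp \<Longrightarrow> \<Psi> (s_elem M iD iH a) = S a"
  using phi_V[of a] by (simp add: s_elem_eq Psi_monomial Hp_H indicator_U_D alpha_indicator_M V_Hp)

lemma Psi_pam_elem: "a \<in> Hp \<Longrightarrow> m \<in> M \<Longrightarrow> \<Psi> (pam_elem G M iD a m) = P a m"
  by (simp add: pam_elem_def monomial_one[symmetric] Psi_monomial H_closed indicator_D M_N Hp_H
      phi_coset V_one)

lemma Psi_star_hom: "star_hom_on (corner p) \<Psi>"
  unfolding star_hom_on_def
  by (auto simp: Psi_add Psi_scale Psi_star Psi_mult corner_iff[OF projection_p])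

end

section \<open>Uniqueness\<close>

text \<open>The algebra need not contain constants, so the constant term has to be removed.\<close>

lemma real_polynomial_in_subalgebra:
  assumes A: "cstar_subalgebra_linf N A" and r: "(\<lambda>x. complex_of_real (r x)) \<in> A"
    and q: "real_polynomial_function q"
  shows "(\<lambda>x. complex_of_real (q (r x) - q 0)) \<in> A"
  using q
proof induction
  case (linear f)
  then obtain c where "f = (\<lambda>x. x * c)" using real_bounded_linear by blast
  then show ?case using sub_scale[OF A r, of c] by (simp add: mult.commute)
next
  case (const c)
  then show ?case using sub_zero[OF A] by simp
next
  case (add f g)
  then show ?case using sub_add[OF A add.IH] by (simp add: algebra_simps)
next
  case (mult f g)
  have "(\<lambda>x. complex_of_real (f (r x) - f 0) * complex_of_real (g (r x) - g 0)
      + (f 0 * complex_of_real (g (r x) - g 0) + g 0 * complex_of_real (f (r x) - f 0))) \<in> A"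
    by (intro sub_add[OF A] sub_mult[OF A] sub_scale[OF A] mult.IH)
  then show ?case by (simp add: algebra_simps)
qed

text \<open>Weierstrass approximation on the range of \<open>r\<close>; as \<open>q\<close> vanishes at zero, removing constant
  terms changes the approximating polynomials only slightly.\<close>

lemma continuous_function_in_subalgebra:
  assumes A: "cstar_subalgebra_linf N A" and r: "(\<lambda>x. complex_of_real (r x)) \<in> A"
    and bound: "\<And>x. \<bar>r x\<bar> \<le> 1" and q: "continuous_on {-1..1} q" "q 0 = (0::real)"
  shows "(\<lambda>x. complex_of_real (q (r x))) \<in> A"
proof -
  have "\<exists>g. real_polynomial_function g \<and> (\<forall>x\<in>{-1..1}. \<bar>q x - g x\<bar> < 1 / real (Suc n))" for n
  proof -
    have "compact {-1..1::real}" "0 < 1 / real (Suc n)" by auto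
    then obtain g where "real_polynomial_function g" "\<And>x. x \<in> {-1..1} \<Longrightarrow> \<bar>q x - g x\<bar> < 1 / real (Suc n)"
      using Stone_Weierstrass_real_polynomial_function[OF _ q(1)] by blast
    then show ?thesis by blast
  qed
  then obtain g where g: "\<And>n. real_polynomial_function (g n)"
    "\<And>n x. x \<in> {-1..1} \<Longrightarrow> \<bar>q x - g n x\<bar> < 1 / real (Suc n)" by metis
  have close: "\<bar>(g n (r x) - g n 0) - q (r x)\<bar> < 2 / real (Suc n)" for n x
    using g(2)[of "r x" n] g(2)[of 0 n] bound[of x] q(2) by (simp add: abs_le_iff field_simps abs_less_iff)
  show ?thesis
  proof (rule sub_lim[OF A])
    show "(\<lambda>x. complex_of_real (g n (r x) - g n 0)) \<in> A" for n
      by (rule real_polynomial_in_subalgebra[OF A r g(1)])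
    show "uniform_limit UNIV (\<lambda>n x. complex_of_real (g n (r x) - g n 0)) (\<lambda>x. complex_of_real (q (r x))) sequentially"
    proof (rule uniform_limitI)
      fix e :: real assume "e > 0"
      have "(\<lambda>n. 2 * (1 / real (Suc n))) \<longlonglongrightarrow> 2 * 0"
        by (intro tendsto_mult tendsto_const LIMSEQ_inverse_real_of_nat[unfolded inverse_eq_divide])
      then have "\<forall>\<^sub>F n in sequentially. 2 / real (Suc n) < e"
        using \<open>e > 0\<close> order_tendstoD(2) by fastforce
      then show "\<forall>\<^sub>F n in sequentially. \<forall>x\<in>UNIV. dist (complex_of_real (g n (r x) - g n 0)) (complex_of_real (q (r x))) < e"
      proof eventually_elim
        case (elim n)
        show ?case
        proof
          fix x
          have "dist (complex_of_real (g n (r x) - g n 0)) (complex_of_real (q (r x))) = \<bar>(g n (r x) - g n 0) - q (r x)\<bar>"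
            by (simp only: dist_norm norm_of_real flip: of_real_diff)
          then show "dist (complex_of_real (g n (r x) - g n 0)) (complex_of_real (q (r x))) < e"
            using close[of n x] elim by linarith
        qed
      qed
    qed
  qed
qed

context sp_crossed_setting
begin

context
  fixes \<Phi> :: "'c \<Rightarrow> 'u"
  assumes hom: "star_hom_on (corner p) \<Phi>"
    and Phi_s: "\<And>a. a \<in> Hp \<Longrightarrow> \<Phi> (s_elem M iD iH a) = S a"
    and Phi_pam: "\<And>a m. a \<in> Hp \<Longrightarrow> m \<in> M \<Longrightarrow> \<Phi> (pam_elem G M iD a m) = P a m"
begin

lemma Phi_hom:
  assumes "x \<in> corner p"
  shows "y \<in> corner p \<Longrightarrow> \<Phi> (x + y) = \<Phi> x + \<Phi> y" "y \<in> corner p \<Longrightarrow> \<Phi> (x * y) = \<Phi> x * \<Phi> y"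
    "\<Phi> (c *\<^sub>C x) = c *\<^sub>C \<Phi> x" "\<Phi> (star x) = star (\<Phi> x)"
  using hom assms by (auto simp: star_hom_on_def)

text \<open>\<open>i\<^sub>D\<close> maps these functions into the corner, so \<open>\<Phi> \<circ> i\<^sub>D\<close> is a *-homomorphism on them.\<close>

definition DM :: "('a \<Rightarrow> complex) set" where
  "DM = {f \<in> D. \<forall>x. x \<notin> M \<longrightarrow> f x = 0}"

lemma DM_D: "f \<in> DM \<Longrightarrow> f \<in> D"
  and DM_corner: "f \<in> DM \<Longrightarrow> iD f \<in> corner p"
  by (auto simp: DM_def intro: iD_in_corner)

lemma DM_subalgebra: "f \<in> DM \<Longrightarrow> g \<in> DM \<Longrightarrow> (\<lambda>x. f x + g x) \<in> DM"
  "f \<in> DM \<Longrightarrow> g \<in> DM \<Longrightarrow> (\<lambda>x. f x * g x) \<in> DM"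
  "f \<in> DM \<Longrightarrow> (\<lambda>x. c * f x) \<in> DM" "f \<in> DM \<Longrightarrow> (\<lambda>x. cnj (f x)) \<in> DM"
  "f \<in> DM \<Longrightarrow> g \<in> DM \<Longrightarrow> (\<lambda>x. f x - g x) \<in> DM"
  by (auto simp: DM_def D_add D_mult D_scale D_cnj D_diff)

lemma Phi_iD_add: "f \<in> DM \<Longrightarrow> g \<in> DM \<Longrightarrow> \<Phi> (iD (\<lambda>x. f x + g x)) = \<Phi> (iD f) + \<Phi> (iD g)"
  and Phi_iD_mult: "f \<in> DM \<Longrightarrow> g \<in> DM \<Longrightarrow> \<Phi> (iD (\<lambda>x. f x * g x)) = \<Phi> (iD f) * \<Phi> (iD g)"
  and Phi_iD_scale: "f \<in> DM \<Longrightarrow> \<Phi> (iD (\<lambda>x. c * f x)) = c *\<^sub>C \<Phi> (iD f)"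
  and Phi_iD_star: "f \<in> DM \<Longrightarrow> \<Phi> (iD (\<lambda>x. cnj (f x))) = star (\<Phi> (iD f))"
  by (simp_all add: iD_add iD_mult iD_scale iD_star DM_D DM_corner Phi_hom)

lemma Phi_iD_diff: "f \<in> DM \<Longrightarrow> g \<in> DM \<Longrightarrow> \<Phi> (iD (\<lambda>x. f x - g x)) = \<Phi> (iD f) - \<Phi> (iD g)"
  using Phi_iD_add[OF _ DM_subalgebra(3)[of g "-1"]] Phi_iD_scale[of g "-1"] by (simp add: scaleC_minus_one)

lemma Phi_iD_sum:
  assumes "finite T" "\<And>i. i \<in> T \<Longrightarrow> F i \<in> DM"
  shows "\<Phi> (iD (\<lambda>x. \<Sum>i\<in>T. F i x)) = (\<Sum>i\<in>T. \<Phi> (iD (F i)))"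
proof -
  have "(\<lambda>x. \<Sum>i\<in>T. F i x) \<in> DM \<and> \<Phi> (iD (\<lambda>x. \<Sum>i\<in>T. F i x)) = (\<Sum>i\<in>T. \<Phi> (iD (F i)))"
    using assms
  proof (induction T rule: finite_induct)
    case empty
    have "(\<lambda>x. 0) \<in> DM" by (simp add: DM_def D_zero)
    then show ?case using Phi_iD_scale[of "\<lambda>x. 0" 0] by simp
  next
    case (insert i T)
    then show ?case
      using DM_subalgebra(1)[of "F i" "\<lambda>x. \<Sum>i\<in>T. F i x"] Phi_iD_add[of "F i" "\<lambda>x. \<Sum>i\<in>T. F i x"] by simp
  qed
  then show ?thesis by blast
qed

lemma Phi_p: "\<Phi> p = 1"
proof -
  have "\<one> <#\<^bsub>G\<^esub> U \<one> = M" using M_carrier by (simp add: l_coset_def U_one)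
  then show ?thesis using Phi_pam[OF one_Hp M_closed(3)] by (simp add: pam_elem_def p_elem_def P_one)
qed

text \<open>For a real function \<open>r\<close> bounded by one, \<open>1 - sqrt (1 - r\<^sup>2)\<close> lies in \<open>D\<close> again, which
  makes the sum of squares available that bounds the image of \<open>r\<close>.\<close>

lemma norm_Phi_iD_real:
  assumes r: "(\<lambda>x. complex_of_real (r x)) \<in> DM" and bound: "\<And>x. \<bar>r x\<bar> \<le> 1"
  shows "norm (\<Phi> (iD (\<lambda>x. complex_of_real (r x)))) \<le> 1"
proof -
  define q :: "real \<Rightarrow> real" where "q t = 1 - sqrt (1 - t\<^sup>2)" for t
  define w where "w = (\<lambda>x. complex_of_real (q (r x)))"
  have "w \<in> D" unfolding w_def
    by (rule continuous_function_in_subalgebra[OF D_subalgebra DM_D[OF r] bound])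
       (auto simp: q_def intro!: continuous_intros)
  then have w: "w \<in> DM" using r by (auto simp: DM_def w_def q_def)
  define v where "v = (\<lambda>x. indicator M x - w x)"
  have ind: "indicator M \<in> DM" by (simp add: DM_def indicator_M_D)
  have v: "v \<in> DM" unfolding v_def by (rule DM_subalgebra(5)[OF ind w])
  let ?r = "\<lambda>x. complex_of_real (r x)"
  have "(\<lambda>x. cnj (?r x)) = ?r" "(\<lambda>x. cnj (v x)) = v" by (auto simp: v_def w_def fun_eq_iff indicator_def)
  then have sa: "star (\<Phi> (iD ?r)) = \<Phi> (iD ?r)" "star (\<Phi> (iD v)) = \<Phi> (iD v)"
    using Phi_iD_star[OF r] Phi_iD_star[OF v] by simp_all
  have com: "\<Phi> (iD ?r) * \<Phi> (iD v) = \<Phi> (iD v) * \<Phi> (iD ?r)"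
    using Phi_iD_mult[OF r v] Phi_iD_mult[OF v r] by (simp add: mult.commute)
  have "?r x * ?r x + v x * v x = indicator M x" for x
  proof (cases "x \<in> M")
    case True
    have "(r x)\<^sup>2 \<le> 1" using bound[of x] by (simp add: abs_square_le_1)
    then have 1: "r x * r x + (1 - q (r x)) * (1 - q (r x)) = 1" by (simp add: q_def power2_eq_square)
    have "?r x * ?r x + v x * v x = complex_of_real (r x * r x + (1 - q (r x)) * (1 - q (r x)))"
      using True by (simp add: v_def w_def)
    then show ?thesis using True by (simp add: 1)
  next
    case False
    then show ?thesis using r v by (simp add: DM_def)
  qed
  then have "\<Phi> (iD ?r) * \<Phi> (iD ?r) + \<Phi> (iD v) * \<Phi> (iD v) = 1"
    using Phi_iD_add[OF DM_subalgebra(2)[OF r r] DM_subalgebra(2)[OF v v]] Phi_p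
    by (simp add: Phi_iD_mult[OF r r] Phi_iD_mult[OF v v] p_elem_def)
  then have "(norm (\<Phi> (iD ?r)))\<^sup>2 \<le> norm (1::'u)" by (rule norm_le_sum_of_squares[OF sa com])
  then have "(norm (\<Phi> (iD ?r)))\<^sup>2 \<le> 1\<^sup>2" using norm_one_le_1[where 'a='u] by simp
  then show ?thesis by (rule power2_le_imp_le) simp
qed

lemma norm_Phi_iD:
  assumes f: "f \<in> DM" and e: "e > 0" and bound: "\<And>x. cmod (f x) \<le> e"
  shows "norm (\<Phi> (iD f)) \<le> e"
proof -
  define r where "r x = (cmod (f x))\<^sup>2 / e\<^sup>2" for x
  have sq: "(\<lambda>x. cnj (f x) * f x) = (\<lambda>x. complex_of_real (e\<^sup>2) * complex_of_real (r x))"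
    using e by (simp add: r_def complex_norm_square mult.commute fun_eq_iff flip: of_real_mult of_real_power)
  have ff: "(\<lambda>x. cnj (f x) * f x) \<in> DM" by (intro DM_subalgebra f)
  have "(\<lambda>x. complex_of_real (1 / e\<^sup>2) * (cnj (f x) * f x)) \<in> DM" by (rule DM_subalgebra(3)[OF ff])
  moreover have "(\<lambda>x. complex_of_real (1 / e\<^sup>2) * (cnj (f x) * f x)) = (\<lambda>x. complex_of_real (r x))"
    using fun_cong[OF sq] e by (simp add: fun_eq_iff)
  ultimately have r: "(\<lambda>x. complex_of_real (r x)) \<in> DM" by simp
  have "\<bar>r x\<bar> \<le> 1" for x using bound[of x] e by (simp add: r_def power_mono)
  then have n: "norm (\<Phi> (iD (\<lambda>x. complex_of_real (r x)))) \<le> 1" by (rule norm_Phi_iD_real[OF r])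
  have "(norm (\<Phi> (iD f)))\<^sup>2 = norm (\<Phi> (iD (\<lambda>x. cnj (f x) * f x)))"
    by (simp add: Phi_iD_mult DM_subalgebra(4) f Phi_iD_star cstar_identity)
  also have "\<dots> = e\<^sup>2 * norm (\<Phi> (iD (\<lambda>x. complex_of_real (r x))))"
    unfolding sq Phi_iD_scale[OF r] norm_scaleC by (simp add: norm_power)
  also have "\<dots> \<le> e\<^sup>2" using n by (simp add: mult_left_le)
  finally show ?thesis by (rule power2_le_imp_le) (use e in simp)
qed

text \<open>Both sides are contractive and agree on step functions, where only the values at the cosets
  enter.\<close>

lemma Phi_iD:
  assumes f: "f \<in> DM"
  shows "\<Phi> (iD f) = phi f"
proof -
  have step: "step b f \<in> DM" if "b \<in> Hp" for b
    using that by (simp add: DM_def step_D step_off_M)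
  have step_eq: "\<Phi> (iD (step b f)) = phi (step b f)" if b: "b \<in> Hp" for b
  proof -
    have ind: "indicator c \<in> DM" "\<Phi> (iD (indicator c)) = P b (rep c)" "phi (indicator c) = P b (rep c)"
      if c: "c \<in> cosets b" for c
    proof -
      show "indicator c \<in> DM" using coset_indicator_D[OF b c] coset_subset_M[OF b c]
        by (auto simp: DM_def indicator_def)
      show "\<Phi> (iD (indicator c)) = P b (rep c)" "phi (indicator c) = P b (rep c)"
        using Phi_pam[OF b rep_M[OF b c]] phi_coset[OF b rep_M[OF b c]]
        by (simp_all add: pam_elem_def coset_rep[OF b c])
    qed
    have "\<Phi> (iD (step b f)) = (\<Sum>c\<in>cosets b. \<Phi> (iD (\<lambda>x. f (rep c) * indicator c x)))"
      unfolding step_def by (rule Phi_iD_sum[OF finite_cosets[OF b] DM_subalgebra(3)[OF ind(1)]])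
    also have "\<dots> = (\<Sum>c\<in>cosets b. f (rep c) *\<^sub>C P b (rep c))"
      by (intro sum.cong refl) (simp only: Phi_iD_scale ind)
    also have "\<dots> = phi (step b f)" unfolding step_def
      by (simp add: phi_sum phi_scale D_scale coset_indicator_D[OF b] ind(3))
    finally show ?thesis .
  qed
  have "norm (\<Phi> (iD f) - phi f) \<le> 0 + e" if e: "e > 0" for e
  proof -
    have e2: "e/2 > 0" using e by simp
    have "\<forall>\<^sub>F b in Hp_filter. b \<in> Hp \<and> (\<forall>x\<in>M. cmod (step b f x - f x) \<le> e/2)"
      using eventually_step_close[OF DM_D[OF f] e2] eventually_in_Hp by (intro eventually_conj)
    then obtain b where b: "b \<in> Hp" "\<And>x. x \<in> M \<Longrightarrow> cmod (step b f x - f x) \<le> e/2"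
      using eventually_happens'[OF Hp_filter_nonbot] by blast
    define r where "r = (\<lambda>x. f x - step b f x)"
    have r: "r \<in> DM" unfolding r_def by (rule DM_subalgebra(5)[OF f step[OF b(1)]])
    have rb: "cmod (r x) \<le> e/2" for x
    proof (cases "x \<in> M")
      case True
      then show ?thesis using b(2) by (simp add: r_def norm_minus_commute)
    next
      case False
      then show ?thesis using r e by (simp add: DM_def)
    qed
    have "\<Phi> (iD f) - phi f = \<Phi> (iD r) - phi r"
      unfolding r_def Phi_iD_diff[OF f step[OF b(1)]] phi_diff[OF DM_D[OF f] step_D[OF b(1)]] step_eq[OF b(1)]
      by simp
    also have "norm \<dots> \<le> norm (\<Phi> (iD r)) + norm (phi r)" by (rule norm_triangle_ineq4)
    also have "\<dots> \<le> e/2 + e/2"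
      by (intro add_mono norm_Phi_iD[OF r e2] phi_bound[OF DM_D[OF r]] rb)
    finally show ?thesis by simp
  qed
  then have "norm (\<Phi> (iD f) - phi f) \<le> 0" by (rule field_le_epsilon)
  then show ?thesis by simp
qed

lemma Phi_corner_monomial:
  assumes h: "h \<in> H" and d: "d \<in> D"
  shows "\<Phi> (p * monomial h d * p) = \<Psi> (monomial h d)"
proof -
  obtain a b where ab: "a \<in> Hp" "b \<in> Hp" "h = inv a \<otimes> b" using H_quotient[OF h] .
  define f where "f = (\<lambda>x. d x * indicator M x)"
  have f: "f \<in> DM" using d by (auto simp: f_def DM_def intro!: D_mult indicator_M_D)
  note s = s_elem_in_corner[OF ab(1)] s_elem_in_corner[OF ab(2)]
  have c: "star (s_elem M iD iH a) \<in> corner p"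
    using s(1) projection_p by (simp add: corner_iff[OF projection_p] projection_elem_def) (metis star_mult)
  have cs: "star (s_elem M iD iH a) * s_elem M iD iH b \<in> corner p"
    using c s(2) by (simp add: corner_iff[OF projection_p] mult.assoc) (simp flip: mult.assoc)
  have "\<Phi> (p * monomial h d * p) = phi f * V h"
    unfolding ab(3) corner_monomial_factor[OF ab(1,2) d] f_def[symmetric]
    using ab s c cs f by (simp add: Phi_hom DM_corner Phi_iD Phi_s V_eq)
  also have "phi f = phi d" by (rule phi_cong[OF DM_D[OF f] d]) (simp add: f_def)
  finally show ?thesis using h d by (simp add: Psi_monomial)
qed

text \<open>Automatic continuity extends the agreement on compressed monomials to their closure.\<close>

lemma Phi_unique:
  assumes x: "x \<in> corner p"
  shows "\<Phi> x = \<Psi> x"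
proof -
  have pp: "p * p = p" using projection_p by (simp add: projection_elem_def)
  have pxp: "p * y * p \<in> corner p" for y by (auto simp: corner_def)
  have diff: "\<Phi> (y - z) = \<Phi> y - \<Phi> z" if "y \<in> corner p" "z \<in> corner p" for y z
  proof -
    have "(-1) *\<^sub>C z \<in> corner p" using that(2)
      by (simp add: corner_iff[OF projection_p] mult_scaleC_left mult_scaleC_right)
    then show ?thesis using Phi_hom(1)[OF that(1), of "(-1) *\<^sub>C z"] Phi_hom(3)[OF that(2), of "-1"]
      by (simp add: scaleC_minus_one)
  qed
  have "continuous_on UNIV (\<lambda>y. \<Phi> (p * y * p))"
  proof (rule continuous_on_subset[OF _ subset_refl], rule continuous_onI)
    fix y e assume e: "(0::real) < e"
    have lip: "dist (\<Phi> (p * z * p)) (\<Phi> (p * y * p)) \<le> dist z y" for z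
    proof -
      have "norm (\<Phi> (p * z * p) - \<Phi> (p * y * p)) = norm (\<Phi> (p * (z - y) * p))"
        by (simp only: diff[OF pxp pxp] right_diff_distrib left_diff_distrib)
      also have "\<dots> \<le> norm (p * (z - y) * p)" by (rule star_hom_on_corner_contractive[OF projection_p hom pxp])
      also have "\<dots> \<le> norm p * norm (z - y) * norm p"
        by (intro order_trans[OF norm_mult_ineq] mult_right_mono norm_mult_ineq norm_ge_zero)
      also have "\<dots> \<le> 1 * norm (z - y) * 1"
        using norm_projection_le_1[OF projection_p] by (intro mult_mono) auto
      finally show ?thesis by (simp add: dist_norm)
    qed
    show "\<exists>d>0. \<forall>z\<in>UNIV. dist z y < d \<longrightarrow> dist (\<Phi> (p * z * p)) (\<Phi> (p * y * p)) \<le> e"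
      using e lip by (meson less_imp_le order_trans)
  qed
  then have "closed {y. \<Phi> (p * y * p) = \<Psi> y}" by (intro closed_Collect_eq Psi_continuous)
  then have "x \<in> {y. \<Phi> (p * y * p) = \<Psi> y}"
  proof (rule monomials_dense)
    show "0 \<in> {y. \<Phi> (p * y * p) = \<Psi> y}" using diff[OF pxp pxp, of 0 0] by (simp add: Psi_zero)
    show "y + z \<in> {y. \<Phi> (p * y * p) = \<Psi> y}" if "y \<in> {y. \<Phi> (p * y * p) = \<Psi> y}" "z \<in> {y. \<Phi> (p * y * p) = \<Psi> y}" for y z
      using that Phi_hom(1)[OF pxp pxp, of y z] by (simp add: distrib_left distrib_right Psi_add)
  qed (simp add: Phi_corner_monomial)
  moreover have "p * x * p = x" using x by (simp add: corner_iff[OF projection_p])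
  ultimately show ?thesis by simp
qed

end

theorem universal_property:
  "\<exists>!\<Phi>. \<Phi> \<in> extensional (corner p) \<and> star_hom_on (corner p) \<Phi> \<and>
     (\<forall>a\<in>Hp. \<Phi> (s_elem M iD iH a) = S a) \<and>
     (\<forall>a\<in>Hp. \<forall>m\<in>M. \<Phi> (pam_elem G M iD a m) = P a m)"
proof (rule ex1I[of _ "restrict \<Psi> (corner p)"])
  note cp = corner_iff[OF projection_p]
  have sp: "star p = p" using projection_p by (simp add: projection_elem_def)
  have mult: "x * y \<in> corner p" if "x \<in> corner p" "y \<in> corner p" for x y
  proof -
    have "p * (x * y) = p * x * y" "x * y * p = x * (y * p)" by (simp_all only: mult.assoc)
    then show ?thesis using that by (simp add: cp)
  qed
  have star: "star x \<in> corner p" if "x \<in> corner p" for x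
    using that sp star_mult[of p x] star_mult[of x p] by (simp add: cp)
  have add: "x + y \<in> corner p" if "x \<in> corner p" "y \<in> corner p" for x y
    using that by (simp add: cp distrib_left distrib_right)
  have scale: "c *\<^sub>C x \<in> corner p" if "x \<in> corner p" for c x
    using that by (simp add: cp mult_scaleC_left mult_scaleC_right)
  have "star_hom_on (corner p) (restrict \<Psi> (corner p))"
    using Psi_star_hom unfolding star_hom_on_def by (simp add: mult star add scale)
  moreover have "restrict \<Psi> (corner p) (s_elem M iD iH a) = S a" if "a \<in> Hp" for a
    by (simp only: restrict_apply' s_elem_in_corner[OF that] Psi_s_elem[OF that])
  moreover have "restrict \<Psi> (corner p) (pam_elem G M iD a m) = P a m" if "a \<in> Hp" "m \<in> M" for a m
    by (simp only: restrict_apply' pam_elem_in_corner[OF that] Psi_pam_elem[OF that])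
  ultimately show "restrict \<Psi> (corner p) \<in> extensional (corner p) \<and> star_hom_on (corner p) (restrict \<Psi> (corner p)) \<and>
     (\<forall>a\<in>Hp. restrict \<Psi> (corner p) (s_elem M iD iH a) = S a) \<and>
     (\<forall>a\<in>Hp. \<forall>m\<in>M. restrict \<Psi> (corner p) (pam_elem G M iD a m) = P a m)"
    using restrict_extensional by blast
  fix \<Phi>
  assume "\<Phi> \<in> extensional (corner p) \<and> star_hom_on (corner p) \<Phi> \<and>
     (\<forall>a\<in>Hp. \<Phi> (s_elem M iD iH a) = S a) \<and>
     (\<forall>a\<in>Hp. \<forall>m\<in>M. \<Phi> (pam_elem G M iD a m) = P a m)"
  then have ext: "\<Phi> \<in> extensional (corner p)" and hom: "star_hom_on (corner p) \<Phi>"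
    and s: "\<And>a. a \<in> Hp \<Longrightarrow> \<Phi> (s_elem M iD iH a) = S a"
    and pam: "\<And>a m. a \<in> Hp \<Longrightarrow> m \<in> M \<Longrightarrow> \<Phi> (pam_elem G M iD a m) = P a m"
    by blast+
  show "\<Phi> = restrict \<Psi> (corner p)"
  proof (rule extensionalityI[OF ext restrict_extensional])
    fix x assume x: "x \<in> corner p"
    show "\<Phi> x = restrict \<Psi> (corner p) x"
      using Phi_unique[OF hom s pam x] x by simp
  qed
qed

end

theorem theorem9p10:
  fixes G :: "('g, 'm) monoid_scheme"
    and N H M :: "'g set"
    and iD :: "('g \<Rightarrow> complex) \<Rightarrow> 'c::cstar_algebra"
    and iH :: "'g \<Rightarrow> 'c multiplier"
    and S :: "'g \<Rightarrow> 'b::unital_cstar_algebra"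
    and P :: "'g \<Rightarrow> 'g \<Rightarrow> 'b"
  assumes "internal_semidirect G N H"
    and "M \<lhd> (G\<lparr>carrier := N\<rparr>)" and "M \<noteq> {\<one>\<^bsub>G\<^esub>}"
    and "filter_base (conjugates G H M)"
    and "\<Inter> (conjugates G H M) = {\<one>\<^bsub>G\<^esub>}"
    and "finite_quotients G (conjugates G H M)"
    and "\<forall>a\<in>H. \<forall>b\<in>H. a \<otimes>\<^bsub>G\<^esub> b = b \<otimes>\<^bsub>G\<^esub> a"
    and "N = (\<Union>a\<in>Hplus G H M. conj_set G (inv\<^bsub>G\<^esub> a) M)"
    and "full_crossed_product G N H (D_alg G N H M) iD iH"
    and "SP_family G H M S P"
  shows "\<exists>!\<Phi>. \<Phi> \<in> extensional (corner (p_elem M iD)) \<and>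
            star_hom_on (corner (p_elem M iD)) \<Phi> \<and>
            (\<forall>a\<in>Hplus G H M. \<Phi> (s_elem M iD iH a) = S a) \<and>
            (\<forall>a\<in>Hplus G H M. \<forall>m\<in>M. \<Phi> (pam_elem G M iD a m) = P a m)"
proof -
  have grp: "group G" and N: "N \<lhd> G" and H: "subgroup H G"
    using assms(1) by (auto simp: internal_semidirect_def)
  have MN: "subgroup M (G\<lparr>carrier := N\<rparr>)" using assms(2) by (rule normal_imp_subgroup)
  have M: "subgroup M G"
    by (rule group.incl_subgroup[OF grp normal_imp_subgroup[OF N] MN])
  have "M \<subseteq> N" using subgroup.subset[OF MN] by simp
  then interpret sp_crossed_setting G N H M S P iD iH
    using grp N H M assms
    by (intro sp_crossed_setting.intro sp_setting.intro crossed_setting.intro conjugation_setting.intro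
         conjugation_setting_axioms.intro sp_setting_axioms.intro crossed_setting_axioms.intro) auto
  show ?thesis by (rule universal_property)
qed

end
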